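(* Let $\ell>0$, let $g,h\in C^1([0,\ell])$ be real-valued functions such that $d:=h(x)-g(x)$ is a positive constant independent of $x\in[0,\ell]$, and let $$\Omega = \left\{ (x, y)^\top\in\mathbb{R}^2: 0 < x < \ell,\ g (x) < y < h (x) \right\}.$$ Define $$\lambda_\pm = \frac{\pi^2}{2 \ell d} \Bigg( \frac{d}{\ell} + \frac{1}{d} \int_0^\ell \big( 1 + g' (x)^2 \big)\, dx \pm \sqrt{\bigg( \frac{d}{\ell} - \frac{1}{d} \int_0^\ell \big( 1 + g' (x)^2 \big)\, dx \bigg)^2 + \frac{64}{\pi^2 \ell^2} \bigg( \int_0^\ell g' (x) \sin (\pi x / \ell)\, dx \bigg)^2} \Bigg).$$ Then $$\text{(i)}\quad \mu_2 (\Omega) \leq \lambda_- \quad \text{and} \quad \mu_3 (\Omega) \leq \lambda_+ .$$ In particular, $$\text{(ii)}\quad \mu_2 (\Omega) \leq \min \left\{ \frac{\pi^2}{\ell^2}, \frac{\pi^2}{d^2 \ell} \int_0^\ell \big( 1 + g' (x)^2 \big)\, dx \right\}$$ and $$\text{(iii)}\quad \frac{\mu_2 (\Omega) + \mu_3 (\Omega)}{2} \leq \frac{\pi^2}{2} \bigg( \frac{1}{\ell^2} + \frac{1}{\ell d^2} \int_0^\ell \big(1 + g' (x)^2 \big)\, dx \bigg)$$ hold. Moreover, equality in the first estimate of (i) (that is, $\mu_2(\Omega)=\lambda_-$) holds if and only if $\Omega$ is a rectangle, and equality in (ii) holds if and only if $\Omega$ is a rectangle.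
   Context: For a bounded, connected Lipschitz domain $\Omega\subset\mathbb{R}^2$, $0=\mu_1(\Omega)<\mu_2(\Omega)\le\mu_3(\Omega)\le\dots$ denote the eigenvalues, counted with multiplicities, of the Neumann Laplacian on $\Omega$, that is, of the self-adjoint operator in $L^2(\Omega)$ associated with the quadratic form $u\mapsto\int_\Omega|\nabla u|^2$ with domain $H^1(\Omega)$. *)

theory Defs
  imports "HOL-Analysis.Analysis" "HOL-Library.Extended_Nat"
begin

text \<open>Functions are genuine functions on the whole space; only their values on the domain
  matter, and elements of \<open>L\<^sup>2\<close> and \<open>H\<^sup>1\<close> are representatives of classes modulo equality almost
  everywhere on the domain.  All spaces are real.\<close>

definition L2_on :: "'a::euclidean_space set \<Rightarrow> ('a \<Rightarrow> 'b::euclidean_space) set" where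
  "L2_on \<Omega> = {f. f \<in> borel_measurable (lebesgue_on \<Omega>) \<and>
                  integrable (lebesgue_on \<Omega>) (\<lambda>x. (norm (f x))\<^sup>2)}"

definition partial_deriv :: "'a::euclidean_space \<Rightarrow> ('a \<Rightarrow> real) \<Rightarrow> 'a \<Rightarrow> real" where
  "partial_deriv b f x = frechet_derivative f (at x) b"

primrec Ck :: "nat \<Rightarrow> ('a::euclidean_space \<Rightarrow> real) \<Rightarrow> bool" where
  "Ck 0 f \<longleftrightarrow> continuous_on UNIV f"
| "Ck (Suc n) f \<longleftrightarrow> (\<forall>x. f differentiable (at x)) \<and> (\<forall>b\<in>Basis. Ck n (partial_deriv b f))"

text \<open>The space \<open>C\<^sub>c\<^sup>\<infinity>\<close> of the domain; its elements are extended by zero to the whole space.\<close>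

definition test_functions :: "'a::euclidean_space set \<Rightarrow> ('a \<Rightarrow> real) set" where
  "test_functions \<Omega> = {\<phi>. (\<forall>n. Ck n \<phi>) \<and> compact (closure {x. \<phi> x \<noteq> 0}) \<and>
                            closure {x. \<phi> x \<noteq> 0} \<subseteq> \<Omega>}"

definition has_weak_gradient ::
    "'a::euclidean_space set \<Rightarrow> ('a \<Rightarrow> real) \<Rightarrow> ('a \<Rightarrow> 'a) \<Rightarrow> bool" where
  "has_weak_gradient \<Omega> u G \<longleftrightarrow> u \<in> L2_on \<Omega> \<and> G \<in> L2_on \<Omega> \<and>
     (\<forall>\<phi>\<in>test_functions \<Omega>. \<forall>b\<in>Basis.
        (LINT x|lebesgue_on \<Omega>. u x * partial_deriv b \<phi> x)
          = - (LINT x|lebesgue_on \<Omega>. (G x \<bullet> b) * \<phi> x))"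

definition H1 :: "'a::euclidean_space set \<Rightarrow> ('a \<Rightarrow> real) set" where
  "H1 \<Omega> = {u. \<exists>G. has_weak_gradient \<Omega> u G}"

text \<open>For an open domain the weak gradient is unique up to null sets, so the choice below does
  not affect any integral.\<close>

definition weak_gradient :: "'a::euclidean_space set \<Rightarrow> ('a \<Rightarrow> real) \<Rightarrow> 'a \<Rightarrow> 'a" where
  "weak_gradient \<Omega> u = (SOME G. has_weak_gradient \<Omega> u G)"

text \<open>The symmetric bilinear form, with form domain \<open>H1 \<Omega>\<close>, that polarises the quadratic form
  given by the integral of the squared length of the gradient.\<close>

definition dirichlet_form ::
    "'a::euclidean_space set \<Rightarrow> ('a \<Rightarrow> real) \<Rightarrow> ('a \<Rightarrow> real) \<Rightarrow> real" where
  "dirichlet_form \<Omega> u v = (LINT x|lebesgue_on \<Omega>. weak_gradient \<Omega> u x \<bullet> weak_gradient \<Omega> v x)"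

text \<open>The graph of the self-adjoint operator associated with the form: \<open>u\<close> is in the operator
  domain and is mapped to \<open>f\<close>.\<close>

definition neumann_laplacian ::
    "'a::euclidean_space set \<Rightarrow> ('a \<Rightarrow> real) \<Rightarrow> ('a \<Rightarrow> real) \<Rightarrow> bool" where
  "neumann_laplacian \<Omega> u f \<longleftrightarrow> u \<in> H1 \<Omega> \<and> f \<in> L2_on \<Omega> \<and>
     (\<forall>v\<in>H1 \<Omega>. dirichlet_form \<Omega> u v = (LINT x|lebesgue_on \<Omega>. f x * v x))"

definition neumann_eigenspace :: "'a::euclidean_space set \<Rightarrow> real \<Rightarrow> ('a \<Rightarrow> real) set" where
  "neumann_eigenspace \<Omega> \<mu> = {u. neumann_laplacian \<Omega> u (\<lambda>x. \<mu> * u x)}"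

definition lin_indep_ae ::
    "'a::euclidean_space set \<Rightarrow> nat \<Rightarrow> (nat \<Rightarrow> 'a \<Rightarrow> real) \<Rightarrow> bool" where
  "lin_indep_ae \<Omega> m u \<longleftrightarrow>
     (\<forall>c. (AE x in lebesgue_on \<Omega>. (\<Sum>i<m. c i * u i x) = 0) \<longrightarrow> (\<forall>i<m. c i = 0))"

text \<open>The dimension of the eigenspace in \<open>L\<^sup>2\<close>; it is \<open>0\<close> if \<open>\<mu>\<close> is not an eigenvalue.\<close>

definition neumann_multiplicity :: "'a::euclidean_space set \<Rightarrow> real \<Rightarrow> enat" where
  "neumann_multiplicity \<Omega> \<mu> =
     (SUP m\<in>{m. \<exists>u. (\<forall>i<m. u i \<in> neumann_eigenspace \<Omega> \<mu>) \<and> lin_indep_ae \<Omega> m u}. enat m)"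

text \<open>The number of eigenvalues not exceeding \<open>\<mu>\<close>, counted with multiplicities: the sum of all
  multiplicities over \<open>{..\<mu>}\<close>, as a supremum of finite partial sums.\<close>

definition neumann_count :: "'a::euclidean_space set \<Rightarrow> real \<Rightarrow> enat" where
  "neumann_count \<Omega> \<mu> =
     (SUP F\<in>{F. finite F \<and> F \<subseteq> {..\<mu>}}. \<Sum>\<nu>\<in>F. neumann_multiplicity \<Omega> \<nu>)"

text \<open>The \<open>k\<close>-th eigenvalue in nondecreasing order with multiplicities, where the numbering
  starts at \<open>k = 1\<close>.\<close>

definition neumann_eigenvalue :: "'a::euclidean_space set \<Rightarrow> nat \<Rightarrow> real" where
  "neumann_eigenvalue \<Omega> k = (LEAST \<mu>. enat k \<le> neumann_count \<Omega> \<mu>)"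

text \<open>Open, nondegenerate rectangles in arbitrary position.\<close>

definition is_rectangle :: "(real \<times> real) set \<Rightarrow> bool" where
  "is_rectangle R \<longleftrightarrow>
     (\<exists>p e f a b. norm e = 1 \<and> norm f = 1 \<and> e \<bullet> f = 0 \<and> 0 < a \<and> 0 < b \<and>
        R = {p + s *\<^sub>R e + t *\<^sub>R f | s t. 0 < s \<and> s < a \<and> 0 < t \<and> t < b})"

end

theory Submission
  imports Defs "HOL-Complex_Analysis.Great_Picard" "HOL-Real_Asymp.Real_Asymp"
begin

text \<open>The functions \<open>cos (\<pi> x / l)\<close> and \<open>cos (\<pi> (y - g x) / d)\<close> are orthogonal to each other and
  to the constants, and their Rayleigh quotient matrix has the eigenvalues \<open>\<lambda>\<^sub>\<plusminus>\<close>; the estimates are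
  thus the Rayleigh--Ritz principle.  If \<open>\<mu>\<^sub>2 = \<lambda>\<^sub>-\<close>, then a linear combination of the two trial
  functions is an eigenfunction, and testing its weak equation with products
  \<open>p x * cos (k \<pi> (y - g x) / d)\<close> yields \<open>g' = 0\<close>.

  The products \<open>cos (j \<pi> x / l) * cos (k \<pi> (y - g x) / d)\<close> form a complete orthogonal system of the
  domain, by the Stone--Weierstrass theorem.  Weak derivatives along \<open>(1, g')\<close> and \<open>(0, 1)\<close> act on the
  coefficients of a function in this system by multiplication with \<open>j \<pi> / l\<close> and \<open>k \<pi> / d\<close>, so
  Bessel's inequality gives the compactness of the embedding of \<open>H\<^sup>1\<close> into \<open>L\<^sup>2\<close>, hence the existence of
  the eigenfunctions.  For \<open>g' = 0\<close> the system consists of the eigenfunctions of the rectangle.\<close>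

section \<open>Smooth functions\<close>

text \<open>Since \<open>g\<close> is only C^1, neither the shear taking \<open>(x, y)\<close> to
  \<open>(x, y - g x)\<close> nor the functions \<open>A x * B (y - g x)\<close> fit the weak
  definition of the gradient, which speaks of smooth test functions. Integration by parts is
  therefore carried out with polynomials in place of \<open>g\<close> and with cutoffs in both
  variables, and both are removed by dominated convergence. A factor that is differentiated has to
  vanish at its end points; this is why cosine coefficients of a function match sine coefficients of
  its derivatives, and it takes the place of traces and extension operators.

  Relative to the common squared norm \<open>l * d / 2\<close> the trial functions have the energy
  matrix with diagonal \<open>A = pi^2 / l^2\<close>, \<open>B = pi^2 / (d^2 * l) * I2\<close> and
  off-diagonal entry \<open>c = - (4 * pi / (l^2 * d)) * S1\<close>; the 64 in \<lambda>_- is 4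
  times the square of the 4 in \<open>c\<close>. The smaller eigenvalue is at most each diagonal
  entry, which is (ii), and the trace gives (iii). As \<mu>_2 \<le> \<lambda>_- \<le>
  \<open>min A B\<close>, equality in (ii) is a case of equality in (i).\<close>

lemma Ck_continuous: "Ck n f \<Longrightarrow> continuous_on UNIV f"
  by (cases n) (auto intro!: continuous_at_imp_continuous_on differentiable_imp_continuous_within)

lemma Ck_Suc_D: "Ck (Suc n) f \<Longrightarrow> Ck n f"
proof (induction n arbitrary: f)
  case 0
  then show ?case using Ck_continuous by fastforce
next
  case (Suc n)
  then show ?case by (meson Ck.simps(2))
qed

text \<open>Any explicit derivative may stand in for \<open>frechet_derivative\<close>, so the
  closure properties below become inductions on \<open>n\<close> over derivative formulas.\<close>

lemma Ck_SucI:
  assumes "\<And>x. (f has_derivative D x) (at x)" "\<And>b. b \<in> Basis \<Longrightarrow> Ck n (\<lambda>x. D x b)"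
  shows "Ck (Suc n) f"
proof -
  have "partial_deriv b f = (\<lambda>x. D x b)" for b
    using frechet_derivative_at[OF assms(1)] by (auto simp: partial_deriv_def)
  then show ?thesis using assms by (auto simp: differentiable_def)
qed

lemma partial_deriv_eq: "(f has_derivative D) (at x) \<Longrightarrow> partial_deriv b f x = D b"
  using frechet_derivative_at[of f D x] by (simp add: partial_deriv_def)

lemma Ck_SucE:
  assumes "Ck (Suc n) f"
  obtains D where "\<And>x. (f has_derivative D x) (at x)" "\<And>b. b \<in> Basis \<Longrightarrow> Ck n (\<lambda>x. D x b)"
proof
  show "(f has_derivative frechet_derivative f (at x)) (at x)" for x
    using assms frechet_derivative_works by auto
  show "Ck n (\<lambda>x. frechet_derivative f (at x) b)" if "b \<in> Basis" for b
    using assms that by (simp add: partial_deriv_def[abs_def])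
qed

lemma Ck_const: "Ck n (\<lambda>x. c)"
proof (induction n arbitrary: c)
  case 0
  then show ?case by simp
next
  case (Suc n)
  show ?case by (rule Ck_SucI[where D="\<lambda>x b. 0"]) (auto simp: Suc)
qed

lemma Ck_linear: "bounded_linear f \<Longrightarrow> Ck n f"
proof (cases n)
  case 0
  assume "bounded_linear f" with 0 show ?thesis by (simp add: linear_continuous_on)
next
  case (Suc m)
  assume "bounded_linear f"
  then have "Ck (Suc m) f"
    by (intro Ck_SucI[where D="\<lambda>x. f"] Ck_const bounded_linear_imp_has_derivative)
  with Suc show ?thesis by simp
qed

lemma Ck_add: "Ck n f \<Longrightarrow> Ck n g \<Longrightarrow> Ck n (\<lambda>x. f x + g x)"
proof (induction n arbitrary: f g)
  case 0
  then show ?case by (simp add: continuous_on_add)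
next
  case (Suc n)
  obtain D where D: "\<And>x. (f has_derivative D x) (at x)" "\<And>b. b \<in> Basis \<Longrightarrow> Ck n (\<lambda>x. D x b)"
    using Ck_SucE Suc.prems(1) by blast
  obtain E where E: "\<And>x. (g has_derivative E x) (at x)" "\<And>b. b \<in> Basis \<Longrightarrow> Ck n (\<lambda>x. E x b)"
    using Ck_SucE Suc.prems(2) by blast
  show ?case
    by (rule Ck_SucI[where D="\<lambda>x b. D x b + E x b"]) (auto intro!: derivative_intros Suc.IH D E)
qed

lemma Ck_mult: "Ck n f \<Longrightarrow> Ck n g \<Longrightarrow> Ck n (\<lambda>x. f x * g x)"
proof (induction n arbitrary: f g)
  case 0
  then show ?case by (simp add: continuous_on_mult)
next
  case (Suc n)
  obtain D where D: "\<And>x. (f has_derivative D x) (at x)" "\<And>b. b \<in> Basis \<Longrightarrow> Ck n (\<lambda>x. D x b)"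
    using Ck_SucE Suc.prems(1) by blast
  obtain E where E: "\<And>x. (g has_derivative E x) (at x)" "\<And>b. b \<in> Basis \<Longrightarrow> Ck n (\<lambda>x. E x b)"
    using Ck_SucE Suc.prems(2) by blast
  show ?case
    by (rule Ck_SucI[where D="\<lambda>x b. f x * E x b + D x b * g x"])
      (auto intro!: derivative_intros Suc.IH Ck_add D E Ck_Suc_D[OF Suc.prems(1)] Ck_Suc_D[OF Suc.prems(2)])
qed

lemma Ck_minus: "Ck n f \<Longrightarrow> Ck n g \<Longrightarrow> Ck n (\<lambda>x. f x - g x)"
  using Ck_add[of n f "\<lambda>x. (-1) * g x"] Ck_mult[OF Ck_const[of n "-1"], of g] by simp

lemma Ck_compose:
  fixes F :: "real \<Rightarrow> real"
  shows "Ck n F \<Longrightarrow> Ck n f \<Longrightarrow> Ck n (\<lambda>x. F (f x))"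
proof (induction n arbitrary: F f)
  case 0
  then show ?case by (simp add: continuous_on_compose2)
next
  case (Suc n)
  obtain D where D: "\<And>x. (F has_derivative D x) (at x)" "\<And>b. b \<in> Basis \<Longrightarrow> Ck n (\<lambda>x. D x b)"
    using Ck_SucE Suc.prems(1) by blast
  obtain E where E: "\<And>x. (f has_derivative E x) (at x)" "\<And>b. b \<in> Basis \<Longrightarrow> Ck n (\<lambda>x. E x b)"
    using Ck_SucE Suc.prems(2) by blast
  \<comment> \<open>A linear map on the reals is multiplication by its value at 1; the chain rule
    becomes a product, to which \<open>Ck_mult\<close> applies.\<close>
  have lin: "D y t = D y 1 * t" for y t
    using linear_cmul[OF has_derivative_linear[OF D(1)], of y t 1] by simp
  have "Ck n (\<lambda>x. D (f x) 1)" using Suc.IH[OF D(2)] Ck_Suc_D[OF Suc.prems(2)] by simp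
  then have "Ck n (\<lambda>x. D (f x) (E x b))" if "b \<in> Basis" for b
    using Ck_mult[OF _ E(2)[OF that]] by (subst lin) simp
  then show ?case
    by (intro Ck_SucI[where D="\<lambda>x b. D (f x) (E x b)"])
      (auto intro: has_derivative_compose[OF E(1) D(1)])
qed

lemma Ck_realI:
  assumes "\<And>x. (f has_real_derivative f' x) (at x)" "Ck n f'"
  shows "Ck (Suc n) f"
  by (rule Ck_SucI[where D="\<lambda>x b. f' x * b"]) (use assms in \<open>auto simp: has_field_derivative_def\<close>)

definition smooth :: "('a::euclidean_space \<Rightarrow> real) \<Rightarrow> bool" where
  "smooth f \<longleftrightarrow> (\<forall>n. Ck n f)"

lemma smooth_const: "smooth (\<lambda>x. c)"
  and smooth_linear: "bounded_linear f \<Longrightarrow> smooth f"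
  and smooth_add: "smooth f \<Longrightarrow> smooth g \<Longrightarrow> smooth (\<lambda>x. f x + g x)"
  and smooth_mult: "smooth f \<Longrightarrow> smooth g \<Longrightarrow> smooth (\<lambda>x. f x * g x)"
  and smooth_minus: "smooth f \<Longrightarrow> smooth g \<Longrightarrow> smooth (\<lambda>x. f x - g x)"
  by (simp_all add: smooth_def Ck_const Ck_linear Ck_add Ck_mult Ck_minus)

lemma smooth_ident: "smooth (\<lambda>x::real. x)"
  by (rule smooth_linear) (rule bounded_linear_ident)

lemma smooth_compose:
  fixes F :: "real \<Rightarrow> real"
  shows "smooth F \<Longrightarrow> smooth f \<Longrightarrow> smooth (\<lambda>x. F (f x))"
  by (simp add: smooth_def Ck_compose)

text \<open>Each function is, up to sign, the derivative of the other, so a single induction treats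
  both.\<close>

lemma smooth_sin: "smooth (sin :: real \<Rightarrow> real)" and smooth_cos: "smooth (cos :: real \<Rightarrow> real)"
proof -
  have "Ck n (sin :: real \<Rightarrow> real) \<and> Ck n (cos :: real \<Rightarrow> real)" for n
  proof (induction n)
    case 0
    then show ?case by (simp add: continuous_intros)
  next
    case (Suc n)
    have "Ck n (\<lambda>x::real. - sin x)" using Ck_mult[OF Ck_const[of n "-1"], of sin] Suc by simp
    then show ?case using Suc
      by (auto intro!: Ck_realI[where f'=cos and f=sin] Ck_realI[where f'="\<lambda>x. - sin x" and f=cos]
          DERIV_sin DERIV_cos simp del: Ck.simps)
  qed
  then show "smooth (sin :: real \<Rightarrow> real)" "smooth (cos :: real \<Rightarrow> real)" by (auto simp: smooth_def)
qed

lemma smooth_polynomial: "real_polynomial_function p \<Longrightarrow> smooth p"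
  by (induction rule: real_polynomial_function.induct)
    (auto simp: smooth_linear smooth_const smooth_add smooth_mult)

section \<open>The flat function at zero\<close>

definition flat :: "nat \<Rightarrow> real \<Rightarrow> real" where
  "flat k x = (if x \<le> 0 then 0 else (1 / x) ^ k * exp (- 1 / x))"

lemma flat_tendsto_0: "(flat k \<longlongrightarrow> 0) (at 0)"
proof -
  have "(flat k \<longlongrightarrow> 0) (at_left 0)"
    by (rule Lim_transform_eventually[OF tendsto_const])
      (auto simp: flat_def eventually_at_filter)
  moreover have "(flat k \<longlongrightarrow> 0) (at_right 0)"
  proof (rule Lim_transform_eventually)
    have "((\<lambda>y::real. y ^ k / exp y) \<longlongrightarrow> 0) at_top" by (rule tendsto_power_div_exp_0)
    from filterlim_compose[OF this filterlim_inverse_at_top_right]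
    show "((\<lambda>x::real. (inverse x) ^ k / exp (inverse x)) \<longlongrightarrow> 0) (at_right 0)" .
    show "\<forall>\<^sub>F x in at_right 0. inverse x ^ k / exp (inverse x) = flat k x"
      by (auto simp: flat_def eventually_at_filter exp_minus field_simps)
  qed
  ultimately show ?thesis by (simp add: filterlim_at_split)
qed

text \<open>The powers of \<open>1 / x\<close> are built into the family because derivatives then
  stay in its linear span; smoothness becomes one induction over all \<open>k\<close>.\<close>

lemma DERIV_flat: "(flat k has_real_derivative flat (k + 2) x - real k * flat (Suc k) x) (at x)"
proof (cases x "0::real" rule: linorder_cases)
  case less
  have "((\<lambda>x. 0) has_real_derivative 0) (at x)" by simp
  then show ?thesis
    using less
    by (intro DERIV_cong_ev[THEN iffD1, OF refl _ _ \<open>((\<lambda>x. 0) has_real_derivative 0) (at x)\<close>])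
      (auto simp: flat_def eventually_nhds intro!: exI[of _ "{..<0}"])
next
  case equal
  \<comment> \<open>At 0 the difference quotient of \<open>flat k\<close> is
    \<open>flat (Suc k)\<close>, whose limit is known.\<close>
  have "((\<lambda>h. (flat k (0 + h) - flat k 0) / h) \<longlongrightarrow> 0) (at 0)"
    by (rule Lim_transform_eventually[OF flat_tendsto_0[of "Suc k"]])
      (auto simp: flat_def eventually_at_filter field_simps)
  then show ?thesis using equal by (simp add: has_field_derivative_iff flat_def)
next
  case greater
  have eq: "(1 / x) ^ k * (exp (- 1 / x) * (1 / (x * x))) + real k * (1 / x) ^ (k - 1) * (- 1 / (x * x)) * exp (- 1 / x)
     = flat (k + 2) x - real k * flat (Suc k) x"
  proof (cases k)
    case 0
    then show ?thesis using greater by (simp add: flat_def power2_eq_square)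
  next
    case (Suc j)
    then show ?thesis using greater by (simp add: flat_def field_simps)
  qed
  have d1: "((\<lambda>x. 1 / x) has_real_derivative - 1 / (x * x)) (at x)"
    and d2: "((\<lambda>x. exp (- 1 / x)) has_real_derivative exp (- 1 / x) * (1 / (x * x))) (at x)"
    using greater by (auto intro!: derivative_eq_intros)
  have "((\<lambda>x. (1 / x) ^ k * exp (- 1 / x)) has_real_derivative
     (1 / x) ^ k * (exp (- 1 / x) * (1 / (x * x))) + real k * (1 / x) ^ (k - 1) * (- 1 / (x * x)) * exp (- 1 / x)) (at x)"
    using DERIV_mult[OF DERIV_power[OF d1, of k] d2] by (simp add: algebra_simps)
  then show ?thesis unfolding eq using greater
    by (subst DERIV_cong_ev[OF refl _ refl]) (auto simp: flat_def eventually_nhds intro!: exI[of _ "{0<..}"])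
qed

lemma smooth_flat: "smooth (flat k)"
proof -
  have "Ck n (flat k)" for n
  proof (induction n arbitrary: k)
    case 0
    show ?case using DERIV_flat by (auto intro!: DERIV_continuous_on)
  next
    case (Suc n)
    have "Ck n (\<lambda>x. flat (k + 2) x - real k * flat (Suc k) x)"
      by (intro Ck_minus Ck_mult Ck_const Suc)
    then show ?case by (rule Ck_realI[OF DERIV_flat])
  qed
  then show ?thesis by (simp add: smooth_def)
qed

lemma test_functionsI:
  assumes "smooth \<phi>" "compact K" "K \<subseteq> \<Omega>" "\<And>z. z \<notin> K \<Longrightarrow> \<phi> z = 0"
  shows "\<phi> \<in> test_functions \<Omega>"
proof -
  have "closure {x. \<phi> x \<noteq> 0} \<subseteq> K"
    by (rule closure_minimal) (use assms compact_imp_closed in auto)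
  moreover from this have "compact (closure {x. \<phi> x \<noteq> 0})"
    by (metis \<open>compact K\<close> bounded_subset closed_closure compact_eq_bounded_closed)
  ultimately show ?thesis using assms unfolding test_functions_def smooth_def by auto
qed

section \<open>The space \<open>L\<^sup>2\<close>\<close>

definition L2 :: "'a measure \<Rightarrow> ('a \<Rightarrow> real) set" where
  "L2 M = {f \<in> borel_measurable M. integrable M (\<lambda>x. (f x)\<^sup>2)}"

lemma L2_D: "f \<in> L2 M \<Longrightarrow> f \<in> borel_measurable M" "f \<in> L2 M \<Longrightarrow> integrable M (\<lambda>x. (f x)\<^sup>2)"
  by (auto simp: L2_def)

lemma L2_mult_integrable:
  assumes "f \<in> L2 M" "g \<in> L2 M"
  shows "integrable M (\<lambda>x. f x * g x)"
proof (rule Bochner_Integration.integrable_bound)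
  show "integrable M (\<lambda>x. (f x)\<^sup>2 + (g x)\<^sup>2)" using assms by (auto simp: L2_def)
  show "(\<lambda>x. f x * g x) \<in> borel_measurable M" using assms by (auto simp: L2_def)
  show "AE x in M. norm (f x * g x) \<le> norm ((f x)\<^sup>2 + (g x)\<^sup>2)"
  proof (rule AE_I2)
    fix x
    have "0 \<le> (\<bar>f x\<bar> - \<bar>g x\<bar>)\<^sup>2" by simp
    moreover have "0 \<le> \<bar>f x\<bar> * \<bar>g x\<bar>" by simp
    ultimately show "norm (f x * g x) \<le> norm ((f x)\<^sup>2 + (g x)\<^sup>2)"
      unfolding power2_diff real_norm_def abs_mult by (simp, linarith)
  qed
qed

lemma L2_add: "f \<in> L2 M \<Longrightarrow> g \<in> L2 M \<Longrightarrow> (\<lambda>x. f x + g x) \<in> L2 M"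
  using L2_mult_integrable[of f M g] by (auto simp: L2_def power2_sum mult.assoc)

lemma L2_scale: "f \<in> L2 M \<Longrightarrow> (\<lambda>x. c * f x) \<in> L2 M"
  by (auto simp: L2_def power_mult_distrib)

lemma L2_diff: "f \<in> L2 M \<Longrightarrow> g \<in> L2 M \<Longrightarrow> (\<lambda>x. f x - g x) \<in> L2 M"
  using L2_add[of f M "\<lambda>x. (-1) * g x"] L2_scale[of g M "-1"] by simp

lemma L2_bounded:
  assumes "finite_measure M" "f \<in> borel_measurable M" "\<And>x. x \<in> space M \<Longrightarrow> \<bar>f x\<bar> \<le> B"
  shows "f \<in> L2 M"
proof -
  interpret finite_measure M by fact
  have "integrable M (\<lambda>x. (f x)\<^sup>2)"
    by (rule integrable_const_bound[of _ "B\<^sup>2"])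
      (use assms in \<open>auto intro!: AE_I2 power2_le_iff_abs_le[THEN iffD2] order_trans[OF abs_ge_zero]\<close>)
  then show ?thesis using assms by (auto simp: L2_def)
qed

lemma L2_mult_bounded:
  assumes "f \<in> L2 M" "h \<in> borel_measurable M" "\<And>x. x \<in> space M \<Longrightarrow> \<bar>h x\<bar> \<le> B"
  shows "(\<lambda>x. h x * f x) \<in> L2 M"
proof -
  have "integrable M (\<lambda>x. (h x * f x)\<^sup>2)"
  proof (rule Bochner_Integration.integrable_bound)
    show "integrable M (\<lambda>x. B\<^sup>2 * (f x)\<^sup>2)" using assms by (auto simp: L2_def)
    show "AE x in M. norm ((h x * f x)\<^sup>2) \<le> norm (B\<^sup>2 * (f x)\<^sup>2)"
      by (rule AE_I2) (use assms(3) in \<open>auto simp: power_mult_distrib intro!: mult_right_mono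
        intro: power2_le_iff_abs_le[THEN iffD2] order_trans[OF abs_ge_zero]\<close>)
  qed (use assms in \<open>auto simp: L2_def\<close>)
  then show ?thesis using assms by (auto simp: L2_def)
qed

lemma (in finite_measure) L2_integrable: "f \<in> L2 M \<Longrightarrow> integrable M f"
  using L2_mult_integrable[of f M "\<lambda>_. 1"] L2_bounded[of M "\<lambda>_. 1" 1] finite_measure_axioms by simp

abbreviation (input) ip :: "'a measure \<Rightarrow> ('a \<Rightarrow> real) \<Rightarrow> ('a \<Rightarrow> real) \<Rightarrow> real" where
  "ip M f g \<equiv> (LINT x|M. f x * g x)"

lemma ip_eq_0_AE:
  assumes "f \<in> L2 M" "ip M f f = 0"
  shows "AE x in M. f x = 0"
  using integral_nonneg_eq_0_iff_AE[of M "\<lambda>x. f x * f x"] assms L2_mult_integrable[of f M f]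
  by auto

text \<open>Along a subsequence with \<open>\<parallel>f\<^sub>k\<^sub>+\<^sub>1 - f\<^sub>k\<parallel>\<^sup>2 < 4\<^sup>-\<^sup>k\<close> the sum of the differences is integrable on a finite
  measure space, so the subsequence converges almost everywhere; Fatou's lemma gives the rest.\<close>

lemma L2_complete:
  fixes f :: "nat \<Rightarrow> 'a \<Rightarrow> real"
  assumes M: "finite_measure M" and f: "\<And>n. f n \<in> L2 M"
    and Cauchy: "\<And>e. e > 0 \<Longrightarrow> \<exists>N. \<forall>m\<ge>N. \<forall>n\<ge>N. (LINT x|M. (f m x - f n x)\<^sup>2) < e"
  obtains F where "F \<in> L2 M" "(\<lambda>n. LINT x|M. (f n x - F x)\<^sup>2) \<longlonglongrightarrow> 0"
proof -
  interpret finite_measure M by fact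
  define q where "q m n = (LINT x|M. (f m x - f n x)\<^sup>2)" for m n
  have sqint: "integrable M (\<lambda>x. (f m x - f n x)\<^sup>2)" for m n
    using L2_diff[OF f f] by (auto simp: L2_def)
  have [measurable]: "f n \<in> borel_measurable M" for n using f by (auto simp: L2_def)
  have "\<exists>N. \<forall>m\<ge>N. \<forall>n\<ge>N. q m n < (1/4)^k" for k :: nat
    using Cauchy[of "(1/4)^k"] by (simp add: q_def)
  then obtain N where N: "\<And>k m n. m \<ge> N k \<Longrightarrow> n \<ge> N k \<Longrightarrow> q m n < (1/4)^k" by metis
  \<comment> \<open>The sum dominates \<open>N k\<close>, and the summand \<open>k\<close> makes
    \<open>r\<close> strictly increasing.\<close>
  define r where "r k = k + (\<Sum>i\<le>k. N i)" for k
  have "strict_mono r" by (rule strict_mono_Suc_iff[THEN iffD2]) (auto simp: r_def)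
  have rN: "r k \<ge> N k" for k
    using member_le_sum[of k "{..k}" N] by (simp add: r_def trans_le_add2)
  have r_mono: "j \<le> k \<Longrightarrow> r j \<le> r k" for j k
    using \<open>strict_mono r\<close> by (simp add: strict_mono_less_eq)
  define D where "D k x = \<bar>f (r (Suc k)) x - f (r k) x\<bar>" for k x
  have DL2: "D k \<in> L2 M" for k
    using sqint unfolding L2_def D_def by simp
  have Dint: "integrable M (D k)" for k by (rule L2_integrable) (rule DL2)
  have D_le: "(LINT x|M. D k x) \<le> (1 + measure M (space M)) * (1/2)^k" for k
  proof -
    have "(LINT x|M. D k x) \<le> (LINT x|M. 2^k * (D k x)\<^sup>2 + (1/2)^k)"
    proof (rule integral_mono)
      fix x
      \<comment> \<open>Completing the square gives \<open>D \<le> 2^k * D^2 + (1/2)^k\<close>: the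
        factor \<open>2^k\<close> uses up half of the decay of \<open>(1/4)^k\<close> and leaves a
        summable bound for the integral of \<open>D\<close>.\<close>
      have "0 \<le> (2^k * D k x - 1/2)\<^sup>2" by simp
      then have "2^k * (2^k * (D k x)\<^sup>2) + 1/4 \<ge> 2^k * D k x"
        by (simp add: power2_diff power_mult_distrib power2_eq_square algebra_simps)
      then have "2^k * D k x \<le> 2^k * (2^k * (D k x)\<^sup>2 + (1/2)^k)"
        by (simp add: algebra_simps flip: power_mult_distrib)
      then show "D k x \<le> 2^k * (D k x)\<^sup>2 + (1/2)^k" by simp
    qed (use Dint L2_D(2)[OF DL2] in auto)
    also have "\<dots> = 2^k * q (r (Suc k)) (r k) + measure M (space M) * (1/2)^k"
      using L2_D(2)[OF DL2] sqint[of "r (Suc k)" "r k"] by (simp add: D_def q_def)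
    also have "\<dots> \<le> 2^k * (1/4)^k + measure M (space M) * (1/2)^k"
      using N[of k "r (Suc k)" "r k"] rN[of k] r_mono[of k "Suc k"]
      by (intro add_right_mono mult_left_mono) auto
    also have "2^k * (1/4)^k = ((1/2)^k :: real)" by (simp flip: power_mult_distrib)
    finally show ?thesis by (simp add: algebra_simps)
  qed
  have "AE x in M. summable (\<lambda>k. D k x)"
  proof -
    have "(\<integral>\<^sup>+x. (\<Sum>k. ennreal (D k x)) \<partial>M) = (\<Sum>k. \<integral>\<^sup>+x. ennreal (D k x) \<partial>M)"
      by (rule nn_integral_suminf) (simp add: D_def)
    also have "\<dots> = (\<Sum>k. ennreal (LINT x|M. D k x))"
      using Dint by (subst nn_integral_eq_integral) (auto simp: D_def)
    also have "\<dots> < \<infinity>"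
    proof -
      have "summable (\<lambda>k. LINT x|M. D k x)"
        by (rule summable_comparison_test'[where N=0, OF summable_mult[OF summable_geometric[of "1/2::real"]]])
          (use D_le in \<open>auto simp: D_def abs_of_nonneg\<close>)
      then show ?thesis by (simp add: suminf_ennreal2 D_def)
    qed
    finally have "AE x in M. (\<Sum>k. ennreal (D k x)) \<noteq> \<infinity>"
      by (intro nn_integral_noteq_infinite) (auto simp: D_def)
    then show ?thesis
      by (rule AE_mp) (auto intro!: AE_I2 summable_suminf_not_top simp: D_def)
  qed
  then have conv: "AE x in M. convergent (\<lambda>k. f (r k) x)"
  proof (rule AE_mp, intro AE_I2 impI)
    fix x assume "summable (\<lambda>k. D k x)"
    then have "summable (\<lambda>k. f (r (Suc k)) x - f (r k) x)"
      unfolding D_def by (rule summable_rabs_cancel)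
    then have "convergent (\<lambda>n. f (r n) x - f (r 0) x)"
      by (simp add: summable_iff_convergent sum_lessThan_telescope[of "\<lambda>k. f (r k) x"])
    then have "convergent (\<lambda>n. (f (r n) x - f (r 0) x) + f (r 0) x)"
      by (intro convergent_add convergent_const)
    then show "convergent (\<lambda>k. f (r k) x)" by simp
  qed
  define F where "F x = lim (\<lambda>k. f (r k) x)" for x
  have lim: "AE x in M. (\<lambda>k. f (r k) x) \<longlonglongrightarrow> F x"
    using conv by (rule AE_mp) (auto simp: F_def convergent_LIMSEQ_iff)
  have [measurable]: "F \<in> borel_measurable M" unfolding F_def by measurable
  have est: "integrable M (\<lambda>x. (f n x - F x)\<^sup>2) \<and> (LINT x|M. (f n x - F x)\<^sup>2) \<le> (1/4)^k" if "n \<ge> N k" for n k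
  proof -
    have "(\<integral>\<^sup>+x. ennreal ((f n x - F x)\<^sup>2) \<partial>M) = (\<integral>\<^sup>+x. liminf (\<lambda>j. ennreal ((f n x - f (r j) x)\<^sup>2)) \<partial>M)"
      by (rule nn_integral_cong_AE, rule AE_mp[OF lim], intro AE_I2 impI)
        (auto intro!: lim_imp_Liminf[symmetric] tendsto_intros)
    also have "\<dots> \<le> liminf (\<lambda>j. \<integral>\<^sup>+x. ennreal ((f n x - f (r j) x)\<^sup>2) \<partial>M)"
      by (rule nn_integral_liminf) auto
    also have "\<dots> \<le> ennreal ((1/4)^k)"
    proof -
      have "\<forall>\<^sub>F j in sequentially. (\<integral>\<^sup>+x. ennreal ((f n x - f (r j) x)\<^sup>2) \<partial>M) \<le> ennreal ((1/4)^k)"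
        using eventually_ge_at_top[of k]
      proof eventually_elim
        case (elim j)
        have "r j \<ge> N k" using rN[of k] r_mono[OF elim] by simp
        then show ?case using N[OF that, of "r j"] sqint[of n "r j"]
          by (subst nn_integral_eq_integral) (auto simp: q_def intro!: ennreal_leI)
      qed
      then have "liminf (\<lambda>j. \<integral>\<^sup>+x. ennreal ((f n x - f (r j) x)\<^sup>2) \<partial>M) \<le> limsup (\<lambda>j. ennreal ((1/4)^k))"
        by (intro order_trans[OF Liminf_le_Limsup Limsup_mono]) auto
      then show ?thesis by (simp add: Limsup_const)
    qed
    finally have le: "(\<integral>\<^sup>+x. ennreal ((f n x - F x)\<^sup>2) \<partial>M) \<le> ennreal ((1/4)^k)" .
    have int: "integrable M (\<lambda>x. (f n x - F x)\<^sup>2)"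
      by (rule integrableI_nonneg) (use le in \<open>auto intro: le_less_trans\<close>)
    then show ?thesis using le by (simp add: nn_integral_eq_integral)
  qed
  have FL2: "F \<in> L2 M"
  proof -
    have "(\<lambda>x. f (N 0) x - F x) \<in> L2 M" using est[of 0 "N 0"] by (auto simp: L2_def)
    from L2_diff[OF f[of "N 0"] this] show ?thesis by simp
  qed
  moreover have "(\<lambda>n. LINT x|M. (f n x - F x)\<^sup>2) \<longlonglongrightarrow> 0"
  proof (rule LIMSEQ_I)
    fix e :: real assume "e > 0"
    then obtain k where k: "(1/4)^k < e" using real_arch_pow_inv[of e "1/4"] by auto
    then show "\<exists>n0. \<forall>n\<ge>n0. norm ((LINT x|M. (f n x - F x)\<^sup>2) - 0) < e"
      by (intro exI[of _ "N k"]) (use est in fastforce)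
  qed
  ultimately show thesis by (rule that)
qed

section \<open>Minimisers of a quotient of quadratic forms\<close>

text \<open>\<open>V\<close> holds representatives, not classes, so \<open>b\<close> is merely
  positive semidefinite. \<open>compact\<close> is the compact embedding of the form domain, and
  \<open>complete\<close> its completeness for \<open>a + b\<close>; both are phrased with
  sequences, which keeps topologies on \<open>V\<close> out of the locale.\<close>

locale form_pair =
  fixes V :: "('z \<Rightarrow> real) set" and a b :: "('z \<Rightarrow> real) \<Rightarrow> ('z \<Rightarrow> real) \<Rightarrow> real"
  assumes V_add: "\<And>u v. u \<in> V \<Longrightarrow> v \<in> V \<Longrightarrow> (\<lambda>x. u x + v x) \<in> V"
    and V_scale: "\<And>c u. u \<in> V \<Longrightarrow> (\<lambda>x. c * u x) \<in> V"
    and a_add: "\<And>u v w. u \<in> V \<Longrightarrow> v \<in> V \<Longrightarrow> w \<in> V \<Longrightarrow> a (\<lambda>x. u x + v x) w = a u w + a v w"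
    and b_add: "\<And>u v w. u \<in> V \<Longrightarrow> v \<in> V \<Longrightarrow> w \<in> V \<Longrightarrow> b (\<lambda>x. u x + v x) w = b u w + b v w"
    and a_scale: "\<And>c u w. u \<in> V \<Longrightarrow> w \<in> V \<Longrightarrow> a (\<lambda>x. c * u x) w = c * a u w"
    and b_scale: "\<And>c u w. u \<in> V \<Longrightarrow> w \<in> V \<Longrightarrow> b (\<lambda>x. c * u x) w = c * b u w"
    and a_sym: "\<And>u v. u \<in> V \<Longrightarrow> v \<in> V \<Longrightarrow> a u v = a v u"
    and b_sym: "\<And>u v. u \<in> V \<Longrightarrow> v \<in> V \<Longrightarrow> b u v = b v u"
    and a_nonneg: "\<And>u. u \<in> V \<Longrightarrow> 0 \<le> a u u"
    and b_nonneg: "\<And>u. u \<in> V \<Longrightarrow> 0 \<le> b u u"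
    and compact: "\<And>u C. (\<And>n::nat. u n \<in> V) \<Longrightarrow> (\<And>n. a (u n) (u n) + b (u n) (u n) \<le> C) \<Longrightarrow>
      \<exists>r::nat\<Rightarrow>nat. strict_mono r \<and>
        (\<forall>e>0. \<exists>N. \<forall>m\<ge>N. \<forall>n\<ge>N. b (\<lambda>x. u (r m) x - u (r n) x) (\<lambda>x. u (r m) x - u (r n) x) < e)"
    and complete: "\<And>u. (\<And>n::nat. u n \<in> V) \<Longrightarrow>
      (\<And>e. e > 0 \<Longrightarrow> \<exists>N. \<forall>m\<ge>N. \<forall>n\<ge>N. a (\<lambda>x. u m x - u n x) (\<lambda>x. u m x - u n x)
          + b (\<lambda>x. u m x - u n x) (\<lambda>x. u m x - u n x) < e) \<Longrightarrow>
      \<exists>w\<in>V. (\<lambda>n. a (\<lambda>x. u n x - w x) (\<lambda>x. u n x - w x) + b (\<lambda>x. u n x - w x) (\<lambda>x. u n x - w x)) \<longlonglongrightarrow> 0"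
begin

lemma V_diff: "u \<in> V \<Longrightarrow> v \<in> V \<Longrightarrow> (\<lambda>x. u x - v x) \<in> V"
  using V_add[of u "\<lambda>x. (-1) * v x"] V_scale[of v "-1"] by simp

lemma a_diff: "u \<in> V \<Longrightarrow> v \<in> V \<Longrightarrow> w \<in> V \<Longrightarrow> a (\<lambda>x. u x - v x) w = a u w - a v w"
  using a_add[of u "\<lambda>x. (-1) * v x" w] V_scale[of v "-1"] a_scale[of v w "-1"] by simp

lemma b_diff: "u \<in> V \<Longrightarrow> v \<in> V \<Longrightarrow> w \<in> V \<Longrightarrow> b (\<lambda>x. u x - v x) w = b u w - b v w"
  using b_add[of u "\<lambda>x. (-1) * v x" w] V_scale[of v "-1"] b_scale[of v w "-1"] by simp

lemma a_add2: "u \<in> V \<Longrightarrow> v \<in> V \<Longrightarrow> w \<in> V \<Longrightarrow> a w (\<lambda>x. u x + v x) = a w u + a w v"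
  and b_add2: "u \<in> V \<Longrightarrow> v \<in> V \<Longrightarrow> w \<in> V \<Longrightarrow> b w (\<lambda>x. u x + v x) = b w u + b w v"
  and a_diff2: "u \<in> V \<Longrightarrow> v \<in> V \<Longrightarrow> w \<in> V \<Longrightarrow> a w (\<lambda>x. u x - v x) = a w u - a w v"
  and b_diff2: "u \<in> V \<Longrightarrow> v \<in> V \<Longrightarrow> w \<in> V \<Longrightarrow> b w (\<lambda>x. u x - v x) = b w u - b w v"
  and a_scale2: "u \<in> V \<Longrightarrow> w \<in> V \<Longrightarrow> a w (\<lambda>x. c * u x) = c * a w u"
  and b_scale2: "u \<in> V \<Longrightarrow> w \<in> V \<Longrightarrow> b w (\<lambda>x. c * u x) = c * b w u"
  by (simp_all add: a_sym[of w] b_sym[of w] a_add b_add a_diff b_diff a_scale b_scale V_add V_diff V_scale)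

lemmas bilin = a_add b_add a_add2 b_add2 a_diff b_diff a_diff2 b_diff2 a_scale b_scale a_scale2 b_scale2
  V_add V_diff V_scale

text \<open>The axioms admit an empty \<open>V\<close>, without the zero function; hence the
  nonempty index sets here and the separate case \<open>k = 0\<close> later.\<close>

lemma V_sum: "finite I \<Longrightarrow> I \<noteq> {} \<Longrightarrow> (\<And>i. i \<in> I \<Longrightarrow> f i \<in> V) \<Longrightarrow> (\<lambda>x. \<Sum>i\<in>I. c i * f i x) \<in> V"
  by (induction I rule: finite_ne_induct) (auto simp: V_add V_scale)

lemma ab_sum:
  assumes "finite I" "I \<noteq> {}" "\<And>i. i \<in> I \<Longrightarrow> f i \<in> V" "w \<in> V"
  shows "b (\<lambda>x. \<Sum>i\<in>I. c i * f i x) w = (\<Sum>i\<in>I. c i * b (f i) w)"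
    and "a (\<lambda>x. \<Sum>i\<in>I. c i * f i x) w = (\<Sum>i\<in>I. c i * a (f i) w)"
  using assms by (induction I rule: finite_ne_induct) (auto simp: bilin V_sum)

text \<open>The first-order condition at a minimum, shared by the Cauchy-Schwarz inequality and by
  \<open>minimiser_stationary\<close>.\<close>

lemma zero_of_quadratic_nonneg:
  assumes quad: "\<And>t::real. 0 \<le> 2 * t * p + t\<^sup>2 * q" and "0 \<le> q"
  shows "p = 0"
proof (rule ccontr)
  assume "p \<noteq> 0"
  \<comment> \<open>For \<open>q > 0\<close> the minimum lies at \<open>t = - p / q\<close>; with
    \<open>q + 1\<close> in the denominator the case \<open>q = 0\<close> is included and the value
    stays negative.\<close>
  define s where "s = 1 / (q + 1)"
  have s: "s > 0" "s * q = 1 - s" using \<open>0 \<le> q\<close> by (auto simp: s_def field_simps)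
  have "0 \<le> 2 * (- p * s) * p + (- p * s)\<^sup>2 * q" by (rule quad)
  also have "\<dots> = - 2 * p\<^sup>2 * s + p\<^sup>2 * s * (s * q)" by (simp add: power2_eq_square)
  also have "\<dots> = - (p\<^sup>2 * s * (1 + s))" unfolding s(2) by (simp add: algebra_simps)
  also have "\<dots> < 0" using s(1) \<open>p \<noteq> 0\<close> by simp
  finally show False by simp
qed

text \<open>Vectors with \<open>b v v = 0\<close> need not vanish, so this case is settled by the
  nonnegativity of \<open>b\<close> along \<open>v + t * u\<close> instead of by division.\<close>

lemma b_Cauchy_Schwarz:
  assumes "u \<in> V" "v \<in> V"
  shows "(b u v)\<^sup>2 \<le> b u u * b v v"
proof (cases "b v v = 0")
  case True
  have "0 \<le> 2 * t * b v u + t\<^sup>2 * b u u" for t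
  proof -
    have "0 \<le> b (\<lambda>x. v x + t * u x) (\<lambda>x. v x + t * u x)" using assms by (intro b_nonneg bilin)
    also have "\<dots> = b v v + 2 * t * b v u + t\<^sup>2 * b u u"
      using assms by (simp add: bilin b_sym[of u v] algebra_simps power2_eq_square)
    finally show ?thesis using True by simp
  qed
  then have "b v u = 0" by (rule zero_of_quadratic_nonneg) (use assms b_nonneg in auto)
  then show ?thesis using assms b_sym[of u v] True by simp
next
  case False
  then have pos: "b v v > 0" using b_nonneg[OF assms(2)] by simp
  define t where "t = b u v / b v v"
  have "0 \<le> b (\<lambda>x. u x - t * v x) (\<lambda>x. u x - t * v x)" using assms by (intro b_nonneg bilin)
  also have "\<dots> = b u u - 2 * t * b u v + t\<^sup>2 * b v v"
    using assms by (simp add: bilin b_sym[of v u] algebra_simps power2_eq_square)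
  also have "\<dots> = b u u - (b u v)\<^sup>2 / b v v"
    using pos by (simp add: t_def field_simps power2_eq_square)
  finally show ?thesis using pos by (simp add: field_simps)
qed

definition orth :: "('z \<Rightarrow> real) set \<Rightarrow> ('z \<Rightarrow> real) set" where
  "orth E = {v \<in> V. \<forall>e\<in>E. b v e = 0}"

lemma orth_V: "v \<in> orth E \<Longrightarrow> v \<in> V" by (simp add: orth_def)

lemma orth_add: "E \<subseteq> V \<Longrightarrow> u \<in> orth E \<Longrightarrow> v \<in> orth E \<Longrightarrow> (\<lambda>x. u x + v x) \<in> orth E"
  and orth_scale: "E \<subseteq> V \<Longrightarrow> u \<in> orth E \<Longrightarrow> (\<lambda>x. c * u x) \<in> orth E"
  by (auto simp: orth_def bilin subset_eq)

text \<open>By the parallelogram law a minimising sequence that is Cauchy for \<open>b\<close> is Cauchy for \<open>a\<close>.\<close>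

lemma minimiser_exists:
  assumes E: "E \<subseteq> V" and w: "w \<in> orth E" "b w w > 0"
  obtains u where "u \<in> orth E" "b u u = 1" "\<And>v. v \<in> orth E \<Longrightarrow> a v v \<ge> a u u * b v v"
proof -
  define \<mu> where "\<mu> = (INF v\<in>{v \<in> orth E. b v v > 0}. a v v / b v v)"
  have bdd: "bdd_below ((\<lambda>v. a v v / b v v) ` {v \<in> orth E. b v v > 0})"
    by (rule bdd_belowI[where m=0]) (auto intro!: divide_nonneg_pos a_nonneg orth_V)
  have ge: "a v v \<ge> \<mu> * b v v" if "v \<in> orth E" for v
  proof (cases "b v v > 0")
    case True
    then have "\<mu> \<le> a v v / b v v" unfolding \<mu>_def using that by (intro cINF_lower bdd) auto
    then show ?thesis using True by (simp add: field_simps)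
  next
    case False
    then have "b v v = 0" using b_nonneg[OF orth_V[OF that]] by simp
    then show ?thesis using a_nonneg[OF orth_V[OF that]] by simp
  qed
  have "\<exists>v. v \<in> orth E \<and> b v v = 1 \<and> a v v < \<mu> + 1 / real (Suc n)" for n
  proof -
    have "\<exists>v\<in>{v \<in> orth E. b v v > 0}. a v v / b v v < \<mu> + 1 / real (Suc n)"
      using w bdd cINF_less_iff[of "{v \<in> orth E. b v v > 0}" "\<lambda>v. a v v / b v v" "\<mu> + 1 / real (Suc n)"]
      by (auto simp: \<mu>_def[symmetric])
    then obtain v where v: "v \<in> orth E" "b v v > 0" "a v v / b v v < \<mu> + 1 / real (Suc n)" by auto
    let ?c = "1 / sqrt (b v v)"
    have c2: "?c * ?c = 1 / b v v" using v(2) by simp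
    have V: "v \<in> V" using v(1) by (rule orth_V)
    have "b (\<lambda>x. ?c * v x) (\<lambda>x. ?c * v x) = (?c * ?c) * b v v" using V by (simp only: bilin mult.assoc)
    moreover have "a (\<lambda>x. ?c * v x) (\<lambda>x. ?c * v x) = (?c * ?c) * a v v" using V by (simp only: bilin mult.assoc)
    ultimately show ?thesis unfolding c2 using v orth_scale[OF E v(1), of ?c]
      by (intro exI[of _ "\<lambda>x. ?c * v x"]) auto
  qed
  then obtain u where u: "\<And>n. u n \<in> orth E" "\<And>n. b (u n) (u n) = 1" "\<And>n. a (u n) (u n) < \<mu> + 1 / real (Suc n)"
    by metis
  have uV: "u n \<in> V" for n using u(1) orth_V by blast
  have "a (u n) (u n) + b (u n) (u n) \<le> \<mu> + 2" for n
  proof -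
    have "1 / real (Suc n) \<le> 1" by simp
    then show ?thesis using u(2,3)[of n] by linarith
  qed
  from compact[OF uV this] obtain r :: "nat \<Rightarrow> nat" where "strict_mono r \<and> (\<forall>e>0. \<exists>N. \<forall>m\<ge>N. \<forall>n\<ge>N.
      b (\<lambda>x. u (r m) x - u (r n) x) (\<lambda>x. u (r m) x - u (r n) x) < e)"
    by (rule exE)
  then have r: "strict_mono r"
    and rC: "\<And>e. e > 0 \<Longrightarrow> \<exists>N. \<forall>m\<ge>N. \<forall>n\<ge>N. b (\<lambda>x. u (r m) x - u (r n) x) (\<lambda>x. u (r m) x - u (r n) x) < e"
    by auto
  define v where "v n = u (r n)" for n
  have vO: "v n \<in> orth E" and vV: "v n \<in> V" and vb: "b (v n) (v n) = 1" for n
    by (auto simp: v_def u uV)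
  have va: "a (v n) (v n) < \<mu> + 1 / real (Suc n)" for n
  proof -
    have "1 / real (Suc (r n)) \<le> 1 / real (Suc n)"
      using strict_mono_imp_increasing[OF r, of n] by (simp add: field_simps)
    then show ?thesis using u(3)[of "r n"] by (simp add: v_def)
  qed
  let ?d = "\<lambda>m n x. v m x - v n x"
  have diff_le: "a (?d m n) (?d m n) \<le> 2 / real (Suc m) + 2 / real (Suc n) + \<bar>\<mu>\<bar> * b (?d m n) (?d m n)" for m n
  proof -
    let ?s = "\<lambda>x. v m x + v n x"
    have "?s \<in> orth E" using orth_add[OF E vO vO] .
    then have "\<mu> * b ?s ?s \<le> a ?s ?s" by (rule ge)
    moreover have "a ?s ?s + a (?d m n) (?d m n) = 2 * a (v m) (v m) + 2 * a (v n) (v n)"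
      "b ?s ?s + b (?d m n) (?d m n) = 4"
      using vV vb by (simp_all add: bilin)
    moreover have "\<mu> * b (?d m n) (?d m n) \<le> \<bar>\<mu>\<bar> * b (?d m n) (?d m n)"
      using vV by (intro mult_right_mono b_nonneg bilin) auto
    moreover have "\<mu> * b ?s ?s + \<mu> * b (?d m n) (?d m n) = 4 * \<mu>"
      using calculation(3) by (simp flip: distrib_left)
    moreover have "2 / real (Suc k) = 2 * (1 / real (Suc k))" for k by simp
    ultimately show ?thesis using va[of m] va[of n] by linarith
  qed
  have "\<exists>N. \<forall>m\<ge>N. \<forall>n\<ge>N. a (?d m n) (?d m n) + b (?d m n) (?d m n) < e" if e: "e > 0" for e
  proof -
    have "e / (2 * (\<bar>\<mu>\<bar> + 1)) > 0" using e by (simp add: field_simps)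
    from rC[OF this] obtain N1 where "\<forall>m\<ge>N1. \<forall>n\<ge>N1. b (?d m n) (?d m n) < e / (2 * (\<bar>\<mu>\<bar> + 1))"
      unfolding v_def by (rule exE)
    then have N1: "\<And>m n. m \<ge> N1 \<Longrightarrow> n \<ge> N1 \<Longrightarrow> b (?d m n) (?d m n) < e / (2 * (\<bar>\<mu>\<bar> + 1))"
      by simp
    obtain N2 where N2: "8 / e < real N2" using reals_Archimedean2 by blast
    have "a (?d m n) (?d m n) + b (?d m n) (?d m n) < e" if "m \<ge> max N1 N2" "n \<ge> max N1 N2" for m n
    proof -
      have "2 / real (Suc k) < e / 4" if "k \<ge> N2" for k
      proof -
        have "8 / e < real (Suc k)" using N2 that by linarith
        then show ?thesis using e by (simp add: field_simps del: of_nat_Suc)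
      qed
      then have "2 / real (Suc m) < e / 4" "2 / real (Suc n) < e / 4" using that by simp_all
      moreover have *: "(\<bar>\<mu>\<bar> + 1) * b (?d m n) (?d m n) < e / 2"
        using N1[of m n] that by (simp add: pos_less_divide_eq algebra_simps)
      moreover have "\<bar>\<mu>\<bar> * b (?d m n) (?d m n) + b (?d m n) (?d m n) < e / 2" using * by (simp add: algebra_simps)
      ultimately show ?thesis using diff_le[of m n] by linarith
    qed
    then show ?thesis by blast
  qed
  from complete[OF vV this] obtain z where z: "z \<in> V"
        and zlim: "(\<lambda>n. a (\<lambda>x. v n x - z x) (\<lambda>x. v n x - z x) + b (\<lambda>x. v n x - z x) (\<lambda>x. v n x - z x)) \<longlonglongrightarrow> 0"
    by blast
  let ?z = "\<lambda>n x. v n x - z x"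
  have zV: "?z n \<in> V" for n by (intro bilin vV z)
  have blim: "(\<lambda>n. b (?z n) (?z n)) \<longlonglongrightarrow> 0"
    by (rule tendsto_sandwich[OF _ _ tendsto_const zlim]) (auto simp: a_nonneg b_nonneg zV)
  have alim: "(\<lambda>n. a (?z n) (?z n)) \<longlonglongrightarrow> 0"
    by (rule tendsto_sandwich[OF _ _ tendsto_const zlim]) (auto simp: a_nonneg b_nonneg zV)
  have blin: "(\<lambda>n. b (?z n) y) \<longlonglongrightarrow> 0" if "y \<in> V" for y
  proof -
    have "(\<lambda>n. (b (?z n) y)\<^sup>2) \<longlonglongrightarrow> 0"
    proof (rule tendsto_sandwich[OF _ _ tendsto_const])
      show "(\<lambda>n. b (?z n) (?z n) * b y y) \<longlonglongrightarrow> 0" using tendsto_mult_right[OF blim, of "b y y"] by simp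
    qed (auto simp: b_Cauchy_Schwarz zV that)
    from tendsto_real_sqrt[OF this] show ?thesis by (simp add: tendsto_rabs_zero_iff)
  qed
  have zO: "z \<in> orth E"
    unfolding orth_def
  proof (intro CollectI conjI ballI z)
    fix e assume "e \<in> E"
    then have "b (?z n) e = - b z e" for n
      using vO[of n] E vV[of n] z by (auto simp: bilin orth_def subset_eq)
    then have "(\<lambda>n::nat. - b z e) \<longlonglongrightarrow> 0" using blin[of e] E \<open>e \<in> E\<close> by auto
    then show "b z e = 0" by (simp add: tendsto_const_iff LIMSEQ_const_iff)
  qed
  have bz: "b z z = 1"
  proof -
    have "b z z = 1 - b (?z n) (?z n) - 2 * b (?z n) z" for n
      using vV[of n] z vb[of n] b_sym[of z "v n"] by (simp add: bilin)
    moreover have "(\<lambda>n. 1 - b (?z n) (?z n) - 2 * b (?z n) z) \<longlonglongrightarrow> 1 - 0 - 2 * 0"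
      by (intro tendsto_intros blim blin z)
    ultimately have "(\<lambda>n::nat. b z z) \<longlonglongrightarrow> 1" by simp
    then show ?thesis by (simp add: LIMSEQ_const_iff)
  qed
  have az: "a z z \<le> \<mu>"
  proof (rule field_le_epsilon)
    fix e :: real assume e: "e > 0"
    \<comment> \<open>Young's inequality
      \<open>a z z \<le> (1 + t) * a v v + (1 + 1/t) * a (v - z) (v - z)\<close> passes to the limit
      for fixed \<open>t\<close>; this \<open>t\<close> keeps the loss \<open>t * \<mu>\<close>
      below \<open>e\<close>.\<close>
    define t where "t = e / (\<bar>\<mu>\<bar> + 1)"
    have t: "t > 0" using e by (simp add: t_def add_nonneg_pos)
    have "a z z \<le> (1 + t) * a (v n) (v n) + (1 + 1/t) * a (?z n) (?z n)" for n
    proof -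
      let ?y = "\<lambda>x. t * v n x + ?z n x"
      have "0 \<le> a ?y ?y" by (intro a_nonneg bilin vV z)
      also have "\<dots> = t\<^sup>2 * a (v n) (v n) + 2 * t * a (v n) (?z n) + a (?z n) (?z n)"
        using vV zV z by (simp only: bilin a_sym[OF z vV]) (simp add: algebra_simps power2_eq_square)
      finally have "- 2 * a (v n) (?z n) \<le> t * a (v n) (v n) + a (?z n) (?z n) / t"
        using t by (simp add: field_simps power2_eq_square)
      moreover have "a z z = a (v n) (v n) - 2 * a (v n) (?z n) + a (?z n) (?z n)"
        using vV[of n] z by (simp add: bilin a_sym[of z "v n"])
      ultimately show ?thesis by (simp add: algebra_simps)
    qed
    moreover have "(1 + t) * a (v n) (v n) \<le> (1 + t) * (\<mu> + 1 / real (Suc n))" for n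
      by (rule mult_left_mono) (use va[of n] t in auto)
    ultimately have "a z z \<le> (1 + t) * (\<mu> + 1 / real (Suc n)) + (1 + 1/t) * a (?z n) (?z n)" for n
      by (meson add_mono_thms_linordered_semiring(3) order_trans)
    moreover have "(\<lambda>n. (1 + t) * (\<mu> + 1 / real (Suc n)) + (1 + 1/t) * a (?z n) (?z n)) \<longlonglongrightarrow> (1 + t) * (\<mu> + 0) + (1 + 1/t) * 0"
      by (intro tendsto_intros alim LIMSEQ_Suc[OF lim_1_over_n])
    ultimately have "a z z \<le> (1 + t) * (\<mu> + 0) + (1 + 1/t) * 0"
      by (intro LIMSEQ_le_const) auto
    also have "\<dots> \<le> \<mu> + t * (\<bar>\<mu>\<bar> + 1)"
      using t mult_left_mono[of \<mu> "\<bar>\<mu>\<bar> + 1" t] by (simp add: algebra_simps)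
    also have "t * (\<bar>\<mu>\<bar> + 1) = e" by (simp add: t_def)
    finally show "a z z \<le> \<mu> + e" by simp
  qed
  show thesis
  proof (rule that[OF zO bz])
    fix y assume y: "y \<in> orth E"
    have "a z z * b y y \<le> \<mu> * b y y" using az y by (intro mult_right_mono b_nonneg orth_V) auto
    then show "a z z * b y y \<le> a y y" using ge[OF y] by simp
  qed
qed

text \<open>Along \<open>u + t * v\<close> the difference \<open>a - \<mu> * b\<close> is a
  nonnegative quadratic polynomial in \<open>t\<close> that vanishes at \<open>t = 0\<close>, so its
  linear coefficient is zero.\<close>

lemma minimiser_stationary:
  assumes E: "E \<subseteq> V" and u: "u \<in> orth E" and min: "\<And>v. v \<in> orth E \<Longrightarrow> a v v \<ge> \<mu> * b v v"
    and eq: "a u u = \<mu> * b u u" and v: "v \<in> orth E"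
  shows "a u v = \<mu> * b u v"
proof -
  have uv: "u \<in> V" "v \<in> V" using u v orth_V by auto
  have "a u v - \<mu> * b u v = 0"
  proof (rule zero_of_quadratic_nonneg)
    show "0 \<le> a v v - \<mu> * b v v" using min[OF v] by simp
    fix t :: real
    have "(\<lambda>x. u x + t * v x) \<in> orth E" by (intro orth_add orth_scale E u v)
    from min[OF this] show "0 \<le> 2 * t * (a u v - \<mu> * b u v) + t\<^sup>2 * (a v v - \<mu> * b v v)"
      using uv eq a_sym[of u v] b_sym[of u v]
      by (simp add: bilin algebra_simps power2_eq_square)
  qed
  then show ?thesis by simp
qed

definition eigvec :: "real \<Rightarrow> ('z \<Rightarrow> real) \<Rightarrow> bool" where
  "eigvec \<mu> u \<longleftrightarrow> u \<in> V \<and> (\<forall>v\<in>V. a u v = \<mu> * b u v)"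

text \<open>Stationarity is known only for variations in the complement of the \<open>e i\<close>.
  Against \<open>e i\<close> itself both sides vanish, because \<open>e i\<close> is an eigenvector
  orthogonal to \<open>u\<close>; a general \<open>v\<close> is split by projection onto the
  \<open>e i\<close>.\<close>

lemma eigvec_of_orth:
  fixes k :: nat
  assumes e: "\<And>i. i < k \<Longrightarrow> eigvec (\<mu> i) (e i)"
    and on: "\<And>i j. i < k \<Longrightarrow> j < k \<Longrightarrow> b (e i) (e j) = (if i = j then 1 else 0)"
    and u: "u \<in> orth (e ` {..<k})" and st: "\<And>v. v \<in> orth (e ` {..<k}) \<Longrightarrow> a u v = \<nu> * b u v"
  shows "eigvec \<nu> u"
proof (cases "k = 0")
  case True
  then show ?thesis using u st by (auto simp: eigvec_def orth_def)
next
  case False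
  then have ne: "{..<k} \<noteq> {}" by auto
  have eV: "e i \<in> V" if "i < k" for i using e that by (simp add: eigvec_def)
  have uV: "u \<in> V" using u orth_V by auto
  have ue: "b u (e i) = 0" "a u (e i) = 0" if "i < k" for i
  proof -
    show *: "b u (e i) = 0" using u that by (auto simp: orth_def)
    show "a u (e i) = 0"
      using e[OF that] uV a_sym[of u "e i"] b_sym[of u "e i"] eV[OF that] * by (auto simp: eigvec_def)
  qed
  show ?thesis unfolding eigvec_def
  proof (intro conjI ballI uV)
    fix v assume v: "v \<in> V"
    define p where "p x = (\<Sum>i<k. b v (e i) * e i x)" for x
    have pV: "p \<in> V" unfolding p_def[abs_def] by (rule V_sum) (use ne eV in auto)
    have "b p (e j) = b v (e j)" if "j < k" for j
    proof -
      have "b p (e j) = (\<Sum>i<k. b v (e i) * b (e i) (e j))"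
        unfolding p_def[abs_def] by (rule ab_sum) (use ne eV that in auto)
      also have "\<dots> = (\<Sum>i<k. if i = j then b v (e i) else 0)"
        by (rule sum.cong) (use on that in auto)
      also have "\<dots> = b v (e j)" using that by simp
      finally show ?thesis .
    qed
    then have "(\<lambda>x. v x - p x) \<in> orth (e ` {..<k})"
      using v pV eV by (auto simp: orth_def bilin)
    from st[OF this] have "a u v - a u p = \<nu> * (b u v - b u p)" using uV v pV by (simp add: bilin)
    moreover have "b p u = 0" "a p u = 0"
      unfolding p_def[abs_def] using ab_sum[of "{..<k}" e u "\<lambda>i. b v (e i)"] ne eV uV ue
      by (auto simp: b_sym[of _ u] a_sym[of _ u])
    ultimately show "a u v = \<nu> * b u v" using a_sym[of u p] b_sym[of u p] uV pV by simp
  qed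
qed

end

section \<open>Counting eigenvalues\<close>

text \<open>More unknowns than equations: Gaussian elimination, one equation at a time. It bounds
  the number of independent eigenfunctions by the size of a spanning family.\<close>

lemma homogeneous_solution:
  fixes C :: "'i \<Rightarrow> 's \<Rightarrow> real"
  assumes "finite S" "finite I" "card S < card I"
  shows "\<exists>c. (\<exists>i\<in>I. c i \<noteq> 0) \<and> (\<forall>s\<in>S. (\<Sum>i\<in>I. c i * C i s) = 0)"
  using assms
proof (induction S arbitrary: I C rule: finite_induct)
  case empty
  then have "I \<noteq> {}" by auto
  then show ?case by (intro exI[of _ "\<lambda>_. 1"]) auto
next
  case (insert s S)
  show ?case
  proof (cases "\<forall>i\<in>I. C i s = 0")
    case True
    have "card S < card I" using insert by simp
    from insert.IH[OF \<open>finite I\<close> this, of C] True show ?thesis by auto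
  next
    case False
    then obtain p where p: "p \<in> I" "C p s \<noteq> 0" by auto
    define J where "J = I - {p}"
    have J: "finite J" "card S < card J" "p \<notin> J" "I = insert p J"
      using insert p by (auto simp: J_def card_Diff_singleton)
    from insert.IH[OF J(1,2), of "\<lambda>i t. C i t - C i s / C p s * C p t"]
    obtain c where c: "\<exists>i\<in>J. c i \<noteq> 0"
      and c0: "\<And>t. t \<in> S \<Longrightarrow> (\<Sum>i\<in>J. c i * (C i t - C i s / C p s * C p t)) = 0" by auto
    \<comment> \<open>The unknown at the pivot \<open>p\<close> is solved from the equation
      \<open>s\<close>.\<close>
    define c' where "c' = c(p := - (\<Sum>i\<in>J. c i * C i s) / C p s)"
    have sum: "(\<Sum>i\<in>I. c' i * C i t) = (\<Sum>i\<in>J. c i * C i t) - (\<Sum>i\<in>J. c i * C i s) / C p s * C p t" for t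
    proof -
      have "(\<Sum>i\<in>J. c' i * C i t) = (\<Sum>i\<in>J. c i * C i t)"
        by (rule sum.cong) (use J(3) in \<open>auto simp: c'_def\<close>)
      then show ?thesis using J by (simp add: c'_def)
    qed
    have "(\<Sum>i\<in>I. c' i * C i t) = 0" if "t \<in> insert s S" for t
    proof (cases "t = s")
      case True
      then show ?thesis using p(2) unfolding sum by simp
    next
      case False
      then have "(\<Sum>i\<in>J. c i * C i t) - (\<Sum>i\<in>J. c i * (C i s / C p s * C p t)) = 0"
        using c0[of t] that by (simp add: right_diff_distrib sum_subtractf)
      moreover have "(\<Sum>i\<in>J. c i * C i s) / C p s * C p t = (\<Sum>i\<in>J. c i * (C i s / C p s * C p t))"
        unfolding sum_distrib_right sum_divide_distrib by (rule sum.cong) auto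
      ultimately show ?thesis unfolding sum by linarith
    qed
    moreover have "\<exists>i\<in>I. c' i \<noteq> 0" using c J by (auto simp: c'_def)
    ultimately show ?thesis by blast
  qed
qed

locale neumann_form =
  form_pair "H1 \<Omega>" "dirichlet_form \<Omega>" "ip (lebesgue_on \<Omega>)" for \<Omega> :: "'a::euclidean_space set" +
  assumes H1_L2: "u \<in> H1 \<Omega> \<Longrightarrow> u \<in> L2 (lebesgue_on \<Omega>)"
begin

abbreviation "M \<equiv> lebesgue_on \<Omega>"

lemma eigvec_iff: "u \<in> neumann_eigenspace \<Omega> \<mu> \<longleftrightarrow> eigvec \<mu> u"
proof -
  have "(\<lambda>x. \<mu> * u x) \<in> L2_on \<Omega>" if "u \<in> H1 \<Omega>"
    using L2_scale[OF H1_L2[OF that], of \<mu>] by (auto simp: L2_on_def L2_def)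
  moreover have "(LINT x|M. \<mu> * u x * v x) = \<mu> * ip M u v" for v
    by (simp add: mult.assoc)
  ultimately show ?thesis
    by (auto simp: neumann_eigenspace_def neumann_laplacian_def eigvec_def)
qed

text \<open>Subtracting the projection onto the \<open>e i\<close> leaves an eigenvector for \<nu>
  in the complement, where the form is at least \<open>\<mu>' > \<nu>\<close> times the squared
  norm; so it vanishes almost everywhere. Coefficients with \<open>\<mu> i \<noteq> \<nu>\<close>
  are zero by the symmetry of the form.\<close>

lemma eigvec_below:
  fixes k :: nat
  assumes e: "\<And>i. i < k \<Longrightarrow> eigvec (\<mu> i) (e i)"
    and on: "\<And>i j. i < k \<Longrightarrow> j < k \<Longrightarrow> ip M (e i) (e j) = (if i = j then 1 else 0)"
    and gap: "\<And>v. v \<in> orth (e ` {..<k}) \<Longrightarrow> dirichlet_form \<Omega> v v \<ge> \<mu>' * ip M v v"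
    and "\<nu> < \<mu>'" and u: "eigvec \<nu> u"
  shows "\<exists>c. AE x in M. u x = (\<Sum>i\<in>{i. i < k \<and> \<mu> i = \<nu>}. c i * e i x)"
proof -
  have eV: "e i \<in> H1 \<Omega>" if "i < k" for i using e that by (simp add: eigvec_def)
  have uV: "u \<in> H1 \<Omega>" using u by (simp add: eigvec_def)
  have c0: "ip M u (e i) = 0" if "i < k" "\<mu> i \<noteq> \<nu>" for i
  proof -
    have "\<nu> * ip M u (e i) = \<mu> i * ip M (e i) u"
      using u e[OF that(1)] uV eV[OF that(1)] a_sym[OF uV eV[OF that(1)]]
      unfolding eigvec_def by metis
    also have "ip M (e i) u = ip M u (e i)" using b_sym uV eV[OF that(1)] by simp
    finally show ?thesis using that(2) by simp
  qed
  define r where "r x = u x - (\<Sum>i<k. ip M u (e i) * e i x)" for x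
  have r: "eigvec \<nu> r \<and> r \<in> orth (e ` {..<k})"
  proof (cases "k = 0")
    case True
    then have "r = u" by (auto simp: r_def)
    then show ?thesis using u True by (auto simp: orth_def eigvec_def)
  next
    case False
    then have ne: "{..<k} \<noteq> {}" by auto
    define p where "p x = (\<Sum>i<k. ip M u (e i) * e i x)" for x
    have pV: "p \<in> H1 \<Omega>" unfolding p_def[abs_def] by (rule V_sum) (use ne eV in auto)
    have reqs: "r = (\<lambda>x. u x - p x)" by (simp add: r_def p_def fun_eq_iff)
    have pb: "ip M p w = (\<Sum>i<k. ip M u (e i) * ip M (e i) w)"
      and pa: "dirichlet_form \<Omega> p w = (\<Sum>i<k. ip M u (e i) * dirichlet_form \<Omega> (e i) w)" if "w \<in> H1 \<Omega>" for w
      unfolding p_def[abs_def] using ab_sum[of "{..<k}" e w "\<lambda>i. ip M u (e i)"] ne eV that by auto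
    have "dirichlet_form \<Omega> p w = \<nu> * ip M p w" if "w \<in> H1 \<Omega>" for w
      unfolding pb[OF that] pa[OF that] sum_distrib_left
      by (rule sum.cong) (use e that c0 in \<open>force simp: eigvec_def\<close>)+
    then have "dirichlet_form \<Omega> r w = \<nu> * ip M r w" if "w \<in> H1 \<Omega>" for w
      using u that unfolding reqs a_diff[OF uV pV that] b_diff[OF uV pV that]
      by (simp add: eigvec_def right_diff_distrib)
    then have "eigvec \<nu> r" unfolding eigvec_def using V_diff[OF uV pV] reqs by simp
    moreover have "ip M p (e j) = ip M u (e j)" if "j < k" for j
    proof -
      have "ip M p (e j) = (\<Sum>i<k. if i = j then ip M u (e i) else 0)"
        unfolding pb[OF eV[OF that]] by (rule sum.cong) (use on that in auto)
      then show ?thesis using that by simp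
    qed
    ultimately show ?thesis
      using uV pV eV by (auto simp: orth_def reqs b_diff V_diff)
  qed
  then have rV: "r \<in> H1 \<Omega>" by (simp add: eigvec_def)
  have "\<nu> * ip M r r = dirichlet_form \<Omega> r r" using r rV by (simp add: eigvec_def)
  also have "\<dots> \<ge> \<mu>' * ip M r r" using gap r by blast
  finally have "ip M r r \<le> 0" using \<open>\<nu> < \<mu>'\<close>
    by (metis linorder_not_le mult_less_cancel_right)
  then have "ip M r r = 0" using b_nonneg[OF rV] by linarith
  then have "AE x in M. r x = 0" by (rule ip_eq_0_AE[OF H1_L2[OF rV]])
  moreover have "(\<Sum>i<k. ip M u (e i) * e i x) = (\<Sum>i\<in>{i. i < k \<and> \<mu> i = \<nu>}. ip M u (e i) * e i x)" for x
    by (rule sum.mono_neutral_right) (use c0 in auto)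
  ultimately show ?thesis
    by (intro exI[of _ "\<lambda>i. ip M u (e i)"]) (auto simp: r_def elim!: AE_mp)
qed

text \<open>By \<open>eigvec_below\<close> every eigenfunction for \<nu> is a combination of the
  listed ones, so a longer family is dependent by \<open>homogeneous_solution\<close>.\<close>

lemma multiplicity_le:
  fixes k :: nat
  assumes e: "\<And>i. i < k \<Longrightarrow> eigvec (\<mu> i) (e i)"
    and on: "\<And>i j. i < k \<Longrightarrow> j < k \<Longrightarrow> ip M (e i) (e j) = (if i = j then 1 else 0)"
    and gap: "\<And>v. v \<in> orth (e ` {..<k}) \<Longrightarrow> dirichlet_form \<Omega> v v \<ge> \<mu>' * ip M v v"
    and "\<nu> < \<mu>'"
  shows "neumann_multiplicity \<Omega> \<nu> \<le> enat (card {i. i < k \<and> \<mu> i = \<nu>})"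
  unfolding neumann_multiplicity_def
proof (rule SUP_least)
  fix m assume "m \<in> {m. \<exists>u. (\<forall>i<m. u i \<in> neumann_eigenspace \<Omega> \<nu>) \<and> lin_indep_ae \<Omega> m u}"
  then obtain u where u: "\<And>i. i < m \<Longrightarrow> eigvec \<nu> (u i)" and li: "lin_indep_ae \<Omega> m u"
    by (auto simp: eigvec_iff)
  let ?S = "{i. i < k \<and> \<mu> i = \<nu>}"
  have "\<forall>i\<in>{..<m}. \<exists>c. AE x in M. u i x = (\<Sum>s\<in>?S. c s * e s x)"
    using eigvec_below[OF e on gap \<open>\<nu> < \<mu>'\<close> u] by auto
  then obtain C where C: "\<And>i. i < m \<Longrightarrow> AE x in M. u i x = (\<Sum>s\<in>?S. C i s * e s x)"
    by (auto dest!: bchoice)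
  show "enat m \<le> enat (card ?S)"
  proof (rule ccontr)
    assume "\<not> enat m \<le> enat (card ?S)"
    then have "card ?S < card {..<m}" by simp
    from homogeneous_solution[OF _ _ this, of C]
    obtain c where c: "\<exists>i<m. c i \<noteq> 0" and c0: "\<And>s. s \<in> ?S \<Longrightarrow> (\<Sum>i<m. c i * C i s) = 0" by auto
    have "AE x in M. \<forall>i\<in>{..<m}. u i x = (\<Sum>s\<in>?S. C i s * e s x)"
      by (rule AE_finite_allI) (use C in auto)
    then have "AE x in M. (\<Sum>i<m. c i * u i x) = 0"
    proof (rule AE_mp, intro AE_I2 impI)
      fix x assume "\<forall>i\<in>{..<m}. u i x = (\<Sum>s\<in>?S. C i s * e s x)"
      then have "(\<Sum>i<m. c i * u i x) = (\<Sum>i<m. \<Sum>s\<in>?S. c i * C i s * e s x)"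
        by (intro sum.cong) (auto simp: sum_distrib_left mult.assoc)
      also have "\<dots> = (\<Sum>s\<in>?S. (\<Sum>i<m. c i * C i s) * e s x)"
        by (subst sum.swap) (simp add: sum_distrib_right)
      also have "\<dots> = 0" by (rule sum.neutral) (use c0 in auto)
      finally show "(\<Sum>i<m. c i * u i x) = 0" .
    qed
    then show False using li c by (auto simp: lin_indep_ae_def)
  qed
qed

lemma multiplicity_ge:
  fixes k :: nat
  assumes e: "\<And>i. i < k \<Longrightarrow> eigvec (\<mu> i) (e i)"
    and on: "\<And>i j. i < k \<Longrightarrow> j < k \<Longrightarrow> ip M (e i) (e j) = (if i = j then 1 else 0)"
  shows "enat (card {i. i < k \<and> \<mu> i = \<nu>}) \<le> neumann_multiplicity \<Omega> \<nu>"
proof -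
  let ?S = "{i. i < k \<and> \<mu> i = \<nu>}"
  obtain f where f: "bij_betw f {..<card ?S} ?S"
    using ex_bij_betw_nat_finite[of ?S] by (auto simp: lessThan_atLeast0)
  have fS: "f i < k" "\<mu> (f i) = \<nu>" if "i < card ?S" for i
    using bij_betwE[OF f] that by auto
  have eV: "e i \<in> H1 \<Omega>" if "i < k" for i using e that by (simp add: eigvec_def)
  have "lin_indep_ae \<Omega> (card ?S) (\<lambda>i. e (f i))"
    unfolding lin_indep_ae_def
  proof (intro allI impI)
    fix c j assume ae: "AE x in M. (\<Sum>i<card ?S. c i * e (f i) x) = 0" and j: "j < card ?S"
    then have ne: "{..<card ?S} \<noteq> {}" by auto
    have "0 = ip M (\<lambda>x. \<Sum>i<card ?S. c i * e (f i) x) (e (f j))"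
      by (rule integral_eq_zero_AE[symmetric]) (use ae in \<open>auto elim!: AE_mp\<close>)
    also have "\<dots> = (\<Sum>i<card ?S. c i * ip M (e (f i)) (e (f j)))"
      by (rule ab_sum(1)) (use ne eV fS j in auto)
    also have "\<dots> = (\<Sum>i<card ?S. if i = j then c j else 0)"
    proof (rule sum.cong)
      fix i assume "i \<in> {..<card ?S}"
      then show "c i * ip M (e (f i)) (e (f j)) = (if i = j then c j else 0)"
        using on[of "f i" "f j"] fS j bij_betw_imp_inj_on[OF f] by (auto simp: inj_on_eq_iff)
    qed simp
    also have "\<dots> = c j" using j by simp
    finally show "c j = 0" by simp
  qed
  then show ?thesis unfolding neumann_multiplicity_def
    using e fS by (intro SUP_upper) (auto simp: eigvec_iff intro!: exI[of _ "\<lambda>i. e (f i)"])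
qed

text \<open>The bridge from the counting definition to successive minimisation:
  \<open>e 0, ..., e k\<close> contribute \<open>k + 1\<close> eigenvalues up to
  \<open>\<mu> k\<close>, while strictly below \<open>\<mu> k\<close> the gap leaves room for the
  \<open>k\<close> vectors \<open>e 0, ..., e (k - 1)\<close> only. Vectors are indexed from 0,
  eigenvalues from 1.\<close>

theorem neumann_eigenvalue_eq:
  assumes e: "\<And>i. i \<le> k \<Longrightarrow> eigvec (\<mu> i) (e i)"
    and on: "\<And>i j. i \<le> k \<Longrightarrow> j \<le> k \<Longrightarrow> ip M (e i) (e j) = (if i = j then 1 else 0)"
    and mono: "\<And>i. i \<le> k \<Longrightarrow> \<mu> i \<le> \<mu> k"
    and gap: "\<And>v. v \<in> orth (e ` {..<k}) \<Longrightarrow> dirichlet_form \<Omega> v v \<ge> \<mu> k * ip M v v"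
  shows "neumann_eigenvalue \<Omega> (Suc k) = \<mu> k"
  unfolding neumann_eigenvalue_def
proof (rule Least_equality)
  let ?F = "\<mu> ` {..<Suc k}"
  have card: "(\<Sum>\<nu>\<in>F. enat (card {i. i < n \<and> \<mu> i = \<nu>})) = enat (card {i. i < n \<and> \<mu> i \<in> F})"
    if "finite F" for n and F :: "real set"
    using that
  proof (induction F rule: finite_induct)
    case empty
    then show ?case by (simp add: zero_enat_def)
  next
    case (insert \<nu> F)
    have "card {i. i < n \<and> \<mu> i \<in> insert \<nu> F} = card ({i. i < n \<and> \<mu> i = \<nu>} \<union> {i. i < n \<and> \<mu> i \<in> F})"
      by (rule arg_cong[where f=card]) auto
    also have "\<dots> = card {i. i < n \<and> \<mu> i = \<nu>} + card {i. i < n \<and> \<mu> i \<in> F}"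
      by (rule card_Un_disjoint) (use insert in auto)
    finally show ?case using insert by simp
  qed
  have "enat (Suc k) = (\<Sum>\<nu>\<in>?F. enat (card {i. i < Suc k \<and> \<mu> i = \<nu>}))"
  proof -
    have "{i. i < Suc k \<and> \<mu> i \<in> ?F} = {..<Suc k}" by auto
    then show ?thesis by (simp add: card)
  qed
  also have "\<dots> \<le> (\<Sum>\<nu>\<in>?F. neumann_multiplicity \<Omega> \<nu>)"
    by (rule sum_mono) (rule multiplicity_ge[where e=e], use e on in auto)
  also have "\<dots> \<le> neumann_count \<Omega> (\<mu> k)"
    unfolding neumann_count_def by (rule SUP_upper) (use mono in auto)
  finally show "enat (Suc k) \<le> neumann_count \<Omega> (\<mu> k)" .
next
  fix \<nu> assume *: "enat (Suc k) \<le> neumann_count \<Omega> \<nu>"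
  have card: "(\<Sum>\<nu>\<in>F. card {i. i < k \<and> \<mu> i = \<nu>}) \<le> k" if "finite F" for F :: "real set"
  proof -
    have "(\<Sum>\<nu>\<in>F. card {i. i < k \<and> \<mu> i = \<nu>}) = card (\<Union>\<nu>\<in>F. {i. i < k \<and> \<mu> i = \<nu>})"
      by (rule card_UN_disjoint[symmetric]) (use that in auto)
    also have "\<dots> \<le> card {..<k}" by (rule card_mono) auto
    finally show ?thesis by simp
  qed
  show "\<mu> k \<le> \<nu>"
  proof (rule ccontr)
    assume "\<not> \<mu> k \<le> \<nu>"
    have "neumann_count \<Omega> \<nu> \<le> enat k"
      unfolding neumann_count_def
    proof (rule SUP_least)
      fix F assume "F \<in> {F. finite F \<and> F \<subseteq> {..\<nu>}}"
      then have F: "finite F" "F \<subseteq> {..\<nu>}" by auto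
      have "(\<Sum>\<nu>\<in>F. neumann_multiplicity \<Omega> \<nu>) \<le> (\<Sum>\<nu>\<in>F. enat (card {i. i < k \<and> \<mu> i = \<nu>}))"
        by (rule sum_mono, rule multiplicity_le[where e=e and \<mu>'="\<mu> k"])
          (use e on gap F \<open>\<not> \<mu> k \<le> \<nu>\<close> in auto)
      also have "\<dots> = enat (\<Sum>\<nu>\<in>F. card {i. i < k \<and> \<mu> i = \<nu>})"
        using F(1) by (induction F rule: finite_induct) (auto simp: zero_enat_def)
      also have "\<dots> \<le> enat k" using card[OF F(1)] by simp
      finally show "(\<Sum>\<nu>\<in>F. neumann_multiplicity \<Omega> \<nu>) \<le> enat k" .
    qed
    then show False using * by (metis Suc_n_not_le_n enat_ord_simps(1) order_trans)
  qed
qed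

end

section \<open>Weak gradients of differentiable functions\<close>

text \<open>Fubini's theorem and translations are applied in \<open>lborel\<close>, whereas the
  definitions use its completion; for Borel integrands the integrals agree.\<close>

lemma integral_lebesgue_on_lborel:
  fixes f :: "'a::euclidean_space \<Rightarrow> real"
  assumes "S \<in> sets borel" "(\<lambda>x. indicator S x * f x) \<in> borel_measurable borel"
  shows "(LINT x|lebesgue_on S. f x) = (LINT x|lborel. indicator S x * f x)"
proof -
  have "(LINT x|lebesgue_on S. f x) = (LINT x|lebesgue. indicator S x * f x)"
    using assms(1) by (subst integral_restrict_space) auto
  also have "\<dots> = (LINT x|lborel. indicator S x * f x)"
    by (rule integral_completion) (use assms in simp)
  finally show ?thesis .
qed

lemma has_derivative_zero_outside:
  assumes "closed K" "z \<notin> K" "\<And>z. z \<notin> K \<Longrightarrow> F z = (0::real)"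
  shows "(F has_derivative (\<lambda>_. 0)) (at z)"
proof (rule has_derivative_transform_within_open[OF has_derivative_const[of 0]])
  show "open (- K)" using assms by auto
qed (use assms in auto)

text \<open>By translation invariance the difference quotients of \<open>F\<close> have integral zero.\<close>

lemma integral_partial_derivative_0:
  fixes F :: "'a::euclidean_space \<Rightarrow> real"
  assumes D: "\<And>z. (F has_derivative D z) (at z)"
    and cont: "continuous_on UNIV (\<lambda>z. D z b)"
    and K: "compact K" "\<And>z. z \<notin> K \<Longrightarrow> F z = 0"
  shows "(LINT z|lborel. D z b) = 0"
proof -
  have D0: "D z b = 0" if "z \<notin> K" for z
  proof -
    have "(F has_derivative (\<lambda>_. 0)) (at z)"
      by (rule has_derivative_zero_outside[OF compact_imp_closed[OF K(1)] that K(2)])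
    then show ?thesis using has_derivative_unique[OF D[of z]] by simp
  qed
  obtain C where C: "\<And>z. \<bar>D z b\<bar> \<le> C" "C \<ge> 0"
  proof -
    have "bounded ((\<lambda>z. D z b) ` K)"
      using K(1) cont by (intro compact_imp_bounded compact_continuous_image) (auto intro: continuous_on_subset)
    then obtain C where "\<forall>z\<in>K. \<bar>D z b\<bar> \<le> C" unfolding bounded_iff by auto
    then have "\<bar>D z b\<bar> \<le> max C 0" for z using D0[of z] by (cases "z \<in> K") (auto simp: le_max_iff_disj)
    then show ?thesis by (rule that) simp
  qed
  obtain R where R: "\<And>z. z \<in> K \<Longrightarrow> norm z \<le> R" using compact_imp_bounded[OF K(1)] by (auto simp: bounded_iff)
  have Fcont: "continuous_on UNIV F"
    using D by (auto intro!: continuous_at_imp_continuous_on has_derivative_continuous)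
  have [measurable]: "F \<in> borel_measurable borel" "(\<lambda>z. D z b) \<in> borel_measurable borel"
    using Fcont cont by (auto intro: borel_measurable_continuous_onI)
  define Q where "Q n z = real (Suc n) * (F (z + (1 / real (Suc n)) *\<^sub>R b) - F z)" for n z
  have Fint: "integrable lborel F"
  proof -
    have "integrable lborel (\<lambda>z. indicator K z *\<^sub>R F z)"
      using K(1) Fcont by (intro borel_integrable_compact) (auto intro: continuous_on_subset)
    moreover have "(\<lambda>z. indicator K z *\<^sub>R F z) = F" by (rule ext) (use K(2) in \<open>auto simp: indicator_def\<close>)
    ultimately show ?thesis by simp
  qed
  have Db: "(\<lambda>s. D z (s *\<^sub>R b)) = (*) (D z b)" for z
    by (rule ext) (simp add: linear_cmul[OF has_derivative_linear[OF D]])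
  \<comment> \<open>The mean value theorem bounds all quotients by the supremum of the derivative,
    and steps no longer than \<open>b\<close> keep their supports in one ball; together these give
    the dominating function.\<close>
  have quot: "\<exists>\<xi>. (F (z + h *\<^sub>R b) - F z) = h * D (z + \<xi> *\<^sub>R b) b" if "h > 0" for z h
  proof -
    have "((\<lambda>t. F (z + t *\<^sub>R b)) has_real_derivative D (z + t *\<^sub>R b) b) (at t)" for t
    proof -
      have "((\<lambda>t. z + t *\<^sub>R b) has_derivative (\<lambda>t. t *\<^sub>R b)) (at t)"
        by (auto intro!: derivative_eq_intros)
      from has_derivative_compose[OF this D]
      have "((\<lambda>t. F (z + t *\<^sub>R b)) has_derivative (\<lambda>s. D (z + t *\<^sub>R b) (s *\<^sub>R b))) (at t)" .
      then show ?thesis unfolding has_field_derivative_def Db .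
    qed
    from MVT2[OF that this] show ?thesis by auto
  qed
  have Qbound: "\<bar>Q n z\<bar> \<le> C" for n z
  proof -
    obtain \<xi> where "F (z + (1 / real (Suc n)) *\<^sub>R b) - F z = 1 / real (Suc n) * D (z + \<xi> *\<^sub>R b) b"
      using quot[of "1 / real (Suc n)" z] by auto
    then have "Q n z = D (z + \<xi> *\<^sub>R b) b" unfolding Q_def by simp
    then show ?thesis using C(1) by simp
  qed
  have Q0: "Q n z = 0" if "z \<notin> cball 0 (R + norm b)" for n z
  proof -
    have "norm z \<le> norm (z + (1 / real (Suc n)) *\<^sub>R b) + norm ((1 / real (Suc n)) *\<^sub>R b)"
      using norm_triangle_ineq4[of "z + (1 / real (Suc n)) *\<^sub>R b" "(1 / real (Suc n)) *\<^sub>R b"] by simp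
    also have "norm ((1 / real (Suc n)) *\<^sub>R b) \<le> norm b"
      using mult_left_mono[of 1 "1 + real n" "norm b"] by (simp add: divide_le_eq)
    finally have "norm z \<le> norm (z + (1 / real (Suc n)) *\<^sub>R b) + norm b" by simp
    moreover have "R + norm b < norm z" using that by (simp add: dist_norm)
    ultimately have "R < norm (z + (1 / real (Suc n)) *\<^sub>R b)" "R < norm z"
      using norm_ge_zero[of b] by linarith+
    then have "z + (1 / real (Suc n)) *\<^sub>R b \<notin> K" "z \<notin> K" using R by (meson linorder_not_le)+
    then show ?thesis using K(2) by (simp add: Q_def)
  qed
  have Qlim: "(\<lambda>n. Q n z) \<longlonglongrightarrow> D z b" for z
  proof -
    have "((\<lambda>t. F (z + t *\<^sub>R b)) has_real_derivative D z b) (at 0)"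
    proof -
      have "((\<lambda>t. z + t *\<^sub>R b) has_derivative (\<lambda>t. t *\<^sub>R b)) (at 0)"
        by (auto intro!: derivative_eq_intros)
      moreover have "(F has_derivative D z) (at (z + 0 *\<^sub>R b))" using D[of z] by simp
      ultimately have "((\<lambda>t. F (z + t *\<^sub>R b)) has_derivative (\<lambda>s. D z (s *\<^sub>R b))) (at 0)"
        by (rule has_derivative_compose)
      then have "((\<lambda>t. F (z + t *\<^sub>R b)) has_derivative (\<lambda>s. D z (s *\<^sub>R b))) (at 0)" .
      then show ?thesis unfolding has_field_derivative_def Db .
    qed
    then have "((\<lambda>h. (F (z + h *\<^sub>R b) - F z) / h) \<longlongrightarrow> D z b) (at 0)"
      by (simp add: has_field_derivative_iff)
    moreover have "filterlim (\<lambda>n. 1 / real (Suc n)) (at 0) sequentially"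
      by (rule filterlim_atI[OF LIMSEQ_Suc[OF lim_1_over_n]]) auto
    ultimately have "(\<lambda>n. (F (z + (1 / real (Suc n)) *\<^sub>R b) - F z) / (1 / real (Suc n))) \<longlonglongrightarrow> D z b"
      by (rule filterlim_compose)
    then show ?thesis by (simp add: Q_def[abs_def] mult.commute del: of_nat_Suc)
  qed
  have shift: "integrable lborel (\<lambda>z. F (z + c)) \<and> (LINT z|lborel. F (z + c)) = (LINT z|lborel. F z)" for c
  proof -
    have "(LINT z|lborel. F z) = (LINT z|distr lborel borel ((+) c). F z)" by (simp add: lborel_distr_plus)
    also have "\<dots> = (LINT z|lborel. F (c + z))" by (rule integral_distr) auto
    moreover have "integrable (distr lborel borel ((+) c)) F" using Fint by (simp add: lborel_distr_plus)
    then have "integrable lborel (\<lambda>z. F (c + z))" by (rule integrable_distr[rotated]) auto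
    ultimately show ?thesis by (simp add: add.commute)
  qed
  have "(LINT z|lborel. Q n z) = 0" for n
    using shift Fint by (simp add: Q_def)
  moreover have "(\<lambda>n. LINT z|lborel. Q n z) \<longlonglongrightarrow> (LINT z|lborel. D z b)"
  proof (rule integral_dominated_convergence[where w="\<lambda>z. C * indicator (cball 0 (R + norm b)) z"])
    show "integrable lborel (\<lambda>z. C * indicator (cball 0 (R + norm b)) z)"
      using emeasure_bounded_finite[OF bounded_cball, of 0 "R + norm b"]
      by (intro integrable_mult_right integrable_real_indicator) auto
    show "AE z in lborel. norm (Q n z) \<le> C * indicator (cball 0 (R + norm b)) z" for n
      using Qbound Q0 by (intro AE_I2) (auto simp: indicator_def)
  qed (use Qlim in \<open>auto simp: Q_def\<close>)
  ultimately show ?thesis by (simp add: LIMSEQ_const_iff)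
qed

text \<open>The product of \<open>v\<close> with a test function is C^1 with compact support, so its
  partial derivatives have integral zero. Regularity of \<open>v\<close> up to and beyond the
  boundary gives square integrability on the bounded set.\<close>

lemma C1_has_weak_gradient:
  fixes v :: "'a::euclidean_space \<Rightarrow> real"
  assumes \<Omega>: "bounded \<Omega>" "\<Omega> \<in> sets borel"
    and D: "\<And>z. (v has_derivative D z) (at z)"
    and cont: "\<And>b. b \<in> Basis \<Longrightarrow> continuous_on UNIV (\<lambda>z. D z b)"
  shows "has_weak_gradient \<Omega> v (\<lambda>z. \<Sum>b\<in>Basis. D z b *\<^sub>R b)"
proof -
  let ?G = "\<lambda>z. \<Sum>b\<in>Basis. D z b *\<^sub>R b"
  have vcont: "continuous_on UNIV v"
    using D by (auto intro!: continuous_at_imp_continuous_on has_derivative_continuous)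
  have Gcont: "continuous_on UNIV ?G" by (intro continuous_intros cont)
  have L2: "f \<in> L2_on \<Omega>" if fc: "continuous_on UNIV f" for f :: "'a \<Rightarrow> 'b::euclidean_space"
  proof -
    have fm: "f \<in> borel_measurable (lebesgue_on \<Omega>)"
      using borel_measurable_continuous_onI[OF fc]
      by (intro measurable_restrict_space1 measurable_completion) simp
    obtain B where B: "\<And>x. x \<in> \<Omega> \<Longrightarrow> norm (f x) \<le> B"
    proof -
      have "compact (f ` closure \<Omega>)" using \<Omega>(1) fc
        by (intro compact_continuous_image) (auto intro: continuous_on_subset)
      then have "bounded (f ` closure \<Omega>)" by (rule compact_imp_bounded)
      then show ?thesis using that closure_subset unfolding bounded_iff by blast
    qed
    have "emeasure lebesgue \<Omega> < \<infinity>" using \<Omega> emeasure_bounded_finite[OF \<Omega>(1)] by simp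
    then have "finite_measure (lebesgue_on \<Omega>)"
      using \<Omega> by (intro finite_measureI) (auto simp: emeasure_restrict_space)
    then have "integrable (lebesgue_on \<Omega>) (\<lambda>x. (norm (f x))\<^sup>2)"
      using fm B by (intro finite_measure.integrable_const_bound[where B="B\<^sup>2"])
        (auto intro!: AE_I2 power_mono)
    then show ?thesis using fm by (simp add: L2_on_def)
  qed
  show ?thesis unfolding has_weak_gradient_def
  proof (intro conjI ballI L2 vcont Gcont)
    fix \<phi> b assume \<phi>: "\<phi> \<in> test_functions \<Omega>" and b: "b \<in> (Basis :: 'a set)"
    have Ck: "Ck (Suc (Suc 0)) \<phi>" using \<phi> unfolding test_functions_def by blast
    obtain S where S: "compact S" "S \<subseteq> \<Omega>" "\<And>x. x \<notin> S \<Longrightarrow> \<phi> x = 0"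
    proof
      show "compact (closure {x. \<phi> x \<noteq> 0})" "closure {x. \<phi> x \<noteq> 0} \<subseteq> \<Omega>"
        using \<phi> unfolding test_functions_def by blast+
      fix x assume x: "x \<notin> closure {x. \<phi> x \<noteq> 0}"
      show "\<phi> x = 0"
      proof (rule ccontr)
        assume "\<phi> x \<noteq> 0"
        then have "x \<in> closure {x. \<phi> x \<noteq> 0}" by (intro subsetD[OF closure_subset]) simp
        then show False using x by simp
      qed
    qed
    obtain E where E: "\<And>x. (\<phi> has_derivative E x) (at x)" "\<And>b. b \<in> Basis \<Longrightarrow> Ck (Suc 0) (\<lambda>x. E x b)"
      using Ck_SucE[OF Ck] by blast
    have \<phi>c: "continuous_on UNIV \<phi>" and Ec: "continuous_on UNIV (\<lambda>x. E x b)"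
      using Ck_continuous[OF Ck] Ck_continuous[OF E(2)[OF b]] by auto
    have E0: "E x b = 0" if "x \<notin> S" for x
    proof -
      have "(\<phi> has_derivative (\<lambda>_. 0)) (at x)" by (rule has_derivative_zero_outside[OF compact_imp_closed[OF S(1)] that S(3)])
      then show ?thesis using has_derivative_unique[OF E(1)[of x]] by simp
    qed
    have int: "integrable lborel f" if "continuous_on UNIV f" "\<And>x. x \<notin> S \<Longrightarrow> f x = 0" for f :: "'a \<Rightarrow> real"
    proof -
      have "integrable lborel (\<lambda>z. indicator S z *\<^sub>R f z)"
        using S(1) that(1) by (intro borel_integrable_compact) (auto intro: continuous_on_subset)
      moreover have "(\<lambda>z. indicator S z *\<^sub>R f z) = f" by (rule ext) (use that(2) in \<open>auto simp: indicator_def\<close>)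
      ultimately show ?thesis by simp
    qed
    have conv: "(LINT x|lebesgue_on \<Omega>. f x) = (LINT x|lborel. f x)"
      if "continuous_on UNIV f" "\<And>x. x \<notin> S \<Longrightarrow> f x = 0" for f :: "'a \<Rightarrow> real"
    proof -
      have eq: "(\<lambda>x. indicator \<Omega> x * f x) = f" using that(2) S(2) by (intro ext) (auto simp: indicator_def)
      show ?thesis using that(1) \<Omega>
        by (subst integral_lebesgue_on_lborel) (auto simp: eq intro: borel_measurable_continuous_onI)
    qed
    have pd: "partial_deriv b \<phi> x = E x b" for x by (rule partial_deriv_eq[OF E(1)])
    have Gb: "?G x \<bullet> b = D x b" for x using b by (simp add: inner_sum_left inner_Basis if_distrib cong: if_cong)
    have c1: "continuous_on UNIV (\<lambda>x. v x * E x b)" and c2: "continuous_on UNIV (\<lambda>x. D x b * \<phi> x)"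
      by (intro continuous_intros vcont \<phi>c Ec cont b)+
    have "(LINT x|lborel. v x * E x b + D x b * \<phi> x) = 0"
    proof (rule integral_partial_derivative_0[where F="\<lambda>x. v x * \<phi> x" and D="\<lambda>x h. v x * E x h + D x h * \<phi> x" and K="S"])
      show "((\<lambda>x. v x * \<phi> x) has_derivative (\<lambda>h. v z * E z h + D z h * \<phi> z)) (at z)" for z
        by (rule has_derivative_mult[OF D E(1)])
      show "continuous_on UNIV (\<lambda>z. v z * E z b + D z b * \<phi> z)"
        by (rule continuous_on_add[OF c1 c2])
      show "v z * \<phi> z = 0" if "z \<notin> S" for z using S(3)[OF that] by simp
    qed (rule S(1))
    then have "(LINT x|lborel. v x * E x b) = - (LINT x|lborel. D x b * \<phi> x)"
      using int[OF c1] int[OF c2] E0 S(3) by (simp add: eq_neg_iff_add_eq_0)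
    then show "(LINT x|lebesgue_on \<Omega>. v x * partial_deriv b \<phi> x) = - (LINT x|lebesgue_on \<Omega>. (?G x \<bullet> b) * \<phi> x)"
      unfolding pd Gb using conv[OF c1] conv[OF c2] E0 S(3) by simp
  qed
qed

section \<open>The strip\<close>

lemma smooth_derivE:
  fixes f :: "real \<Rightarrow> real"
  assumes "smooth f"
  obtains f' where "\<And>x. (f has_real_derivative f' x) (at x)" "smooth f'"
proof
  have *: "Ck (Suc n) f" for n using assms by (simp add: smooth_def)
  have fd: "(f has_derivative frechet_derivative f (at x)) (at x)" for x
    using * [of 0] frechet_derivative_works by auto
  have "frechet_derivative f (at x) = (*) (partial_deriv 1 f x)" for x
  proof
    fix s
    have "frechet_derivative f (at x) s = s * frechet_derivative f (at x) 1"
      using linear_cmul[OF has_derivative_linear[OF fd[of x]], of s 1]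
      by (simp only: real_scaleR_def mult_1_right)
    then show "frechet_derivative f (at x) s = partial_deriv 1 f x * s"
      by (simp only: partial_deriv_def mult.commute)
  qed
  with fd show "(f has_real_derivative partial_deriv 1 f x) (at x)" for x
    by (simp only: has_field_derivative_def)
  show "smooth (partial_deriv 1 f)"
    using * by (auto simp: smooth_def)
qed

lemma smooth_continuous: "smooth f \<Longrightarrow> continuous_on UNIV f"
  using Ck_continuous[of 0 f] by (simp add: smooth_def)

lemma has_derivative_shear:
  fixes A B p :: "real \<Rightarrow> real" and z :: "real \<times> real"
  assumes "\<And>x. (A has_real_derivative A' x) (at x)" "\<And>x. (B has_real_derivative B' x) (at x)"
    "\<And>x. (p has_real_derivative q x) (at x)"
  shows "((\<lambda>z. A (fst z) * B (snd z - p (fst z))) has_derivative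
    (\<lambda>h. A' (fst z) * fst h * B (snd z - p (fst z))
        + A (fst z) * (B' (snd z - p (fst z)) * (snd h - q (fst z) * fst h)))) (at z)"
proof -
  have A: "(A has_derivative (*) (A' x)) (at x)" and B: "(B has_derivative (*) (B' x)) (at x)"
    and p: "(p has_derivative (*) (q x)) (at x)" for x
    using assms by (simp_all add: has_field_derivative_def)
  have 1: "((\<lambda>z. A (fst z)) has_derivative (\<lambda>h. A' (fst z) * fst h)) (at z)"
    by (rule has_derivative_compose[OF has_derivative_fst[OF has_derivative_ident] A])
  have 2: "((\<lambda>z. p (fst z)) has_derivative (\<lambda>h. q (fst z) * fst h)) (at z)"
    by (rule has_derivative_compose[OF has_derivative_fst[OF has_derivative_ident] p])
  have 3: "((\<lambda>z. snd z - p (fst z)) has_derivative (\<lambda>h. snd h - q (fst z) * fst h)) (at z)"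
    by (rule has_derivative_diff[OF has_derivative_snd[OF has_derivative_ident] 2])
  have 4: "((\<lambda>z. B (snd z - p (fst z))) has_derivative (\<lambda>h. B' (snd z - p (fst z)) * (snd h - q (fst z) * fst h))) (at z)"
    by (rule has_derivative_compose[OF 3 B])
  show ?thesis
    by (rule has_derivative_eq_rhs[OF has_derivative_mult[OF 1 4]]) auto
qed

lemma polynomial_antiderivative:
  assumes "real_polynomial_function q"
  obtains p where "p 0 = (c::real)" "\<And>x. (p has_real_derivative q x) (at x)"
proof -
  obtain a n where q: "q = (\<lambda>x. \<Sum>i\<le>n. a i * x ^ i)"
    using assms real_polynomial_function_iff_sum[of q] by auto
  show thesis
  proof
    show "((\<lambda>x. c + (\<Sum>i\<le>n. a i / real (Suc i) * x ^ Suc i)) has_real_derivative q x) (at x)" for x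
    proof -
      have "((\<lambda>x. c + (\<Sum>i\<le>n. a i / real (Suc i) * x ^ Suc i)) has_real_derivative
          (\<Sum>i\<le>n. a i / real (Suc i) * (real (Suc i) * x ^ i))) (at x)"
      proof (rule DERIV_cong[OF DERIV_add[OF DERIV_const DERIV_sum]])
        show "((\<lambda>x. a i / real (Suc i) * x ^ Suc i) has_real_derivative a i / real (Suc i) * (real (Suc i) * x ^ i)) (at x)" for i
          using DERIV_cmult[OF DERIV_pow, of "a i / real (Suc i)" "Suc i" x UNIV] by (simp only: diff_Suc_Suc diff_zero)
      qed simp
      moreover have "(\<Sum>i\<le>n. a i / real (Suc i) * (real (Suc i) * x ^ i)) = q x"
        unfolding q by (rule sum.cong) auto
      ultimately show ?thesis by (rule DERIV_cong)
    qed
  qed simp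
qed

lemma smooth_of_deriv:
  assumes "\<And>x. (p has_real_derivative q x) (at x)" "smooth q"
  shows "smooth p"
  unfolding smooth_def
proof
  fix n
  have "Ck n q" using assms(2) by (simp add: smooth_def)
  then show "Ck n p" by (rule Ck_Suc_D[OF Ck_realI[OF assms(1)]])
qed

text \<open>A uniform margin at both ends rather than mere vanishing there: it keeps the supports of
  products inside the domain and absorbs the replacement of \<open>g\<close> by a nearby
  function.\<close>

definition cutoff :: "real \<Rightarrow> (real \<Rightarrow> real) \<Rightarrow> bool" where
  "cutoff L A \<longleftrightarrow> smooth A \<and> (\<exists>e>0. \<forall>x. x \<notin> {e..L - e} \<longrightarrow> A x = 0)"

lemma cutoff_mult: "cutoff L A \<Longrightarrow> smooth f \<Longrightarrow> cutoff L (\<lambda>x. A x * f x)"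
  by (auto simp: cutoff_def intro: smooth_mult)

text \<open>\<open>g\<close> lives on the whole line, so that the functions below are continuous on
  the whole plane; \<open>C1_extension\<close> produces such a \<open>g\<close> from data on
  \<open>{0..l}\<close>.\<close>

locale strip =
  fixes l d :: real and g g' :: "real \<Rightarrow> real"
  assumes l: "0 < l" and d: "0 < d"
    and g: "\<And>x. (g has_real_derivative g' x) (at x)"
    and g'c: "continuous_on UNIV g'"
begin

section \<open>The domain, its closure and integrals over it\<close>

definition \<Omega> :: "(real \<times> real) set" where
  "\<Omega> = {z. 0 < fst z \<and> fst z < l \<and> g (fst z) < snd z \<and> snd z < g (fst z) + d}"

definition K :: "(real \<times> real) set" where
  "K = {z. 0 \<le> fst z \<and> fst z \<le> l \<and> g (fst z) \<le> snd z \<and> snd z \<le> g (fst z) + d}"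

abbreviation M :: "(real \<times> real) measure" where "M \<equiv> lebesgue_on \<Omega>"

lemma gc: "continuous_on UNIV g"
  using g DERIV_continuous_on by blast

lemma gc': "continuous_on S (\<lambda>z::real \<times> real. g (fst z))" "continuous_on S (\<lambda>z::real \<times> real. g' (fst z))"
  by (rule continuous_on_compose2[OF gc] continuous_on_compose2[OF g'c]; auto intro: continuous_intros)+

lemma open_\<Omega>: "open \<Omega>"
  unfolding \<Omega>_def by (intro open_Collect_conj open_Collect_less continuous_intros gc')

lemma compact_K: "compact K"
proof -
  have "closed K"
    unfolding K_def by (intro closed_Collect_conj closed_Collect_le continuous_intros gc')
  moreover have "bounded K"
  proof -
    have "compact (g ` {0..l})"
      by (intro compact_continuous_image) (auto intro: continuous_on_subset[OF gc])
    then obtain B where B: "\<And>x. x \<in> {0..l} \<Longrightarrow> \<bar>g x\<bar> \<le> B"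
      using compact_imp_bounded by (force simp: bounded_iff)
    have "K \<subseteq> {0..l} \<times> {- B..B + d}"
      unfolding K_def
    proof clarsimp
      fix x y assume "0 \<le> x" "x \<le> l" "g x \<le> y" "y \<le> g x + d"
      then show "- B \<le> y \<and> y \<le> B + d" using B[of x] by (auto simp: abs_le_iff)
    qed
    then show ?thesis by (rule bounded_subset[rotated]) (intro bounded_Times bounded_closed_interval)
  qed
  ultimately show ?thesis by (simp add: compact_eq_bounded_closed)
qed

lemma \<Omega>_K: "\<Omega> \<subseteq> K"
  by (auto simp: \<Omega>_def K_def)

lemma bounded_\<Omega>: "bounded \<Omega>"
  using compact_imp_bounded[OF compact_K] \<Omega>_K bounded_subset by blast

lemma \<Omega>_sets [measurable, simp]: "\<Omega> \<in> sets borel"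
  using open_\<Omega> by (rule borel_open)

lemma space_M [simp]: "space M = \<Omega>"
  by simp

lemma finite_M: "finite_measure M"
proof -
  have "emeasure lebesgue \<Omega> < \<infinity>" using bounded_\<Omega> emeasure_bounded_finite by simp
  then show ?thesis by (intro finite_measureI) (auto simp: emeasure_restrict_space)
qed

lemma cont_measurable: "continuous_on UNIV F \<Longrightarrow> (F :: real \<times> real \<Rightarrow> real) \<in> borel_measurable M"
  by (intro measurable_restrict_space1 measurable_completion) (simp add: borel_measurable_continuous_onI)

lemma cont_bounded:
  assumes "continuous_on UNIV F"
  obtains C where "\<And>z. z \<in> K \<Longrightarrow> \<bar>F z :: real\<bar> \<le> C"
proof -
  have "compact (F ` K)" by (intro compact_continuous_image compact_K) (use assms in \<open>auto intro: continuous_on_subset\<close>)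
  then show ?thesis using that compact_imp_bounded by (force simp: bounded_iff)
qed

lemma cont_L2:
  assumes "continuous_on UNIV F"
  shows "F \<in> L2 M"
proof -
  obtain C where C: "\<And>z. z \<in> K \<Longrightarrow> \<bar>F z\<bar> \<le> C" using cont_bounded[OF assms] by blast
  show ?thesis
    by (rule L2_bounded[OF finite_M cont_measurable[OF assms], of C]) (use C \<Omega>_K in auto)
qed

lemma L2_cont_integrable: "w \<in> L2 M \<Longrightarrow> continuous_on UNIV F \<Longrightarrow> integrable M (\<lambda>z. w z * F z)"
  by (rule L2_mult_integrable[OF _ cont_L2])

lemma tendsto_ip:
  assumes w: "w \<in> L2 M" and h: "\<And>n. h n \<in> borel_measurable M" "\<And>n z. z \<in> \<Omega> \<Longrightarrow> \<bar>h n z\<bar> \<le> C"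
    and lim: "\<And>z. z \<in> \<Omega> \<Longrightarrow> (\<lambda>n. h n z) \<longlonglongrightarrow> h' z"
  shows "(\<lambda>n. LINT z|M. w z * h n z) \<longlonglongrightarrow> (LINT z|M. w z * h' z)"
proof (rule integral_dominated_convergence[where w="\<lambda>z. C * \<bar>w z\<bar>"])
  have [measurable]: "w \<in> borel_measurable M" using w by (rule L2_D)
  have "h' \<in> borel_measurable M"
    by (rule borel_measurable_LIMSEQ_real[OF _ h(1)]) (use lim in simp)
  then show "(\<lambda>z. w z * h' z) \<in> borel_measurable M" by simp
  show "(\<lambda>z. w z * h n z) \<in> borel_measurable M" for n using h(1)[of n] by simp
  show "integrable M (\<lambda>z. C * \<bar>w z\<bar>)"
    using finite_measure.L2_integrable[OF finite_M w] by simp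
  show "AE z in M. (\<lambda>n. w z * h n z) \<longlonglongrightarrow> w z * h' z"
    by (rule AE_I2) (auto intro!: tendsto_intros lim)
  show "AE z in M. norm (w z * h n z) \<le> C * \<bar>w z\<bar>" for n
    by (rule AE_I2) (use h(2) in \<open>auto simp: abs_mult mult.commute[of _ "\<bar>w _\<bar>"] intro!: mult_left_mono\<close>)
qed

text \<open>A product in the coordinates \<open>(x, y - g x)\<close>, which straighten the strip to
  the rectangle with sides \<open>l\<close> and \<open>d\<close>.\<close>

definition V :: "(real \<Rightarrow> real) \<Rightarrow> (real \<Rightarrow> real) \<Rightarrow> real \<times> real \<Rightarrow> real" where
  "V X Y z = X (fst z) * Y (snd z - g (fst z))"

lemma V_cont:
  assumes "continuous_on UNIV X" "continuous_on UNIV Y"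
  shows "continuous_on UNIV (V X Y)"
proof -
  have "continuous_on UNIV (\<lambda>z::real \<times> real. X (fst z))"
    by (rule continuous_on_compose2[OF assms(1)]) (auto intro: continuous_on_fst continuous_on_id)
  moreover have "continuous_on UNIV (\<lambda>z::real \<times> real. Y (snd z - g (fst z)))"
    by (rule continuous_on_compose2[OF assms(2)], intro continuous_on_diff continuous_on_snd continuous_on_id gc') simp
  ultimately show ?thesis unfolding V_def by (rule continuous_on_mult)
qed

lemma V_mult: "V X Y z * V A B z = V (\<lambda>x. X x * A x) (\<lambda>t. Y t * B t) z"
  by (simp add: V_def)

lemma lborel_integral_open_interval:
  fixes Y :: "real \<Rightarrow> real"
  assumes "continuous_on UNIV Y"
  shows "(LINT t|lborel. indicator {0<..<b} t * Y t) = integral {0..b} Y"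
proof -
  have "set_integrable lborel {0..b} Y"
    by (rule borel_integrable_atLeastAtMost') (use assms continuous_on_subset in blast)
  then have "set_integrable lborel {0<..<b} Y" by (rule set_integrable_subset) auto
  from set_borel_integral_eq_integral(2)[OF this] show ?thesis
    by (simp add: set_lebesgue_integral_def integral_open_interval_real)
qed

text \<open>The straightening shear preserves area: translating the inner integral by
  \<open>g x\<close> removes \<open>g\<close>, and Fubini's theorem separates the variables.\<close>

lemma integral_V:
  assumes X: "continuous_on UNIV X" and Y: "continuous_on UNIV Y"
  shows "(LINT z|M. V X Y z) = integral {0..l} X * integral {0..d} Y"
proof -
  let ?f = "\<lambda>z. indicator \<Omega> z * V X Y z"
  have bm: "?f \<in> borel_measurable borel"
    using borel_measurable_continuous_onI[OF V_cont[OF X Y]] by measurable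
  have "integrable lborel (\<lambda>z. indicator K z *\<^sub>R V X Y z)"
    using compact_K V_cont[OF X Y] by (intro borel_integrable_compact) (auto intro: continuous_on_subset)
  then have int: "integrable lborel ?f"
    by (rule Bochner_Integration.integrable_bound) (use bm \<Omega>_K in \<open>auto simp: indicator_def\<close>)
  have inner: "(LINT y|lborel. ?f (x, y)) = indicator {0<..<l} x * X x * integral {0..d} Y" for x
  proof -
    have "(LINT y|lborel. ?f (x, y)) = (LINT y|lborel. ?f (x, g x + 1 * y))"
      using lborel_integral_real_affine[of 1 "\<lambda>y. ?f (x, y)" "g x"] by simp
    also have "\<dots> = (LINT y|lborel. (indicator {0<..<l} x * X x) * (indicator {0<..<d} y * Y y))"
      by (rule Bochner_Integration.integral_cong) (auto simp: \<Omega>_def V_def indicator_def)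
    finally show ?thesis using lborel_integral_open_interval[OF Y] by simp
  qed
  have "(LINT z|M. V X Y z) = (LINT z|lborel. ?f z)"
    by (rule integral_lebesgue_on_lborel) (use bm in auto)
  also have "\<dots> = integral\<^sup>L (lborel \<Otimes>\<^sub>M lborel) (\<lambda>(x, y). ?f (x, y))"
    by (simp add: lborel_prod case_prod_unfold)
  also have "\<dots> = (LINT x|lborel. LINT y|lborel. ?f (x, y))"
    by (rule lborel_pair.integral_fst[symmetric]) (use int in \<open>simp add: lborel_prod case_prod_unfold\<close>)
  also have "\<dots> = (LINT x|lborel. indicator {0<..<l} x * X x) * integral {0..d} Y"
    unfolding inner by simp
  finally show ?thesis by (simp add: lborel_integral_open_interval[OF X])
qed

section \<open>Weak gradients tested with sheared products\<close>

lemma has_weak_gradient_iff: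
  "has_weak_gradient \<Omega> u G \<longleftrightarrow> u \<in> L2 M \<and> (\<lambda>z. fst (G z)) \<in> L2 M \<and> (\<lambda>z. snd (G z)) \<in> L2 M \<and>
    (\<forall>\<phi>\<in>test_functions \<Omega>.
      (LINT z|M. u z * partial_deriv (1, 0) \<phi> z) = - (LINT z|M. fst (G z) * \<phi> z) \<and>
      (LINT z|M. u z * partial_deriv (0, 1) \<phi> z) = - (LINT z|M. snd (G z) * \<phi> z))"
proof -
  have "u \<in> L2_on \<Omega> \<longleftrightarrow> u \<in> L2 M" by (simp add: L2_on_def L2_def)
  moreover have "G \<in> L2_on \<Omega> \<longleftrightarrow> (\<lambda>z. fst (G z)) \<in> L2 M \<and> (\<lambda>z. snd (G z)) \<in> L2 M"
  proof -
    have n: "(norm (G z))\<^sup>2 = (fst (G z))\<^sup>2 + (snd (G z))\<^sup>2" for z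
      by (cases "G z") (simp add: norm_Pair)
    have fm: "(\<lambda>z. fst (G z)) \<in> borel_measurable M" "(\<lambda>z. snd (G z)) \<in> borel_measurable M"
      if "G \<in> borel_measurable M"
      by (rule measurable_compose[OF that borel_measurable_continuous_onI]; intro continuous_intros)+
    show ?thesis
    proof
      assume "G \<in> L2_on \<Omega>"
      then have G: "G \<in> borel_measurable M" and int: "integrable M (\<lambda>z. (fst (G z))\<^sup>2 + (snd (G z))\<^sup>2)"
        by (auto simp: L2_on_def n)
      have "integrable M (\<lambda>z. (fst (G z))\<^sup>2)" "integrable M (\<lambda>z. (snd (G z))\<^sup>2)"
        by (rule Bochner_Integration.integrable_bound[OF int]; use fm[OF G] in auto)+
      then show "(\<lambda>z. fst (G z)) \<in> L2 M \<and> (\<lambda>z. snd (G z)) \<in> L2 M" using fm[OF G] by (simp add: L2_def)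
    next
      assume *: "(\<lambda>z. fst (G z)) \<in> L2 M \<and> (\<lambda>z. snd (G z)) \<in> L2 M"
      then have "(\<lambda>z. (fst (G z), snd (G z))) \<in> borel_measurable M"
        by (intro borel_measurable_Pair) (auto simp: L2_def)
      then show "G \<in> L2_on \<Omega>" using * by (simp add: L2_on_def L2_def n)
    qed
  qed
  moreover have "(\<forall>b\<in>Basis. P b) \<longleftrightarrow> P (1, 0) \<and> P (0, 1)" for P :: "real \<times> real \<Rightarrow> bool"
    by (auto simp: Basis_prod_def)
  ultimately show ?thesis
    unfolding has_weak_gradient_def by (simp add: inner_prod_def)
qed

text \<open>The support follows the graph of \<open>p\<close>, not of \<open>g\<close>; the margin
  \<open>e\<close> of \<open>B\<close> exceeds their distance and keeps it inside the strip.\<close>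

lemma shear_test_function:
  assumes A: "cutoff l A" and B: "smooth B" "\<And>t. t \<notin> {e..d - e} \<Longrightarrow> B t = 0"
    and p: "smooth p" "\<And>x. x \<in> {0..l} \<Longrightarrow> \<bar>p x - g x\<bar> < e"
  shows "(\<lambda>z. A (fst z) * B (snd z - p (fst z))) \<in> test_functions \<Omega>"
proof -
  obtain e' where e': "e' > 0" "\<And>x. x \<notin> {e'..l - e'} \<Longrightarrow> A x = 0" and sA: "smooth A"
    using A by (auto simp: cutoff_def)
  let ?K = "{z. e' \<le> fst z \<and> fst z \<le> l - e' \<and> e \<le> snd z - p (fst z) \<and> snd z - p (fst z) \<le> d - e}"
  have sub: "?K \<subseteq> \<Omega>"
  proof
    fix z :: "real \<times> real" assume z: "z \<in> ?K"
    then have "fst z \<in> {0..l}" using e'(1) by auto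
    from p(2)[OF this] show "z \<in> \<Omega>" using z e'(1) by (auto simp: \<Omega>_def)
  qed
  have pc: "continuous_on S (\<lambda>z::real \<times> real. p (fst z))" for S
    by (rule continuous_on_compose2[OF smooth_continuous[OF p(1)]]) (auto intro: continuous_intros)
  have "closed ?K" by (intro closed_Collect_conj closed_Collect_le continuous_intros pc)
  moreover have "bounded ?K" using bounded_subset[OF bounded_\<Omega> sub] .
  ultimately have compact: "compact ?K" by (simp add: compact_eq_bounded_closed)
  have smooth: "smooth (\<lambda>z::real \<times> real. A (fst z) * B (snd z - p (fst z)))"
    by (intro smooth_mult smooth_compose[OF sA] smooth_compose[OF B(1)] smooth_minus smooth_compose[OF p(1)]
        smooth_linear bounded_linear_fst bounded_linear_snd)
  show ?thesis
    by (rule test_functionsI[OF smooth compact sub]) (use e'(2) B(2) in auto)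
qed

text \<open>The x-derivative of the product is \<open>A' * B - A * q * B'\<close>. Its second term
  is a y-derivative, of the product with \<open>A * q\<close> in place of \<open>A\<close>; moving
  it across adds \<open>q\<close> times the vertical component of the gradient and produces the
  derivative along \<open>(1, q)\<close>.\<close>

lemma shear_weak_gradient:
  assumes u: "has_weak_gradient \<Omega> u G"
    and A: "cutoff l A" "\<And>x. (A has_real_derivative A' x) (at x)"
    and B: "smooth B" "\<And>t. t \<notin> {e..d - e} \<Longrightarrow> B t = 0" "\<And>x. (B has_real_derivative B' x) (at x)"
    and p: "smooth q" "\<And>x. (p has_real_derivative q x) (at x)" "\<And>x. x \<in> {0..l} \<Longrightarrow> \<bar>p x - g x\<bar> < e"
  shows "(LINT z|M. u z * (A (fst z) * B' (snd z - p (fst z)))) = - (LINT z|M. snd (G z) * (A (fst z) * B (snd z - p (fst z))))"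
    and "(LINT z|M. u z * (A' (fst z) * B (snd z - p (fst z))))
      = - (LINT z|M. (fst (G z) + q (fst z) * snd (G z)) * (A (fst z) * B (snd z - p (fst z))))"
proof -
  have sp: "smooth p" by (rule smooth_of_deriv[OF p(2,1)])
  have sA: "smooth A" using A(1) by (simp add: cutoff_def)
  have cont: "continuous_on UNIV (\<lambda>z::real \<times> real. X (fst z) * Y (snd z - p (fst z)))"
    if "continuous_on UNIV X" "continuous_on UNIV Y" for X Y :: "real \<Rightarrow> real"
  proof -
    have f: "continuous_on UNIV (\<lambda>z::real \<times> real. X' (fst z))" if "continuous_on UNIV X'" for X' :: "real \<Rightarrow> real"
      by (rule continuous_on_compose2[OF that]) (auto intro: continuous_on_fst continuous_on_id)
    have "continuous_on UNIV (\<lambda>z::real \<times> real. Y (snd z - p (fst z)))"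
      by (rule continuous_on_compose2[OF that(2)], intro continuous_on_diff continuous_on_snd continuous_on_id f smooth_continuous sp) simp
    then show ?thesis by (intro continuous_on_mult f that)
  qed
  have L2: "u \<in> L2 M" "(\<lambda>z. fst (G z)) \<in> L2 M" "(\<lambda>z. snd (G z)) \<in> L2 M"
    and wg: "\<And>\<phi>. \<phi> \<in> test_functions \<Omega> \<Longrightarrow> (LINT z|M. u z * partial_deriv (1, 0) \<phi> z) = - (LINT z|M. fst (G z) * \<phi> z)"
      "\<And>\<phi>. \<phi> \<in> test_functions \<Omega> \<Longrightarrow> (LINT z|M. u z * partial_deriv (0, 1) \<phi> z) = - (LINT z|M. snd (G z) * \<phi> z)"
    using u by (auto simp: has_weak_gradient_iff)
  \<comment> \<open>Stated for arbitrary \<open>A\<close> because it is applied once more to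
    \<open>A * q\<close>.\<close>
  have y: "(LINT z|M. u z * (A (fst z) * B' (snd z - p (fst z)))) = - (LINT z|M. snd (G z) * (A (fst z) * B (snd z - p (fst z))))"
    if A: "cutoff l A" "\<And>x. (A has_real_derivative A' x) (at x)" for A A'
  proof -
    have "partial_deriv (0, 1) (\<lambda>z. A (fst z) * B (snd z - p (fst z))) z = A (fst z) * B' (snd z - p (fst z))" for z
      by (subst partial_deriv_eq[OF has_derivative_shear[OF A(2) B(3) p(2)]]) simp
    then show ?thesis using wg(2)[OF shear_test_function[OF A(1) B(1,2) sp p(3)]] by simp
  qed
  show "(LINT z|M. u z * (A (fst z) * B' (snd z - p (fst z)))) = - (LINT z|M. snd (G z) * (A (fst z) * B (snd z - p (fst z))))"
    by (rule y[OF A])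
  obtain q' where q': "\<And>x. (q has_real_derivative q' x) (at x)" using smooth_derivE[OF p(1)] by blast
  have Aq: "cutoff l (\<lambda>x. A x * q x)" by (rule cutoff_mult[OF A(1) p(1)])
  have dAq: "((\<lambda>x. A x * q x) has_real_derivative A' x * q x + q' x * A x) (at x)" for x
    by (rule DERIV_mult[OF A(2) q'])
  obtain A'' where A'': "\<And>x. (A has_real_derivative A'' x) (at x)" "smooth A''" using smooth_derivE[OF sA] by blast
  have "A' = A''" using DERIV_unique[OF A(2) A''(1)] by auto
  obtain B'' where B'': "\<And>x. (B has_real_derivative B'' x) (at x)" "smooth B''" using smooth_derivE[OF B(1)] by blast
  have "B' = B''" using DERIV_unique[OF B(3) B''(1)] by auto
  have c: "continuous_on UNIV A" "continuous_on UNIV A'" "continuous_on UNIV B" "continuous_on UNIV B'" "continuous_on UNIV q"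
    using smooth_continuous A''(2) B''(2) sA B(1) p(1) \<open>A' = A''\<close> \<open>B' = B''\<close> by auto
  have int1: "integrable M (\<lambda>z. u z * (A' (fst z) * B (snd z - p (fst z))))"
    by (intro L2_cont_integrable L2 cont c)
  have int2: "integrable M (\<lambda>z. u z * ((A (fst z) * q (fst z)) * B' (snd z - p (fst z))))"
    using L2_cont_integrable[OF L2(1) cont[of "\<lambda>x. A x * q x" B']] c by (simp add: continuous_on_mult)
  have int3: "integrable M (\<lambda>z. fst (G z) * (A (fst z) * B (snd z - p (fst z))))"
    by (intro L2_cont_integrable L2 cont c)
  have int4: "integrable M (\<lambda>z. snd (G z) * ((A (fst z) * q (fst z)) * B (snd z - p (fst z))))"
    using L2_cont_integrable[OF L2(3) cont[of "\<lambda>x. A x * q x" B]] c by (simp add: continuous_on_mult)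
  have "partial_deriv (1, 0) (\<lambda>z. A (fst z) * B (snd z - p (fst z))) z
      = A' (fst z) * B (snd z - p (fst z)) - (A (fst z) * q (fst z)) * B' (snd z - p (fst z))" for z
    by (subst partial_deriv_eq[OF has_derivative_shear[OF A(2) B(3) p(2)]]) simp
  then have "(LINT z|M. u z * (A' (fst z) * B (snd z - p (fst z))) - u z * ((A (fst z) * q (fst z)) * B' (snd z - p (fst z))))
      = - (LINT z|M. fst (G z) * (A (fst z) * B (snd z - p (fst z))))"
    using wg(1)[OF shear_test_function[OF A(1) B(1,2) sp p(3)]] by (simp add: right_diff_distrib)
  then have "(LINT z|M. u z * (A' (fst z) * B (snd z - p (fst z))))
      = - ((LINT z|M. fst (G z) * (A (fst z) * B (snd z - p (fst z)))) + (LINT z|M. snd (G z) * ((A (fst z) * q (fst z)) * B (snd z - p (fst z)))))"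
    using y[OF Aq dAq] Bochner_Integration.integral_diff[OF int1 int2] by linarith
  also have "(LINT z|M. fst (G z) * (A (fst z) * B (snd z - p (fst z)))) + (LINT z|M. snd (G z) * ((A (fst z) * q (fst z)) * B (snd z - p (fst z))))
     = (LINT z|M. (fst (G z) + q (fst z) * snd (G z)) * (A (fst z) * B (snd z - p (fst z))))"
    unfolding Bochner_Integration.integral_add[OF int3 int4, symmetric]
    by (rule Bochner_Integration.integral_cong) (auto simp: algebra_simps)
  finally show "(LINT z|M. u z * (A' (fst z) * B (snd z - p (fst z))))
      = - (LINT z|M. (fst (G z) + q (fst z) * snd (G z)) * (A (fst z) * B (snd z - p (fst z))))" .
qed

end

section \<open>Cutoff functions\<close>

text \<open>For \<open>t = 1 / x\<close> the quotient \<open>t ^ k / fact k\<close> is a single term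
  of the series of \<open>exp t\<close>.\<close>

lemma flat_le_fact: "flat k x \<le> fact k"
proof (cases "x > 0")
  case True
  have "(1 / x) ^ k / fact k \<le> exp (1 / x)"
  proof -
    have "(\<Sum>n\<in>{k}. (1 / x) ^ n / fact n) \<le> (\<Sum>n. (1 / x) ^ n / fact n)"
      by (rule sum_le_suminf) (use True summable_exp[of "1 / x"] in \<open>auto simp: inverse_eq_divide field_simps\<close>)
    then show ?thesis by (simp add: exp_def inverse_eq_divide)
  qed
  then have "(1 / x) ^ k \<le> exp (1 / x) * fact k"
    using pos_divide_le_eq[of "fact k" "(1 / x) ^ k" "exp (1 / x)"] fact_gt_zero[of k] by blast
  then show ?thesis using True by (simp add: flat_def exp_minus field_simps)
qed (simp add: flat_def)

lemma flat_nonneg: "0 \<le> flat k x"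
  by (simp add: flat_def)

lemma mult_flat: "x * flat (Suc k) x = flat k x"
  by (simp add: flat_def)

lemma flat_0_at_top: "(flat 0 \<longlongrightarrow> 1) at_top"
proof (rule Lim_transform_eventually)
  have "((\<lambda>x::real. exp (- inverse x)) \<longlongrightarrow> exp (- 0)) at_top"
    by (intro tendsto_intros tendsto_inverse_0_at_top filterlim_ident)
  then show "((\<lambda>x::real. exp (- inverse x)) \<longlongrightarrow> 1) at_top" by simp
  show "\<forall>\<^sub>F x in at_top. exp (- inverse x) = flat 0 x"
    using eventually_gt_at_top[of "0::real"] by eventually_elim (simp add: flat_def field_simps)
qed

lemma flat_Suc_at_top: "(flat (Suc k) \<longlongrightarrow> 0) at_top"
proof (rule tendsto_sandwich[OF _ _ tendsto_const])
  show "\<forall>\<^sub>F x in at_top. flat (Suc k) x \<le> inverse x * fact k"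
    using eventually_gt_at_top[of "0::real"]
  proof eventually_elim
    case (elim x)
    then have "flat (Suc k) x = inverse x * flat k x" by (simp add: flat_def field_simps)
    also have "\<dots> \<le> inverse x * fact k" using elim flat_le_fact by (intro mult_left_mono) auto
    finally show ?case .
  qed
  have "((\<lambda>x::real. inverse x * fact k) \<longlongrightarrow> 0 * fact k) at_top"
    by (intro tendsto_intros tendsto_inverse_0_at_top filterlim_ident)
  then show "((\<lambda>x::real. inverse x * fact k) \<longlongrightarrow> 0) at_top" by simp
qed (simp add: flat_nonneg)

text \<open>The cutoffs are built from \<open>exp (- 1 / (n x - 1))\<close>, whose derivative is \<open>O(1 / x)\<close>
  uniformly in \<open>n\<close>.\<close>

lemma cutoff_sequence:
  assumes L: "0 < L"
  obtains \<kappa> \<kappa>' :: "nat \<Rightarrow> real \<Rightarrow> real"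
  where "\<And>n. cutoff L (\<kappa> n)" "\<And>n x. (\<kappa> n has_real_derivative \<kappa>' n x) (at x)"
    "\<And>n x. \<bar>\<kappa> n x\<bar> \<le> 1" "\<And>x. 0 < x \<Longrightarrow> x < L \<Longrightarrow> (\<lambda>n. \<kappa> n x) \<longlonglongrightarrow> 1"
    "\<And>x. 0 < x \<Longrightarrow> x < L \<Longrightarrow> (\<lambda>n. \<kappa>' n x) \<longlonglongrightarrow> 0"
    "\<And>n x. 0 < x \<Longrightarrow> x < L \<Longrightarrow> \<bar>\<kappa>' n x\<bar> * min x (L - x) \<le> 6"
proof
  define \<psi> where "\<psi> n x = flat 0 (real n * x - 1)" for n x
  define \<psi>' where "\<psi>' n x = real n * flat 2 (real n * x - 1)" for n x
  have d\<psi>: "(\<psi> n has_real_derivative \<psi>' n x) (at x)" for n x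
  proof -
    have "((\<lambda>x. real n * x - 1) has_real_derivative real n) (at x)" by (auto intro!: derivative_eq_intros)
    from DERIV_chain2[OF DERIV_flat[of 0] this] show ?thesis
      by (simp add: \<psi>_def[abs_def] \<psi>'_def mult.commute numeral_2_eq_2)
  qed
  have d\<psi>2: "((\<lambda>x. \<psi> n (L - x)) has_real_derivative - \<psi>' n (L - x)) (at x)" for n x
  proof -
    have "((\<lambda>x. L - x) has_real_derivative - 1) (at x)" by (auto intro!: derivative_eq_intros)
    from DERIV_chain2[OF d\<psi> this] show ?thesis by simp
  qed
  have \<psi>01: "0 \<le> \<psi> n x" "\<psi> n x \<le> 1" for n x
    using flat_nonneg[of 0] flat_le_fact[of 0] by (auto simp: \<psi>_def)
  have \<psi>'0: "0 \<le> \<psi>' n x" for n x using flat_nonneg by (simp add: \<psi>'_def)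
  \<comment> \<open>\<open>n * x = (n * x - 1) + 1\<close> and \<open>mult_flat\<close> trade the
    growing factor \<open>n\<close> for two bounded members of the family.\<close>
  have \<psi>'x: "\<psi>' n x * x = flat 1 (real n * x - 1) + flat 2 (real n * x - 1)" for n x
    using mult_flat[of "real n * x - 1" 1] by (simp add: \<psi>'_def algebra_simps numeral_2_eq_2)
  \<comment> \<open>The bound is \<open>fact 1 + fact 2\<close>; the two ends of the interval
    together give the 6.\<close>
  have \<psi>'b: "\<psi>' n x * x \<le> 3" for n x
    using flat_le_fact[of 1 "real n * x - 1"] flat_le_fact[of 2 "real n * x - 1"] unfolding \<psi>'x
    by (simp add: fact_numeral)
  have s\<psi>: "smooth (\<psi> n)" for n
  proof -
    have "smooth (\<lambda>x. real n * x - 1)" by (intro smooth_minus smooth_mult smooth_const smooth_ident)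
    from smooth_compose[OF smooth_flat this] show ?thesis by (simp add: \<psi>_def[abs_def])
  qed
  have top: "filterlim (\<lambda>n. real n * x - 1) at_top sequentially" if "x > 0" for x
    using that by real_asymp
  have \<psi>lim: "(\<lambda>n. \<psi> n x) \<longlonglongrightarrow> 1" if "x > 0" for x
    unfolding \<psi>_def by (rule filterlim_compose[OF flat_0_at_top top[OF that]])
  have \<psi>'lim: "(\<lambda>n. \<psi>' n x) \<longlonglongrightarrow> 0" if "x > 0" for x
  proof -
    have "(\<lambda>n. (flat (Suc 0) (real n * x - 1) + flat (Suc 1) (real n * x - 1)) / x) \<longlonglongrightarrow> (0 + 0) / x"
      using that by (intro tendsto_intros filterlim_compose[OF flat_Suc_at_top top[OF that]]) auto
    moreover have "\<psi>' n x = (flat (Suc 0) (real n * x - 1) + flat (Suc 1) (real n * x - 1)) / x" for n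
      using \<psi>'x[of n x] that by (simp add: field_simps numeral_2_eq_2)
    ultimately show ?thesis by simp
  qed
  let ?\<kappa> = "\<lambda>n x. \<psi> n x * \<psi> n (L - x)"
  let ?\<kappa>' = "\<lambda>n x. \<psi> n x * (- \<psi>' n (L - x)) + \<psi>' n x * \<psi> n (L - x)"
  show "(?\<kappa> n has_real_derivative ?\<kappa>' n x) (at x)" for n x
    by (rule DERIV_cong[OF DERIV_mult[OF d\<psi> d\<psi>2]]) simp
  show "cutoff L (?\<kappa> n)" for n
    unfolding cutoff_def
  proof (intro conjI exI allI impI)
    show "smooth (?\<kappa> n)"
      by (intro smooth_mult s\<psi> smooth_compose[OF s\<psi>] smooth_minus smooth_const smooth_ident)
    \<comment> \<open>The denominator \<open>n + 1\<close> provides a margin for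
      \<open>n = 0\<close> as well.\<close>
    show "0 < 1 / (real n + 1)" by simp
    fix x assume x: "x \<notin> {1 / (real n + 1)..L - 1 / (real n + 1)}"
    have z: "\<psi> n y = 0" if "y < 1 / (real n + 1)" for y
    proof -
      have "real n * y \<le> 1"
      proof (cases "y \<le> 0")
        case True
        then have "real n * y \<le> 0" by (simp add: mult_nonneg_nonpos)
        then show ?thesis by simp
      next
        case False
        have "(real n + 1) * y < 1" using that by (simp add: field_simps)
        then show ?thesis using False by (simp add: algebra_simps)
      qed
      then show ?thesis by (simp add: \<psi>_def flat_def)
    qed
    show "?\<kappa> n x = 0"
    proof (cases "x < 1 / (real n + 1)")
      case False
      then have "L - x < 1 / (real n + 1)" using x by auto
      then show ?thesis using z by simp
    qed (simp add: z)
  qed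
  show "\<bar>?\<kappa> n x\<bar> \<le> 1" for n x
    using \<psi>01 by (simp add: abs_mult mult_le_one)
  fix x assume x: "0 < x" "x < L"
  have "(\<lambda>n. ?\<kappa> n x) \<longlonglongrightarrow> 1 * 1" using x by (intro tendsto_mult \<psi>lim) auto
  then show "(\<lambda>n. ?\<kappa> n x) \<longlonglongrightarrow> 1" by simp
  have "(\<lambda>n. ?\<kappa>' n x) \<longlonglongrightarrow> 1 * (- 0) + 0 * 1"
    using x by (intro tendsto_intros \<psi>lim \<psi>'lim) auto
  then show "(\<lambda>n. ?\<kappa>' n x) \<longlonglongrightarrow> 0" by simp
  fix n
  let ?m = "min x (L - x)"
  have m: "?m \<ge> 0" "?m \<le> x" "?m \<le> L - x" using x by auto
  have "\<bar>?\<kappa>' n x\<bar> \<le> \<psi> n x * \<psi>' n (L - x) + \<psi>' n x * \<psi> n (L - x)"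
    using \<psi>01 \<psi>'0 by (intro order_trans[OF abs_triangle_ineq]) (simp add: abs_mult)
  also have "\<dots> \<le> \<psi>' n (L - x) + \<psi>' n x"
    using \<psi>01 \<psi>'0 by (intro add_mono mult_left_le_one_le mult_right_le_one_le) auto
  finally have "\<bar>?\<kappa>' n x\<bar> * ?m \<le> (\<psi>' n (L - x) + \<psi>' n x) * ?m" using m by (intro mult_right_mono)
  also have "\<dots> \<le> \<psi>' n (L - x) * (L - x) + \<psi>' n x * x"
    unfolding distrib_right using m \<psi>'0 by (intro add_mono mult_left_mono) auto
  also have "\<dots> \<le> 6" using \<psi>'b[of n "L - x"] \<psi>'b[of n x] by simp
  finally show "\<bar>?\<kappa>' n x\<bar> * ?m \<le> 6" .
qed

lemma bounded_on_interval:
  fixes A :: "real \<Rightarrow> real"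
  assumes "continuous_on UNIV A"
  obtains C where "C > 0" "\<And>x. a \<le> x \<Longrightarrow> x \<le> b \<Longrightarrow> \<bar>A x\<bar> \<le> C"
proof -
  have "compact (A ` {a..b})"
    by (intro compact_continuous_image) (use assms continuous_on_subset in auto)
  then obtain C where "\<And>x. a \<le> x \<Longrightarrow> x \<le> b \<Longrightarrow> \<bar>A x\<bar> \<le> C"
    using compact_imp_bounded by (force simp: bounded_iff)
  then show ?thesis by (intro that[of "\<bar>C\<bar> + 1"]) (force, smt (verit))
qed

text \<open>Without zeros at the ends only the values converge boundedly. This serves the variable
  in which nothing is differentiated.\<close>

lemma cutoff_approx:
  assumes L: "0 < L" and A: "smooth A"
  obtains An An' C where "\<And>n. cutoff L (An n)" "\<And>n x. (An n has_real_derivative An' n x) (at x)"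
    "\<And>x. 0 < x \<Longrightarrow> x < L \<Longrightarrow> (\<lambda>n::nat. An n x) \<longlonglongrightarrow> A x"
    "\<And>n x. 0 < x \<Longrightarrow> x < L \<Longrightarrow> \<bar>An n x\<bar> \<le> C"
proof -
  obtain \<kappa> \<kappa>' where \<kappa>: "\<And>n. cutoff L (\<kappa> n)" "\<And>n x. (\<kappa> n has_real_derivative \<kappa>' n x) (at x)"
    "\<And>n x. \<bar>\<kappa> n x\<bar> \<le> 1" "\<And>x. 0 < x \<Longrightarrow> x < L \<Longrightarrow> (\<lambda>n::nat. \<kappa> n x) \<longlonglongrightarrow> 1"
    using cutoff_sequence[OF L] by metis
  obtain A' where A': "\<And>x. (A has_real_derivative A' x) (at x)" using smooth_derivE[OF A] by blast
  obtain C where C: "\<And>x. 0 \<le> x \<Longrightarrow> x \<le> L \<Longrightarrow> \<bar>A x\<bar> \<le> C"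
    using bounded_on_interval[OF smooth_continuous[OF A], of 0 L] by metis
  show ?thesis
  proof
    show "cutoff L (\<lambda>x. \<kappa> n x * A x)" for n by (rule cutoff_mult[OF \<kappa>(1) A])
    show "((\<lambda>x. \<kappa> n x * A x) has_real_derivative \<kappa>' n x * A x + A' x * \<kappa> n x) (at x)" for n x
      by (rule DERIV_mult[OF \<kappa>(2) A'])
    show "(\<lambda>n. \<kappa> n x * A x) \<longlonglongrightarrow> A x" if "0 < x" "x < L" for x
      using tendsto_mult_right[OF \<kappa>(4)[OF that], of "A x"] by simp
    show "\<bar>\<kappa> n x * A x\<bar> \<le> C" if "0 < x" "x < L" for n x
      using mult_mono[OF \<kappa>(3)[of n x] C[of x]] that by (simp add: abs_mult)
  qed
qed

text \<open>Zeros at both ends make \<open>A x\<close> at most a multiple of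
  \<open>min x (L - x)\<close>, the distance to the ends, which compensates the growth of the
  derivatives of the cutoffs there; so the derivatives converge boundedly too.\<close>

lemma cutoff_approx_boundary:
  assumes L: "0 < L" and A: "smooth A" "A 0 = 0" "A L = 0" "\<And>x. (A has_real_derivative A' x) (at x)"
  obtains An An' C where "\<And>n. cutoff L (An n)" "\<And>n x. (An n has_real_derivative An' n x) (at x)"
    "\<And>x. 0 < x \<Longrightarrow> x < L \<Longrightarrow> (\<lambda>n::nat. An n x) \<longlonglongrightarrow> A x"
    "\<And>x. 0 < x \<Longrightarrow> x < L \<Longrightarrow> (\<lambda>n::nat. An' n x) \<longlonglongrightarrow> A' x"
    "\<And>n x. 0 < x \<Longrightarrow> x < L \<Longrightarrow> \<bar>An n x\<bar> \<le> C" "\<And>n x. 0 < x \<Longrightarrow> x < L \<Longrightarrow> \<bar>An' n x\<bar> \<le> C"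
proof -
  obtain \<kappa> \<kappa>' where \<kappa>: "\<And>n. cutoff L (\<kappa> n)" "\<And>n x. (\<kappa> n has_real_derivative \<kappa>' n x) (at x)"
    "\<And>n x. \<bar>\<kappa> n x\<bar> \<le> 1" "\<And>x. 0 < x \<Longrightarrow> x < L \<Longrightarrow> (\<lambda>n::nat. \<kappa> n x) \<longlonglongrightarrow> 1"
    "\<And>x. 0 < x \<Longrightarrow> x < L \<Longrightarrow> (\<lambda>n. \<kappa>' n x) \<longlonglongrightarrow> 0"
    "\<And>n x. 0 < x \<Longrightarrow> x < L \<Longrightarrow> \<bar>\<kappa>' n x\<bar> * min x (L - x) \<le> 6"
    using cutoff_sequence[OF L] by metis
  obtain A'' where "\<And>x. (A has_real_derivative A'' x) (at x)" "smooth A''" using smooth_derivE[OF A(1)] by blast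
  then have A'c: "continuous_on UNIV A'" using DERIV_unique[OF A(4)] smooth_continuous by (metis ext)
  obtain C1 where C1: "C1 > 0" "\<And>x. 0 \<le> x \<Longrightarrow> x \<le> L \<Longrightarrow> \<bar>A' x\<bar> \<le> C1"
    using bounded_on_interval[OF A'c, of 0 L] by metis
  obtain C2 where C2: "C2 > 0" "\<And>x. 0 \<le> x \<Longrightarrow> x \<le> L \<Longrightarrow> \<bar>A x\<bar> \<le> C2"
    using bounded_on_interval[OF smooth_continuous[OF A(1)], of 0 L] by metis
  have Am: "\<bar>A x\<bar> \<le> C1 * min x (L - x)" if x: "0 < x" "x < L" for x
  proof -
    obtain \<xi> where \<xi>: "0 < \<xi>" "\<xi> < x" "A x - A 0 = (x - 0) * A' \<xi>" using MVT2[OF x(1) A(4)] by blast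
    obtain \<eta> where \<eta>: "x < \<eta>" "\<eta> < L" "A L - A x = (L - x) * A' \<eta>" using MVT2[OF x(2) A(4)] by blast
    have "A x = x * A' \<xi>" "A x = (x - L) * A' \<eta>" using \<xi>(3) \<eta>(3) A(2,3) by (auto simp: algebra_simps)
    then have "\<bar>A x\<bar> = x * \<bar>A' \<xi>\<bar>" "\<bar>A x\<bar> = (L - x) * \<bar>A' \<eta>\<bar>"
      using x by (metis abs_mult abs_of_pos, metis abs_minus_commute abs_mult abs_of_pos diff_gt_0_iff_gt)
    moreover have "\<bar>A' \<xi>\<bar> \<le> C1" "\<bar>A' \<eta>\<bar> \<le> C1" using C1(2)[of \<xi>] C1(2)[of \<eta>] \<xi> \<eta> x by auto
    ultimately have "\<bar>A x\<bar> = x * \<bar>A' \<xi>\<bar>" "\<bar>A x\<bar> = (L - x) * \<bar>A' \<eta>\<bar>" "\<bar>A' \<xi>\<bar> \<le> C1" "\<bar>A' \<eta>\<bar> \<le> C1"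
      by blast+
    then show ?thesis using x C1(1) mult_left_mono[of "\<bar>A' \<xi>\<bar>" C1 x] mult_left_mono[of "\<bar>A' \<eta>\<bar>" C1 "L - x"]
      by (auto simp: min_def mult.commute)
  qed
  show ?thesis
  proof
    show "cutoff L (\<lambda>x. \<kappa> n x * A x)" for n by (rule cutoff_mult[OF \<kappa>(1) A(1)])
    show "((\<lambda>x. \<kappa> n x * A x) has_real_derivative \<kappa>' n x * A x + A' x * \<kappa> n x) (at x)" for n x
      by (rule DERIV_mult[OF \<kappa>(2) A(4)])
    fix x assume x: "0 < x" "x < L"
    show "(\<lambda>n. \<kappa> n x * A x) \<longlonglongrightarrow> A x"
      using tendsto_mult_right[OF \<kappa>(4)[OF x], of "A x"] by simp
    have "(\<lambda>n. \<kappa>' n x * A x + A' x * \<kappa> n x) \<longlonglongrightarrow> 0 * A x + A' x * 1"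
      by (intro tendsto_intros \<kappa>(4,5) x)
    then show "(\<lambda>n. \<kappa>' n x * A x + A' x * \<kappa> n x) \<longlonglongrightarrow> A' x" by simp
    fix n
    have "\<bar>\<kappa> n x * A x\<bar> \<le> C2" using mult_mono[OF \<kappa>(3)[of n x] C2(2)[of x]] x by (simp add: abs_mult)
    then show "\<bar>\<kappa> n x * A x\<bar> \<le> 6 * C1 + C1 + C2" using C1(1) by simp
    have "\<bar>\<kappa>' n x * A x\<bar> \<le> \<bar>\<kappa>' n x\<bar> * (C1 * min x (L - x))"
      unfolding abs_mult by (rule mult_left_mono[OF Am[OF x]]) simp
    also have "\<dots> \<le> 6 * C1" using mult_left_mono[OF \<kappa>(6)[OF x, of n], of C1] C1(1) by (simp add: mult_ac)
    finally have "\<bar>\<kappa>' n x * A x\<bar> \<le> 6 * C1" .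
    moreover have "\<bar>A' x * \<kappa> n x\<bar> \<le> C1" using mult_mono[OF C1(2)[of x] \<kappa>(3)[of n x]] x C1(1) by (simp add: abs_mult)
    ultimately show "\<bar>\<kappa>' n x * A x + A' x * \<kappa> n x\<bar> \<le> 6 * C1 + C1 + C2" using C2(1) by linarith
  qed
qed

section \<open>Integration by parts in the strip\<close>

context strip
begin

text \<open>Since \<open>g\<close> is only \<open>C\<^sup>1\<close>, the function \<open>A x * B (y - g x)\<close> is not a test function; it becomes one
  when \<open>g\<close> is replaced by a polynomial close to it in \<open>C\<^sup>1\<close>.\<close>

lemma polynomial_approx:
  obtains q p :: "nat \<Rightarrow> real \<Rightarrow> real"
  where "\<And>n. smooth (q n)" "\<And>n x. (p n has_real_derivative q n x) (at x)"
    "\<And>n x. 0 \<le> x \<Longrightarrow> x \<le> l \<Longrightarrow> \<bar>q n x - g' x\<bar> \<le> 1 / real (Suc n)"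
    "\<And>n x. 0 \<le> x \<Longrightarrow> x \<le> l \<Longrightarrow> \<bar>p n x - g x\<bar> \<le> l / real (Suc n)"
proof -
  have "\<exists>p q. smooth q \<and> (\<forall>x. (p has_real_derivative q x) (at x)) \<and>
      (\<forall>x. 0 \<le> x \<and> x \<le> l \<longrightarrow> \<bar>q x - g' x\<bar> \<le> 1 / real (Suc n)) \<and>
      (\<forall>x. 0 \<le> x \<and> x \<le> l \<longrightarrow> \<bar>p x - g x\<bar> \<le> l / real (Suc n))" for n
  proof -
    have "continuous_on {0..l} g'" using g'c continuous_on_subset by blast
    from Stone_Weierstrass_real_polynomial_function[OF _ this, of "1 / real (Suc n)"]
    obtain q where q: "real_polynomial_function q" "\<And>x. x \<in> {0..l} \<Longrightarrow> \<bar>g' x - q x\<bar> < 1 / real (Suc n)"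
      by auto
    obtain p where p: "p 0 = g 0" "\<And>x. (p has_real_derivative q x) (at x)"
      using polynomial_antiderivative[OF q(1), of "g 0"] by blast
    have "\<bar>p x - g x\<bar> \<le> l / real (Suc n)" if x: "0 \<le> x" "x \<le> l" for x
    proof (cases "x = 0")
      case True
      then show ?thesis using p l by simp
    next
      case False
      then have "0 < x" using x by simp
      have "((\<lambda>x. p x - g x) has_real_derivative q y - g' y) (at y)" for y
        by (rule DERIV_diff[OF p(2) g])
      from MVT2[OF \<open>0 < x\<close> this] obtain y where y: "0 < y" "y < x" "p x - g x = x * (q y - g' y)"
        using p(1) by auto
      then have "\<bar>p x - g x\<bar> = x * \<bar>g' y - q y\<bar>" using \<open>0 < x\<close> by (simp add: abs_mult abs_minus_commute)
      also have "\<dots> \<le> l * (1 / real (Suc n))"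
        using q(2)[of y] y x l by (intro mult_mono) auto
      finally show ?thesis by simp
    qed
    moreover have "\<bar>q x - g' x\<bar> \<le> 1 / real (Suc n)" if "0 \<le> x" "x \<le> l" for x
      using q(2)[of x] that by (simp add: abs_minus_commute del: of_nat_Suc)
    ultimately show ?thesis using p(2) smooth_polynomial[OF q(1)] by blast
  qed
  then show ?thesis using that by metis
qed

lemma tendsto_ip_shear:
  assumes w: "w \<in> L2 M" and Y: "continuous_on UNIV Y"
    and p: "\<And>n. continuous_on UNIV (p n)" "\<And>n x. 0 \<le> x \<Longrightarrow> x \<le> l \<Longrightarrow> \<bar>p n x - g x\<bar> \<le> l / real (Suc n)"
    and r: "\<And>n. continuous_on UNIV (r n)" "\<And>n x. 0 < x \<Longrightarrow> x < l \<Longrightarrow> \<bar>r n x\<bar> \<le> C"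
      "\<And>x. 0 < x \<Longrightarrow> x < l \<Longrightarrow> (\<lambda>n. r n x) \<longlonglongrightarrow> r' x"
  shows "(\<lambda>n. LINT z|M. w z * (r n (fst z) * Y (snd z - p n (fst z)))) \<longlonglongrightarrow> (LINT z|M. w z * V r' Y z)"
proof -
  \<comment> \<open>As \<open>p n\<close> stays within \<open>l\<close> of \<open>g\<close>, the
    argument \<open>y - p n x\<close> stays in this interval.\<close>
  obtain D where D: "\<And>t. - l \<le> t \<Longrightarrow> t \<le> d + l \<Longrightarrow> \<bar>Y t\<bar> \<le> D"
    using bounded_on_interval[OF Y, of "- l" "d + l"] by metis
  have f: "continuous_on UNIV (\<lambda>z::real \<times> real. X (fst z))" if "continuous_on UNIV X" for X :: "real \<Rightarrow> real"
    by (rule continuous_on_compose2[OF that]) (auto intro: continuous_on_fst continuous_on_id)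
  show ?thesis
  proof (rule tendsto_ip[OF w, where C="C * D"])
    fix n
    have "continuous_on UNIV (\<lambda>z::real \<times> real. Y (snd z - p n (fst z)))"
      by (rule continuous_on_compose2[OF Y], intro continuous_on_diff continuous_on_snd continuous_on_id f p) simp
    then show "(\<lambda>z. r n (fst z) * Y (snd z - p n (fst z))) \<in> borel_measurable M"
      by (intro cont_measurable continuous_on_mult f r)
    fix z assume z: "z \<in> \<Omega>"
    then have x: "0 < fst z" "fst z < l" and y: "g (fst z) < snd z" "snd z < g (fst z) + d" by (auto simp: \<Omega>_def)
    have "l / real (Suc n) \<le> l" using l by (simp add: divide_le_eq)
    with p(2)[of "fst z" n] x have "\<bar>p n (fst z) - g (fst z)\<bar> \<le> l" by simp
    then have "\<bar>Y (snd z - p n (fst z))\<bar> \<le> D" using y by (intro D) linarith+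
    then show "\<bar>r n (fst z) * Y (snd z - p n (fst z))\<bar> \<le> C * D"
      unfolding abs_mult using r(2)[OF x] by (intro mult_mono) (auto intro: order_trans[OF abs_ge_zero])
  next
    fix z assume z: "z \<in> \<Omega>"
    then have x: "0 < fst z" "fst z < l" by (auto simp: \<Omega>_def)
    have "(\<lambda>n. p n (fst z) - g (fst z)) \<longlonglongrightarrow> 0"
    proof (rule Lim_null_comparison)
      show "\<forall>\<^sub>F n in sequentially. norm (p n (fst z) - g (fst z)) \<le> l / real (Suc n)"
        using p(2) x by (intro always_eventually) (simp del: of_nat_Suc)
      show "(\<lambda>n. l / real (Suc n)) \<longlonglongrightarrow> 0"
        using tendsto_mult_right_zero[OF LIMSEQ_Suc[OF lim_1_over_n], of l] by simp
    qed
    then have "(\<lambda>n. p n (fst z)) \<longlonglongrightarrow> g (fst z)" by (simp add: LIM_zero_iff)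
    then have "(\<lambda>n. snd z - p n (fst z)) \<longlonglongrightarrow> snd z - g (fst z)" by (intro tendsto_intros)
    then have "(\<lambda>n. Y (snd z - p n (fst z))) \<longlonglongrightarrow> Y (snd z - g (fst z))"
      using Y by (intro isCont_tendsto_compose[where g=Y]) (auto simp: continuous_on_eq_continuous_at)
    then show "(\<lambda>n. r n (fst z) * Y (snd z - p n (fst z))) \<longlonglongrightarrow> V r' Y z"
      unfolding V_def by (intro tendsto_mult r(3) x)
  qed
qed

text \<open>The derivative along the curves \<open>y - g x = const\<close>.\<close>

definition shear_grad :: "(real \<times> real \<Rightarrow> real \<times> real) \<Rightarrow> real \<times> real \<Rightarrow> real" where
  "shear_grad G z = fst (G z) + g' (fst z) * snd (G z)"

lemma shear_grad_L2:
  assumes "(\<lambda>z. fst (G z)) \<in> L2 M" "(\<lambda>z. snd (G z)) \<in> L2 M"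
  shows "shear_grad G \<in> L2 M"
proof -
  obtain C where C: "\<And>x. 0 \<le> x \<Longrightarrow> x \<le> l \<Longrightarrow> \<bar>g' x\<bar> \<le> C" using bounded_on_interval[OF g'c, of 0 l] by metis
  have "(\<lambda>z. g' (fst z) * snd (G z)) \<in> L2 M"
    by (rule L2_mult_bounded[OF assms(2), of _ C]) 
      (use C \<Omega>_K in \<open>auto simp: K_def subset_eq intro: cont_measurable[OF gc'(2)]\<close>)
  from L2_add[OF assms(1) this] show ?thesis by (simp add: shear_grad_def[abs_def])
qed

text \<open>The limit of \<open>shear_weak_gradient\<close> along polynomials \<open>p n\<close>
  with \<open>p n\<close> and its derivative \<open>q n\<close> tending uniformly to
  \<open>g\<close> and \<open>g'\<close>; the derivative along \<open>(1, q n)\<close> becomes the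
  one along \<open>(1, g')\<close>.\<close>

lemma cutoff_weak_gradient:
  assumes u: "has_weak_gradient \<Omega> u G"
    and A: "cutoff l A" "\<And>x. (A has_real_derivative A' x) (at x)"
    and B: "cutoff d B" "\<And>x. (B has_real_derivative B' x) (at x)"
  shows "(LINT z|M. u z * V A B' z) = - (LINT z|M. snd (G z) * V A B z)"
    and "(LINT z|M. u z * V A' B z) = - (LINT z|M. shear_grad G z * V A B z)"
proof -
  have L2: "u \<in> L2 M" "(\<lambda>z. fst (G z)) \<in> L2 M" "(\<lambda>z. snd (G z)) \<in> L2 M"
    using u by (auto simp: has_weak_gradient_iff)
  obtain e where e: "e > 0" "\<And>t. t \<notin> {e..d - e} \<Longrightarrow> B t = 0" and sB: "smooth B"
    using B(1) by (auto simp: cutoff_def)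
  have sA: "smooth A" using A(1) by (simp add: cutoff_def)
  obtain A'' where A'': "\<And>x. (A has_real_derivative A'' x) (at x)" "smooth A''" using smooth_derivE[OF sA] by blast
  have "A' = A''" using DERIV_unique[OF A(2) A''(1)] by auto
  obtain B'' where B'': "\<And>x. (B has_real_derivative B'' x) (at x)" "smooth B''" using smooth_derivE[OF sB] by blast
  have "B' = B''" using DERIV_unique[OF B(2) B''(1)] by auto
  have c: "continuous_on UNIV A" "continuous_on UNIV A'" "continuous_on UNIV B" "continuous_on UNIV B'"
    using smooth_continuous A''(2) B''(2) sA sB \<open>A' = A''\<close> \<open>B' = B''\<close> by auto
  obtain q p where pq: "\<And>n. smooth (q n)" "\<And>n x. (p n has_real_derivative q n x) (at x)"
    "\<And>n x. 0 \<le> x \<Longrightarrow> x \<le> l \<Longrightarrow> \<bar>q n x - g' x\<bar> \<le> 1 / real (Suc n)"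
    "\<And>n x. 0 \<le> x \<Longrightarrow> x \<le> l \<Longrightarrow> \<bar>p n x - g x\<bar> \<le> l / real (Suc n)"
    using polynomial_approx by blast
  have pc: "continuous_on UNIV (p n)" and qc: "continuous_on UNIV (q n)" for n
    using smooth_of_deriv[OF pq(2,1)] pq(1) smooth_continuous by auto
  \<comment> \<open>Only for large \<open>n\<close> is \<open>p n\<close> closer to \<open>g\<close>
    than the fixed margin of \<open>B\<close>.\<close>
  have ev: "\<forall>\<^sub>F n in sequentially. l / real (Suc n) < e"
    using order_tendstoD(2)[OF tendsto_mult_right_zero[OF LIMSEQ_Suc[OF lim_1_over_n], of l] e(1)] by simp
  have close: "\<bar>p n x - g x\<bar> < e" if "l / real (Suc n) < e" "x \<in> {0..l}" for n x
    using pq(4)[of x n] that by auto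
  obtain CA where CA: "\<And>x. 0 \<le> x \<Longrightarrow> x \<le> l \<Longrightarrow> \<bar>A x\<bar> \<le> CA" using bounded_on_interval[OF c(1), of 0 l] by metis
  obtain CA' where CA': "\<And>x. 0 \<le> x \<Longrightarrow> x \<le> l \<Longrightarrow> \<bar>A' x\<bar> \<le> CA'" using bounded_on_interval[OF c(2), of 0 l] by metis
  obtain Cg where Cg: "\<And>x. 0 \<le> x \<Longrightarrow> x \<le> l \<Longrightarrow> \<bar>g' x\<bar> \<le> Cg" using bounded_on_interval[OF g'c, of 0 l] by metis
  have A1: "(\<lambda>n. LINT z|M. w z * (A (fst z) * Y (snd z - p n (fst z)))) \<longlonglongrightarrow> (LINT z|M. w z * V A Y z)"
    if "w \<in> L2 M" "continuous_on UNIV Y" for w Y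
    by (rule tendsto_ip_shear[where r="\<lambda>_. A" and C=CA]) (use that pc pq(4) c CA in auto)
  have A2: "(\<lambda>n. LINT z|M. w z * (A' (fst z) * Y (snd z - p n (fst z)))) \<longlonglongrightarrow> (LINT z|M. w z * V A' Y z)"
    if "w \<in> L2 M" "continuous_on UNIV Y" for w Y
    by (rule tendsto_ip_shear[where r="\<lambda>_. A'" and C=CA']) (use that pc pq(4) c CA' in auto)
  have A3: "(\<lambda>n. LINT z|M. w z * ((q n (fst z) * A (fst z)) * B (snd z - p n (fst z)))) \<longlonglongrightarrow> (LINT z|M. w z * V (\<lambda>x. g' x * A x) B z)"
    if "w \<in> L2 M" for w
  proof (rule tendsto_ip_shear[where r="\<lambda>n x. q n x * A x" and r'="\<lambda>x. g' x * A x" and C="(1 + Cg) * CA"])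
    show "continuous_on UNIV (\<lambda>x. q n x * A x)" for n by (intro continuous_on_mult qc c)
    show "\<bar>p n x - g x\<bar> \<le> l / real (Suc n)" if "0 \<le> x" "x \<le> l" for n x by (rule pq(4)[OF that])
    show "w \<in> L2 M" by (rule that)
    fix n x assume x: "0 < x" "x < l"
    have "1 / real (Suc n) \<le> 1" by simp
    then have "\<bar>q n x\<bar> \<le> 1 + Cg" using pq(3)[of x n] Cg[of x] x by linarith
    then show "\<bar>q n x * A x\<bar> \<le> (1 + Cg) * CA"
      unfolding abs_mult using CA[of x] x by (intro mult_mono) (auto intro: order_trans[OF abs_ge_zero])
  next
    fix x assume x: "0 < x" "x < l"
    have "(\<lambda>n. q n x - g' x) \<longlonglongrightarrow> 0"
      by (rule Lim_null_comparison[OF _ LIMSEQ_Suc[OF lim_1_over_n]])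
        (use pq(3) x in \<open>auto intro!: always_eventually simp del: of_nat_Suc\<close>)
    then show "(\<lambda>n. q n x * A x) \<longlonglongrightarrow> g' x * A x" by (intro tendsto_intros) (simp add: LIM_zero_iff)
  qed (rule c pc)+
  have "\<forall>\<^sub>F n in sequentially. (LINT z|M. u z * (A (fst z) * B' (snd z - p n (fst z)))) = - (LINT z|M. snd (G z) * (A (fst z) * B (snd z - p n (fst z))))"
    using ev by eventually_elim (rule shear_weak_gradient(1)[OF u A sB e(2) B(2) pq(1,2) close])
  from Lim_transform_eventually[OF A1[OF L2(1) c(4)] this]
  have "(\<lambda>n. - (LINT z|M. snd (G z) * (A (fst z) * B (snd z - p n (fst z))))) \<longlonglongrightarrow> (LINT z|M. u z * V A B' z)" .
  from LIMSEQ_unique[OF this tendsto_minus[OF A1[OF L2(3) c(3)]]]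
  show "(LINT z|M. u z * V A B' z) = - (LINT z|M. snd (G z) * V A B z)" .
  \<comment> \<open>The weight \<open>q n\<close> depends on \<open>n\<close> as well, so it is
    moved to the function of \<open>x\<close> and the two terms are taken to their limits
    separately.\<close>
  have split: "(LINT z|M. (fst (G z) + q n (fst z) * snd (G z)) * (A (fst z) * B (snd z - p n (fst z))))
    = (LINT z|M. fst (G z) * (A (fst z) * B (snd z - p n (fst z)))) + (LINT z|M. snd (G z) * ((q n (fst z) * A (fst z)) * B (snd z - p n (fst z))))" for n
  proof -
    have f: "continuous_on UNIV (\<lambda>z::real \<times> real. X (fst z))" if "continuous_on UNIV X" for X :: "real \<Rightarrow> real"
      by (rule continuous_on_compose2[OF that]) (auto intro: continuous_on_fst continuous_on_id)
    have "continuous_on UNIV (\<lambda>z::real \<times> real. B (snd z - p n (fst z)))"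
      by (rule continuous_on_compose2[OF c(3)], intro continuous_on_diff continuous_on_snd continuous_on_id f pc) simp
    note Bc = this
    have "integrable M (\<lambda>z. fst (G z) * (A (fst z) * B (snd z - p n (fst z))))"
      by (rule L2_cont_integrable[OF L2(2) continuous_on_mult[OF f[OF c(1)] Bc]])
    moreover have "integrable M (\<lambda>z. snd (G z) * ((q n (fst z) * A (fst z)) * B (snd z - p n (fst z))))"
      by (rule L2_cont_integrable[OF L2(3) continuous_on_mult[OF continuous_on_mult[OF f[OF qc] f[OF c(1)]] Bc]])
    ultimately have "integrable M (\<lambda>z. fst (G z) * (A (fst z) * B (snd z - p n (fst z))))"
      "integrable M (\<lambda>z. snd (G z) * ((q n (fst z) * A (fst z)) * B (snd z - p n (fst z))))" by auto
    from Bochner_Integration.integral_add[OF this, symmetric] show ?thesis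
      by (simp add: algebra_simps)
  qed
  have "\<forall>\<^sub>F n in sequentially. (LINT z|M. u z * (A' (fst z) * B (snd z - p n (fst z)))) =
    - ((LINT z|M. fst (G z) * (A (fst z) * B (snd z - p n (fst z)))) + (LINT z|M. snd (G z) * ((q n (fst z) * A (fst z)) * B (snd z - p n (fst z)))))"
    using ev unfolding split[symmetric]
    by eventually_elim (rule shear_weak_gradient(2)[OF u A sB e(2) B(2) pq(1,2) close])
  from Lim_transform_eventually[OF A2[OF L2(1) c(3)] this]
  have "(LINT z|M. u z * V A' B z) = - ((LINT z|M. fst (G z) * V A B z) + (LINT z|M. snd (G z) * V (\<lambda>x. g' x * A x) B z))"
    by (rule LIMSEQ_unique) (intro tendsto_minus tendsto_add A1 A3 L2 c)
  also have "(LINT z|M. fst (G z) * V A B z) + (LINT z|M. snd (G z) * V (\<lambda>x. g' x * A x) B z) = (LINT z|M. shear_grad G z * V A B z)"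
  proof -
    have "integrable M (\<lambda>z. fst (G z) * V A B z)" "integrable M (\<lambda>z. snd (G z) * V (\<lambda>x. g' x * A x) B z)"
      by (intro L2_cont_integrable L2 V_cont continuous_on_mult c g'c)+
    from Bochner_Integration.integral_add[OF this, symmetric] show ?thesis
      by (simp add: shear_grad_def V_def algebra_simps)
  qed
  finally show "(LINT z|M. u z * V A' B z) = - (LINT z|M. shear_grad G z * V A B z)" .
qed

lemma tendsto_ip_V:
  assumes w: "w \<in> L2 M" and "\<And>n. continuous_on UNIV (A n)" "\<And>n. continuous_on UNIV (B n)"
    and A: "\<And>n x. 0 < x \<Longrightarrow> x < l \<Longrightarrow> \<bar>A n x\<bar> \<le> C" "\<And>x. 0 < x \<Longrightarrow> x < l \<Longrightarrow> (\<lambda>n. A n x) \<longlonglongrightarrow> A' x"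
    and B: "\<And>n x. 0 < x \<Longrightarrow> x < d \<Longrightarrow> \<bar>B n x\<bar> \<le> D" "\<And>x. 0 < x \<Longrightarrow> x < d \<Longrightarrow> (\<lambda>n. B n x) \<longlonglongrightarrow> B' x"
  shows "(\<lambda>n. LINT z|M. w z * V (A n) (B n) z) \<longlonglongrightarrow> (LINT z|M. w z * V A' B' z)"
proof (rule tendsto_ip[OF w, where C="C * D"])
  show "V (A n) (B n) \<in> borel_measurable M" for n by (intro cont_measurable V_cont assms)
  fix z assume "z \<in> \<Omega>"
  then have z: "0 < fst z" "fst z < l" "0 < snd z - g (fst z)" "snd z - g (fst z) < d" by (auto simp: \<Omega>_def)
  show "\<bar>V (A n) (B n) z\<bar> \<le> C * D" for n
    unfolding V_def abs_mult using A(1)[OF z(1,2)] B(1)[OF z(3,4)]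
    by (intro mult_mono) (auto intro: order_trans[OF abs_ge_zero])
  show "(\<lambda>n. V (A n) (B n) z) \<longlonglongrightarrow> V A' B' z"
    unfolding V_def by (intro tendsto_mult A(2) B(2) z)
qed

lemma cutoff_deriv_cont:
  assumes "cutoff L A" "\<And>x. (A has_real_derivative A' x) (at x)"
  shows "continuous_on UNIV A" "continuous_on UNIV A'"
proof -
  have sA: "smooth A" using assms(1) by (simp add: cutoff_def)
  obtain A'' where A'': "\<And>x. (A has_real_derivative A'' x) (at x)" "smooth A''" using smooth_derivE[OF sA] by blast
  have "A' = A''" using DERIV_unique[OF assms(2) A''(1)] by auto
  then show "continuous_on UNIV A" "continuous_on UNIV A'" using smooth_continuous sA A''(2) by auto
qed

text \<open>The differentiated factor \<open>A\<close> vanishes at the ends and can be cut off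
  together with its derivative; \<open>B\<close> is cut off by values alone and is free at its ends.
  No boundary condition falls on \<open>u\<close>.\<close>

lemma weak_gradient_x:
  assumes u: "has_weak_gradient \<Omega> u G"
    and A: "smooth A" "A 0 = 0" "A l = 0" "\<And>x. (A has_real_derivative A' x) (at x)" and B: "smooth B"
  shows "(LINT z|M. u z * V A' B z) = - (LINT z|M. shear_grad G z * V A B z)"
proof -
  have L2: "u \<in> L2 M" "(\<lambda>z. fst (G z)) \<in> L2 M" "(\<lambda>z. snd (G z)) \<in> L2 M"
    using u by (auto simp: has_weak_gradient_iff)
  obtain An An' C where An: "\<And>n. cutoff l (An n)" "\<And>n x. (An n has_real_derivative An' n x) (at x)"
    "\<And>x. 0 < x \<Longrightarrow> x < l \<Longrightarrow> (\<lambda>n::nat. An n x) \<longlonglongrightarrow> A x"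
    "\<And>x. 0 < x \<Longrightarrow> x < l \<Longrightarrow> (\<lambda>n::nat. An' n x) \<longlonglongrightarrow> A' x"
    "\<And>n x. 0 < x \<Longrightarrow> x < l \<Longrightarrow> \<bar>An n x\<bar> \<le> C" "\<And>n x. 0 < x \<Longrightarrow> x < l \<Longrightarrow> \<bar>An' n x\<bar> \<le> C"
    using cutoff_approx_boundary[OF l A] by blast
  obtain Bn Bn' D where Bn: "\<And>n. cutoff d (Bn n)" "\<And>n x. (Bn n has_real_derivative Bn' n x) (at x)"
    "\<And>x. 0 < x \<Longrightarrow> x < d \<Longrightarrow> (\<lambda>n::nat. Bn n x) \<longlonglongrightarrow> B x"
    "\<And>n x. 0 < x \<Longrightarrow> x < d \<Longrightarrow> \<bar>Bn n x\<bar> \<le> D"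
    using cutoff_approx[OF d B] by blast
  note cA = cutoff_deriv_cont[OF An(1,2)] and cB = cutoff_deriv_cont(1)[OF Bn(1,2)]
  have "(\<lambda>n. LINT z|M. u z * V (An' n) (Bn n) z) \<longlonglongrightarrow> (LINT z|M. u z * V A' B z)"
    by (rule tendsto_ip_V[OF L2(1) cA(2) cB An(6,4) Bn(4,3)]) assumption+
  moreover have "(\<lambda>n. - (LINT z|M. shear_grad G z * V (An n) (Bn n) z)) \<longlonglongrightarrow> - (LINT z|M. shear_grad G z * V A B z)"
    by (rule tendsto_minus, rule tendsto_ip_V[OF shear_grad_L2[OF L2(2,3)] cA(1) cB An(5,3) Bn(4,3)]) assumption+
  ultimately show ?thesis unfolding cutoff_weak_gradient(2)[OF u An(1,2) Bn(1,2)] by (rule LIMSEQ_unique)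
qed

lemma weak_gradient_y:
  assumes u: "has_weak_gradient \<Omega> u G"
    and A: "smooth A" and B: "smooth B" "B 0 = 0" "B d = 0" "\<And>x. (B has_real_derivative B' x) (at x)"
  shows "(LINT z|M. u z * V A B' z) = - (LINT z|M. snd (G z) * V A B z)"
proof -
  have L2: "u \<in> L2 M" "(\<lambda>z. fst (G z)) \<in> L2 M" "(\<lambda>z. snd (G z)) \<in> L2 M"
    using u by (auto simp: has_weak_gradient_iff)
  obtain Bn Bn' D where Bn: "\<And>n. cutoff d (Bn n)" "\<And>n x. (Bn n has_real_derivative Bn' n x) (at x)"
    "\<And>x. 0 < x \<Longrightarrow> x < d \<Longrightarrow> (\<lambda>n::nat. Bn n x) \<longlonglongrightarrow> B x"
    "\<And>x. 0 < x \<Longrightarrow> x < d \<Longrightarrow> (\<lambda>n::nat. Bn' n x) \<longlonglongrightarrow> B' x"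
    "\<And>n x. 0 < x \<Longrightarrow> x < d \<Longrightarrow> \<bar>Bn n x\<bar> \<le> D" "\<And>n x. 0 < x \<Longrightarrow> x < d \<Longrightarrow> \<bar>Bn' n x\<bar> \<le> D"
    using cutoff_approx_boundary[OF d B] by blast
  obtain An An' C where An: "\<And>n. cutoff l (An n)" "\<And>n x. (An n has_real_derivative An' n x) (at x)"
    "\<And>x. 0 < x \<Longrightarrow> x < l \<Longrightarrow> (\<lambda>n::nat. An n x) \<longlonglongrightarrow> A x"
    "\<And>n x. 0 < x \<Longrightarrow> x < l \<Longrightarrow> \<bar>An n x\<bar> \<le> C"
    using cutoff_approx[OF l A] by blast
  note cB = cutoff_deriv_cont[OF Bn(1,2)] and cA = cutoff_deriv_cont(1)[OF An(1,2)]
  have "(\<lambda>n. LINT z|M. u z * V (An n) (Bn' n) z) \<longlonglongrightarrow> (LINT z|M. u z * V A B' z)"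
    by (rule tendsto_ip_V[OF L2(1) cA cB(2) An(4,3) Bn(6,4)]) assumption+
  moreover have "(\<lambda>n. - (LINT z|M. snd (G z) * V (An n) (Bn n) z)) \<longlonglongrightarrow> - (LINT z|M. snd (G z) * V A B z)"
    by (rule tendsto_minus, rule tendsto_ip_V[OF L2(3) cA cB(1) An(4,3) Bn(5,3)]) assumption+
  ultimately show ?thesis unfolding cutoff_weak_gradient(1)[OF u An(1,2) Bn(1,2)] by (rule LIMSEQ_unique)
qed

text \<open>For \<open>u = 0\<close> the side with derivatives disappears, so both factors may be
  cut off by values alone. This is the input for the uniqueness of weak gradients.\<close>

lemma weak_gradient_zero:
  assumes u: "has_weak_gradient \<Omega> (\<lambda>_. 0) G" and A: "smooth A" and B: "smooth B"
  shows "(LINT z|M. shear_grad G z * V A B z) = 0" "(LINT z|M. snd (G z) * V A B z) = 0"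
proof -
  have L2: "(\<lambda>z. fst (G z)) \<in> L2 M" "(\<lambda>z. snd (G z)) \<in> L2 M"
    using u by (auto simp: has_weak_gradient_iff)
  obtain An An' C where An: "\<And>n. cutoff l (An n)" "\<And>n x. (An n has_real_derivative An' n x) (at x)"
    "\<And>x. 0 < x \<Longrightarrow> x < l \<Longrightarrow> (\<lambda>n::nat. An n x) \<longlonglongrightarrow> A x"
    "\<And>n x. 0 < x \<Longrightarrow> x < l \<Longrightarrow> \<bar>An n x\<bar> \<le> C"
    using cutoff_approx[OF l A] by blast
  obtain Bn Bn' D where Bn: "\<And>n. cutoff d (Bn n)" "\<And>n x. (Bn n has_real_derivative Bn' n x) (at x)"
    "\<And>x. 0 < x \<Longrightarrow> x < d \<Longrightarrow> (\<lambda>n::nat. Bn n x) \<longlonglongrightarrow> B x"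
    "\<And>n x. 0 < x \<Longrightarrow> x < d \<Longrightarrow> \<bar>Bn n x\<bar> \<le> D"
    using cutoff_approx[OF d B] by blast
  note cA = cutoff_deriv_cont(1)[OF An(1,2)] and cB = cutoff_deriv_cont(1)[OF Bn(1,2)]
  have "(LINT z|M. shear_grad G z * V (An n) (Bn n) z) = 0" "(LINT z|M. snd (G z) * V (An n) (Bn n) z) = 0" for n
    using cutoff_weak_gradient[OF u An(1,2) Bn(1,2), of n n] by auto
  moreover have "(\<lambda>n. LINT z|M. w z * V (An n) (Bn n) z) \<longlonglongrightarrow> (LINT z|M. w z * V A B z)" if "w \<in> L2 M" for w
    by (rule tendsto_ip_V[OF that cA cB An(4,3) Bn(4,3)]) assumption+
  from this[OF shear_grad_L2[OF L2]] this[OF L2(2)]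
  show "(LINT z|M. shear_grad G z * V A B z) = 0" "(LINT z|M. snd (G z) * V A B z) = 0"
    unfolding calculation by (simp_all add: LIMSEQ_const_iff)
qed

end

section \<open>Orthogonal expansions and cosines\<close>

lemma L2_Cauchy_Schwarz:
  assumes f: "f \<in> L2 M" and g: "g \<in> L2 M"
  shows "(ip M f g)\<^sup>2 \<le> ip M f f * ip M g g"
proof -
  have quad: "0 \<le> ip M f f - 2 * t * ip M f g + t\<^sup>2 * ip M g g" for t
  proof -
    have "0 \<le> (LINT x|M. (f x - t * g x)\<^sup>2)" by (rule Bochner_Integration.integral_nonneg) simp
    also have "\<dots> = (LINT x|M. f x * f x - 2 * t * (f x * g x) + t\<^sup>2 * (g x * g x))"
      by (rule Bochner_Integration.integral_cong) (auto simp: power2_eq_square algebra_simps)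
    also have "\<dots> = ip M f f - 2 * t * ip M f g + t\<^sup>2 * ip M g g"
      using L2_mult_integrable[OF f f] L2_mult_integrable[OF f g] L2_mult_integrable[OF g g] by simp
    finally show ?thesis .
  qed
  have g0: "0 \<le> ip M g g" by (rule Bochner_Integration.integral_nonneg) simp
  show ?thesis
  proof (cases "ip M g g = 0")
    case True
    then have "AE x in M. g x = 0" by (rule ip_eq_0_AE[OF g])
    then have "ip M f g = 0" by (intro integral_eq_zero_AE) auto
    then show ?thesis using True by simp
  next
    case False
    then have pos: "ip M g g > 0" using le_neq_trans[OF g0] by metis
    have "0 \<le> ip M f f - (ip M f g)\<^sup>2 / ip M g g"
      using quad[of "ip M f g / ip M g g"] pos by (simp add: power2_eq_square field_simps)
    then show ?thesis using pos by (simp add: field_simps)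
  qed
qed

lemma L2_tendsto_ip:
  assumes f: "\<And>n. f n \<in> L2 M" and F: "F \<in> L2 M" and \<psi>: "\<psi> \<in> L2 M"
    and lim: "(\<lambda>n::nat. LINT x|M. (f n x - F x)\<^sup>2) \<longlonglongrightarrow> 0"
  shows "(\<lambda>n. ip M (f n) \<psi>) \<longlonglongrightarrow> ip M F \<psi>"
proof -
  have "(\<lambda>n. (ip M (f n) \<psi> - ip M F \<psi>)\<^sup>2) \<longlonglongrightarrow> 0"
  proof (rule tendsto_sandwich[OF _ _ tendsto_const])
    show "(\<lambda>n. (LINT x|M. (f n x - F x)\<^sup>2) * ip M \<psi> \<psi>) \<longlonglongrightarrow> 0"
      using tendsto_mult_right[OF lim, of "ip M \<psi> \<psi>"] by simp
    show "\<forall>\<^sub>F n in sequentially. (ip M (f n) \<psi> - ip M F \<psi>)\<^sup>2 \<le> (LINT x|M. (f n x - F x)\<^sup>2) * ip M \<psi> \<psi>"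
    proof (rule always_eventually, rule allI)
      fix n
      have "ip M (f n) \<psi> - ip M F \<psi> = ip M (\<lambda>x. f n x - F x) \<psi>"
        using L2_mult_integrable[OF f \<psi>, of n] L2_mult_integrable[OF F \<psi>] by (simp add: left_diff_distrib)
      then show "(ip M (f n) \<psi> - ip M F \<psi>)\<^sup>2 \<le> (LINT x|M. (f n x - F x)\<^sup>2) * ip M \<psi> \<psi>"
        using L2_Cauchy_Schwarz[OF L2_diff[OF f F] \<psi>, of n] by (simp add: power2_eq_square)
    qed
  qed simp
  from tendsto_real_sqrt[OF this] show ?thesis
    by (simp add: tendsto_rabs_zero_iff LIM_zero_iff)
qed

text \<open>Both parts come from the squared distance between \<open>w\<close> and a linear
  combination, which is least at the Fourier coefficients: best approximation, and Bessel's
  inequality because that minimum is nonnegative. The system is not normalised;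
  \<open>\<nu> i\<close> are the squared norms.\<close>

lemma orthogonal_expansion:
  assumes F: "finite F" and w: "w \<in> L2 M" and e: "\<And>i. i \<in> F \<Longrightarrow> e i \<in> L2 M"
    and on: "\<And>i j. i \<in> F \<Longrightarrow> j \<in> F \<Longrightarrow> ip M (e i) (e j) = (if i = j then \<nu> i else 0)"
    and pos: "\<And>i. i \<in> F \<Longrightarrow> \<nu> i > 0"
  shows "ip M w w - (\<Sum>i\<in>F. (ip M w (e i))\<^sup>2 / \<nu> i) \<le> (LINT x|M. (w x - (\<Sum>i\<in>F. c i * e i x))\<^sup>2)"
    and "(\<Sum>i\<in>F. (ip M w (e i))\<^sup>2 / \<nu> i) \<le> ip M w w"
proof -
  have gen: "(LINT x|M. (w x - (\<Sum>i\<in>F. c i * e i x))\<^sup>2) = ip M w w - 2 * (\<Sum>i\<in>F. c i * ip M w (e i)) + (\<Sum>i\<in>F. (c i)\<^sup>2 * \<nu> i)" for c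
  proof -
    have i1: "integrable M (\<lambda>x. w x * w x)" by (rule L2_mult_integrable[OF w w])
    have i2: "integrable M (\<lambda>x. \<Sum>i\<in>F. c i * (w x * e i x))"
      by (intro Bochner_Integration.integrable_sum integrable_mult_right L2_mult_integrable w e)
    have i3: "integrable M (\<lambda>x. \<Sum>i\<in>F. \<Sum>j\<in>F. (c i * c j) * (e i x * e j x))"
      by (intro Bochner_Integration.integrable_sum integrable_mult_right L2_mult_integrable e)
    have "(LINT x|M. (w x - (\<Sum>i\<in>F. c i * e i x))\<^sup>2)
       = (LINT x|M. w x * w x - 2 * (\<Sum>i\<in>F. c i * (w x * e i x)) + (\<Sum>i\<in>F. \<Sum>j\<in>F. (c i * c j) * (e i x * e j x)))"
    proof (rule Bochner_Integration.integral_cong[OF refl])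
      fix x
      have "(\<Sum>i\<in>F. c i * e i x) * (\<Sum>j\<in>F. c j * e j x) = (\<Sum>i\<in>F. \<Sum>j\<in>F. (c i * c j) * (e i x * e j x))"
        by (simp add: sum_product mult_ac)
      moreover have "w x * (\<Sum>i\<in>F. c i * e i x) = (\<Sum>i\<in>F. c i * (w x * e i x))"
        by (simp add: sum_distrib_left mult_ac)
      ultimately show "(w x - (\<Sum>i\<in>F. c i * e i x))\<^sup>2 = w x * w x - 2 * (\<Sum>i\<in>F. c i * (w x * e i x)) + (\<Sum>i\<in>F. \<Sum>j\<in>F. (c i * c j) * (e i x * e j x))"
        unfolding power2_eq_square by (simp add: algebra_simps)
    qed
    also have "\<dots> = ip M w w - 2 * (LINT x|M. (\<Sum>i\<in>F. c i * (w x * e i x))) + (LINT x|M. (\<Sum>i\<in>F. \<Sum>j\<in>F. (c i * c j) * (e i x * e j x)))"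
      using i1 i2 i3 by simp
    also have "(LINT x|M. (\<Sum>i\<in>F. c i * (w x * e i x))) = (\<Sum>i\<in>F. c i * ip M w (e i))"
      by (subst Bochner_Integration.integral_sum) (auto intro!: integrable_mult_right L2_mult_integrable w e)
    also have "(LINT x|M. (\<Sum>i\<in>F. \<Sum>j\<in>F. (c i * c j) * (e i x * e j x))) = (\<Sum>i\<in>F. \<Sum>j\<in>F. (c i * c j) * ip M (e i) (e j))"
    proof -
      have int: "integrable M (\<lambda>x. (c i * c j) * (e i x * e j x))" if "i \<in> F" "j \<in> F" for i j
        by (intro integrable_mult_right L2_mult_integrable e that)
      have "(LINT x|M. (\<Sum>i\<in>F. \<Sum>j\<in>F. (c i * c j) * (e i x * e j x)))
          = (\<Sum>i\<in>F. LINT x|M. (\<Sum>j\<in>F. (c i * c j) * (e i x * e j x)))"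
        by (rule Bochner_Integration.integral_sum) (intro Bochner_Integration.integrable_sum int)
      also have "\<dots> = (\<Sum>i\<in>F. \<Sum>j\<in>F. LINT x|M. (c i * c j) * (e i x * e j x))"
        by (intro sum.cong refl Bochner_Integration.integral_sum int)
      finally show ?thesis by simp
    qed
    also have "\<dots> = (\<Sum>i\<in>F. \<Sum>j\<in>F. if i = j then (c i)\<^sup>2 * \<nu> i else 0)"
      by (intro sum.cong refl) (simp add: on power2_eq_square)
    also have "\<dots> = (\<Sum>i\<in>F. (c i)\<^sup>2 * \<nu> i)" using F by simp
    finally show ?thesis .
  qed
  have "2 * (c i * ip M w (e i)) - (c i)\<^sup>2 * \<nu> i \<le> (ip M w (e i))\<^sup>2 / \<nu> i" if "i \<in> F" for i
  proof -
    have "0 \<le> (c i * \<nu> i - ip M w (e i))\<^sup>2" by simp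
    then show ?thesis using pos[OF that] by (simp add: field_simps power2_eq_square)
  qed
  then have "2 * (\<Sum>i\<in>F. c i * ip M w (e i)) - (\<Sum>i\<in>F. (c i)\<^sup>2 * \<nu> i) \<le> (\<Sum>i\<in>F. (ip M w (e i))\<^sup>2 / \<nu> i)"
    unfolding sum_distrib_left sum_subtractf[symmetric] by (rule sum_mono)
  then show "ip M w w - (\<Sum>i\<in>F. (ip M w (e i))\<^sup>2 / \<nu> i) \<le> (LINT x|M. (w x - (\<Sum>i\<in>F. c i * e i x))\<^sup>2)"
    unfolding gen by linarith
  have "0 \<le> (LINT x|M. (w x - (\<Sum>i\<in>F. ip M w (e i) / \<nu> i * e i x))\<^sup>2)"
    by (rule Bochner_Integration.integral_nonneg) simp
  also have "\<dots> = ip M w w - (\<Sum>i\<in>F. (ip M w (e i))\<^sup>2 / \<nu> i)"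
  proof -
    have "2 * (ip M w (e i) / \<nu> i * ip M w (e i)) - (ip M w (e i) / \<nu> i)\<^sup>2 * \<nu> i = (ip M w (e i))\<^sup>2 / \<nu> i" if "i \<in> F" for i
      using pos[OF that] by (simp add: field_simps power2_eq_square)
    then have "2 * (\<Sum>i\<in>F. ip M w (e i) / \<nu> i * ip M w (e i)) - (\<Sum>i\<in>F. (ip M w (e i) / \<nu> i)\<^sup>2 * \<nu> i) = (\<Sum>i\<in>F. (ip M w (e i))\<^sup>2 / \<nu> i)"
      unfolding sum_distrib_left sum_subtractf[symmetric] by (rule sum.cong[OF refl])
    then show ?thesis unfolding gen by linarith
  qed
  finally show "(\<Sum>i\<in>F. (ip M w (e i))\<^sup>2 / \<nu> i) \<le> ip M w w" by simp
qed

section \<open>Cosines and sines on an interval\<close>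

definition cs :: "real \<Rightarrow> nat \<Rightarrow> real \<Rightarrow> real" where "cs L k x = cos (real k * pi / L * x)"
definition sn :: "real \<Rightarrow> nat \<Rightarrow> real \<Rightarrow> real" where "sn L k x = sin (real k * pi / L * x)"

lemma smooth_cs: "smooth (cs L k)" and smooth_sn: "smooth (sn L k)"
  unfolding cs_def[abs_def] sn_def[abs_def]
  by (intro smooth_compose[OF smooth_cos] smooth_compose[OF smooth_sin] smooth_mult smooth_const smooth_ident)+

lemma DERIV_cs: "(cs L k has_real_derivative - (real k * pi / L) * sn L k x) (at x)"
  and DERIV_sn: "(sn L k has_real_derivative (real k * pi / L) * cs L k x) (at x)"
proof -
  let ?c = "real k * pi / L"
  have d: "((\<lambda>x. ?c * x) has_real_derivative ?c) (at x)" by (rule DERIV_cmult_Id)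
  show "(cs L k has_real_derivative - (real k * pi / L) * sn L k x) (at x)"
    using DERIV_chain2[OF DERIV_cos d] by (simp add: cs_def[abs_def] sn_def mult.commute)
  show "(sn L k has_real_derivative (real k * pi / L) * cs L k x) (at x)"
    using DERIV_chain2[OF DERIV_sin d] by (simp add: sn_def[abs_def] cs_def mult.commute)
qed

lemma sn_ends: "sn L k 0 = 0" "L \<noteq> 0 \<Longrightarrow> sn L k L = 0"
  by (simp_all add: sn_def)

lemmas cs_cont = smooth_continuous[OF smooth_cs] and sn_cont = smooth_continuous[OF smooth_sn]

lemma integral_cs:
  assumes "L > 0"
  shows "integral {0..L} (cs L k) = (if k = 0 then L else 0)"
proof (cases "k = 0")
  case True
  then have "cs L k = (\<lambda>_. 1)" by (simp add: cs_def fun_eq_iff)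
  then show ?thesis using True assms by simp
next
  case False
  let ?a = "real k * pi / L"
  have "?a \<noteq> 0" using False assms by simp
  have "(cs L k has_integral sn L k L / ?a - sn L k 0 / ?a) {0..L}"
  proof (rule fundamental_theorem_of_calculus)
    show "((\<lambda>x. sn L k x / ?a) has_vector_derivative cs L k x) (at x within {0..L})" for x
      using DERIV_cdivide[OF DERIV_sn[of L k x], of ?a] \<open>?a \<noteq> 0\<close>
      by (simp add: has_real_derivative_iff_has_vector_derivative has_vector_derivative_at_within)
  qed (use assms in simp)
  then show ?thesis using False assms sn_ends[of L k] by (simp add: integral_unique)
qed

text \<open>In truncated subtraction \<open>(j - k) + (k - j)\<close> is the absolute difference of
  \<open>j\<close> and \<open>k\<close>, so the product formulas stay within natural
  indices.\<close>

lemma cs_mult: "cs L j x * cs L k x = (cs L (j + k) x + cs L ((j - k) + (k - j)) x) / 2"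
  and sn_mult: "sn L j x * sn L k x = (cs L ((j - k) + (k - j)) x - cs L (j + k) x) / 2"
proof -
  let ?a = "real j * pi / L * x" and ?b = "real k * pi / L * x"
  have "cs L ((j - k) + (k - j)) x = cos (?a - ?b)"
  proof (cases "j \<ge> k")
    case True
    then show ?thesis by (simp add: cs_def of_nat_diff algebra_simps diff_divide_distrib)
  next
    case False
    then have "cs L ((j - k) + (k - j)) x = cos (?b - ?a)"
      by (simp add: cs_def of_nat_diff algebra_simps diff_divide_distrib)
    then show ?thesis by (metis cos_minus minus_diff_eq)
  qed
  moreover have "cs L (j + k) x = cos (?a + ?b)" by (simp add: cs_def algebra_simps add_divide_distrib)
  ultimately show "cs L j x * cs L k x = (cs L (j + k) x + cs L ((j - k) + (k - j)) x) / 2"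
    "sn L j x * sn L k x = (cs L ((j - k) + (k - j)) x - cs L (j + k) x) / 2"
    by (simp_all add: cos_add cos_diff) (simp_all add: cs_def sn_def)
qed

text \<open>The squared norm of \<open>cs L k\<close> on \<open>{0..L}\<close>, and of
  \<open>sn L k\<close> for \<open>k > 0\<close>.\<close>

definition nrm :: "real \<Rightarrow> nat \<Rightarrow> real" where "nrm L k = (if k = 0 then L else L / 2)"

lemma cs_integrable: "cs L k integrable_on {0..b}"
  by (rule integrable_continuous_real) (use cs_cont continuous_on_subset in blast)

lemma integral_cs_cs:
  assumes "L > 0"
  shows "integral {0..L} (\<lambda>x. cs L j x * cs L k x) = (if j = k then nrm L k else 0)"
proof -
  have "integral {0..L} (\<lambda>x. cs L j x * cs L k x) = (integral {0..L} (cs L (j + k)) + integral {0..L} (cs L ((j - k) + (k - j)))) / 2"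
    unfolding cs_mult by (simp add: Henstock_Kurzweil_Integration.integral_add cs_integrable)
  moreover have "((j - k) + (k - j) = 0) = (j = k)" by auto
  ultimately show ?thesis unfolding integral_cs[OF assms] by (auto simp: nrm_def simp del: add_is_0)
qed

lemma integral_sn_sn:
  assumes "L > 0" "k > 0"
  shows "integral {0..L} (\<lambda>x. sn L j x * sn L k x) = (if j = k then nrm L k else 0)"
proof -
  have "integral {0..L} (\<lambda>x. sn L j x * sn L k x) = (integral {0..L} (cs L ((j - k) + (k - j))) - integral {0..L} (cs L (j + k))) / 2"
    unfolding sn_mult by (simp add: Henstock_Kurzweil_Integration.integral_diff cs_integrable)
  moreover have "((j - k) + (k - j) = 0) = (j = k)" by auto
  ultimately show ?thesis unfolding integral_cs[OF assms(1)] using assms by (auto simp: nrm_def simp del: add_is_0)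
qed

section \<open>Completeness of the cosines\<close>

lemma square_add_le: "((a::real) + b)\<^sup>2 \<le> 2 * a\<^sup>2 + 2 * b\<^sup>2"
  using sum_squares_bound[of a b] by (simp add: power2_sum)

context strip
begin

section \<open>The orthogonal system of the strip\<close>

definition e :: "nat \<times> nat \<Rightarrow> real \<times> real \<Rightarrow> real" where
  "e i = V (cs l (fst i)) (cs d (snd i))"

text \<open>The squared norm of \<open>e i\<close>; the functions themselves stay unnormalised to
  keep the product formulas simple.\<close>

definition nu :: "nat \<times> nat \<Rightarrow> real" where
  "nu i = nrm l (fst i) * nrm d (snd i)"

lemma nu_pos: "nu i > 0"
  using l d by (simp add: nu_def nrm_def)

lemma nu_le: "nu i \<le> l * d"
  unfolding nu_def using l d by (intro mult_mono) (auto simp: nrm_def)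

lemma e_cont: "continuous_on UNIV (e i)"
  unfolding e_def by (intro V_cont cs_cont)

lemma e_L2: "e i \<in> L2 M"
  by (rule cont_L2[OF e_cont])

lemma e_orth: "ip M (e i) (e j) = (if i = j then nu i else 0)"
proof -
  have "ip M (e i) (e j) = integral {0..l} (\<lambda>x. cs l (fst i) x * cs l (fst j) x) * integral {0..d} (\<lambda>x. cs d (snd i) x * cs d (snd j) x)"
    unfolding e_def V_mult by (rule integral_V) (intro continuous_on_mult cs_cont)+
  then show ?thesis unfolding integral_cs_cs[OF l] integral_cs_cs[OF d]
    by (auto simp: nu_def prod_eq_iff)
qed

lemma V_sin_orth:
  assumes "k > 0" "k' > 0"
  shows "ip M (V (sn l k) (cs d m)) (V (sn l k') (cs d m')) = (if (k, m) = (k', m') then nu (k, m) else 0)"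
    and "ip M (V (cs l m) (sn d k)) (V (cs l m') (sn d k')) = (if (m, k) = (m', k') then nu (m, k) else 0)"
proof -
  have "ip M (V (sn l k) (cs d m)) (V (sn l k') (cs d m')) = integral {0..l} (\<lambda>x. sn l k x * sn l k' x) * integral {0..d} (\<lambda>x. cs d m x * cs d m' x)"
    unfolding V_mult by (rule integral_V) (intro continuous_on_mult cs_cont sn_cont)+
  then show "ip M (V (sn l k) (cs d m)) (V (sn l k') (cs d m')) = (if (k, m) = (k', m') then nu (k, m) else 0)"
    unfolding integral_cs_cs[OF d] integral_sn_sn[OF l assms(2)] by (auto simp: nu_def)
  have "ip M (V (cs l m) (sn d k)) (V (cs l m') (sn d k')) = integral {0..l} (\<lambda>x. cs l m x * cs l m' x) * integral {0..d} (\<lambda>x. sn d k x * sn d k' x)"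
    unfolding V_mult by (rule integral_V) (intro continuous_on_mult cs_cont sn_cont)+
  then show "ip M (V (cs l m) (sn d k)) (V (cs l m') (sn d k')) = (if (m, k) = (m', k') then nu (m, k) else 0)"
    unfolding integral_cs_cs[OF l] integral_sn_sn[OF d assms(2)] by (auto simp: nu_def)
qed

text \<open>The linear span of the system. The product formulas for cosines make it an algebra, and
  as an inductive set it lends itself to that proof.\<close>

inductive_set trig :: "(real \<times> real \<Rightarrow> real) set" where
  base: "e i \<in> trig"
| scale: "f \<in> trig \<Longrightarrow> (\<lambda>z. c * f z) \<in> trig"
| add: "f \<in> trig \<Longrightarrow> h \<in> trig \<Longrightarrow> (\<lambda>z. f z + h z) \<in> trig"

lemma trig_cont: "f \<in> trig \<Longrightarrow> continuous_on UNIV f"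
  by (induction rule: trig.induct) (auto intro: e_cont continuous_on_mult continuous_on_const continuous_on_add)

lemma trig_form:
  assumes "f \<in> trig"
  shows "\<exists>F c. finite F \<and> f = (\<lambda>z. \<Sum>i\<in>F. c i * e i z)"
  using assms
proof (induction rule: trig.induct)
  case (base i)
  show ?case by (intro exI[of _ "{i}"] exI[of _ "\<lambda>_. 1"]) simp
next
  case (scale f c)
  then obtain F c' where "finite F" "f = (\<lambda>z. \<Sum>i\<in>F. c' i * e i z)" by blast
  then show ?case by (intro exI[of _ F] exI[of _ "\<lambda>i. c * c' i"]) (simp add: sum_distrib_left mult.assoc)
next
  case (add f h)
  then obtain F a H b where F: "finite F" "f = (\<lambda>z. \<Sum>i\<in>F. a i * e i z)"
    and H: "finite H" "h = (\<lambda>z. \<Sum>i\<in>H. b i * e i z)" by blast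
  have 1: "(\<Sum>i\<in>F. a i * e i z) = (\<Sum>i\<in>F \<union> H. (if i \<in> F then a i else 0) * e i z)"
    and 2: "(\<Sum>i\<in>H. b i * e i z) = (\<Sum>i\<in>F \<union> H. (if i \<in> H then b i else 0) * e i z)" for z
    using F(1) H(1) by (auto intro!: sum.mono_neutral_cong_left)
  have "(\<lambda>z. f z + h z) = (\<lambda>z. \<Sum>i\<in>F \<union> H. ((if i \<in> F then a i else 0) + (if i \<in> H then b i else 0)) * e i z)"
    (is "_ = ?rhs") unfolding F(2) H(2) 1 2 by (simp add: sum.distrib distrib_right)
  then have "finite (F \<union> H) \<and> (\<lambda>z. f z + h z) = ?rhs" using F(1) H(1) by simp
  then show ?case by (intro exI)
qed

lemma trig_mult_base: "(\<lambda>z. e i z * e j z) \<in> trig"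
proof -
  define D where "D a b = (a - b) + (b - a)" for a b :: nat
  have "e i z * e j z = 1/4 * e (fst i + fst j, snd i + snd j) z + 1/4 * e (fst i + fst j, D (snd i) (snd j)) z
      + (1/4 * e (D (fst i) (fst j), snd i + snd j) z + 1/4 * e (D (fst i) (fst j), D (snd i) (snd j)) z)" for z
  proof -
    have "e i z * e j z = (cs l (fst i) (fst z) * cs l (fst j) (fst z)) * (cs d (snd i) (snd z - g (fst z)) * cs d (snd j) (snd z - g (fst z)))"
      by (simp add: e_def V_def)
    also have "\<dots> = ((cs l (fst i + fst j) (fst z) + cs l (D (fst i) (fst j)) (fst z)) / 2)
       * ((cs d (snd i + snd j) (snd z - g (fst z)) + cs d (D (snd i) (snd j)) (snd z - g (fst z))) / 2)"
      by (simp only: cs_mult D_def)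
    finally show ?thesis by (simp add: e_def V_def algebra_simps add_divide_distrib)
  qed
  then show ?thesis by (simp only:) (intro trig.intros)
qed

lemma trig_mult:
  assumes "f \<in> trig" "h \<in> trig"
  shows "(\<lambda>z. f z * h z) \<in> trig"
  using assms(1)
proof (induction rule: trig.induct)
  case (base i)
  show ?case using assms(2)
  proof (induction rule: trig.induct)
    case (base j)
    show ?case by (rule trig_mult_base)
  next
    case (scale f c)
    from trig.scale[OF scale.IH, of c] show ?case by (simp add: mult_ac)
  next
    case (add f h)
    from trig.add[OF add.IH] show ?case by (simp add: distrib_left)
  qed
next
  case (scale f c)
  from trig.scale[OF scale.IH, of c] show ?case by (simp add: mult_ac)
next
  case (add f h)
  from trig.add[OF add.IH] show ?case by (simp add: distrib_right)
qed

lemma trig_const: "(\<lambda>_. c) \<in> trig"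
proof -
  have "(\<lambda>z. c * e (0, 0) z) \<in> trig" by (intro trig.intros)
  then show ?thesis by (simp add: e_def V_def cs_def)
qed

lemma cos_inj_interval:
  assumes "L > 0" "0 \<le> x" "x \<le> L" "0 \<le> y" "y \<le> L" "cs L 1 x = cs L 1 y"
  shows "x = y"
proof -
  have "pi / L * x \<le> pi" "pi / L * y \<le> pi" using assms by (simp_all add: field_simps)
  moreover have "0 \<le> pi / L * x" "0 \<le> pi / L * y" using assms by simp_all
  moreover have "cos (pi / L * x) = cos (pi / L * y)" using assms(6) by (simp add: cs_def)
  ultimately have "pi / L * x = pi / L * y" by - (rule cos_inj_pi)
  then show ?thesis using assms(1) by simp
qed

text \<open>The cosine is injective on half a period, so \<open>e (1, 0)\<close> determines
  \<open>x\<close> and \<open>e (0, 1)\<close> determines \<open>y - g x\<close>: the algebra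
  separates the points of the closed strip.\<close>

lemma trig_uniform_dense:
  assumes F: "continuous_on UNIV F" and \<eta>: "\<eta> > 0"
  obtains s where "s \<in> trig" "\<And>z. z \<in> K \<Longrightarrow> \<bar>F z - s z\<bar> < \<eta>"
proof -
  interpret function_ring_on trig K
  proof
    fix x y assume x: "x \<in> K" and y: "y \<in> K" and "x \<noteq> y"
    show "\<exists>f\<in>trig. f x \<noteq> f y"
    proof (cases "fst x = fst y")
      case False
      have "cs l 1 (fst x) \<noteq> cs l 1 (fst y)"
        using cos_inj_interval[of l "fst x" "fst y"] False x y l by (auto simp: K_def)
      then show ?thesis by (intro bexI[OF _ trig.base[of "(1, 0)"]]) (simp add: e_def V_def cs_def)
    next
      case True
      then have "snd x \<noteq> snd y" using \<open>x \<noteq> y\<close> by (simp add: prod_eq_iff)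
      then have "cs d 1 (snd x - g (fst x)) \<noteq> cs d 1 (snd y - g (fst y))"
        using cos_inj_interval[of d "snd x - g (fst x)" "snd y - g (fst y)"] True x y d by (auto simp: K_def)
      then show ?thesis by (intro bexI[OF _ trig.base[of "(0, 1)"]]) (simp add: e_def V_def cs_def)
    qed
  next
    show "continuous_on K f" if "f \<in> trig" for f
      using trig_cont[OF that] by (rule continuous_on_subset) simp
  qed (simp_all add: compact_K trig.add trig_mult trig_const)
  have "continuous_on K F" using F by (rule continuous_on_subset) simp
  from Stone_Weierstrass_basic[OF this \<eta>] show ?thesis using that by blast
qed

text \<open>Truncation makes the approximation of a measurable function by continuous ones, which is
  only pointwise almost everywhere, an approximation in the mean.\<close>

lemma continuous_dense_L2:
  assumes w: "w \<in> L2 M" and \<epsilon>: "\<epsilon> > 0"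
  obtains F where "continuous_on UNIV F" "(LINT z|M. (w z - F z)\<^sup>2) < \<epsilon>"
proof -
  interpret finite_measure M by (rule finite_M)
  have [measurable]: "w \<in> borel_measurable M" using w by (rule L2_D)
  define cl where "cl T v = max (- T) (min T v)" for T v :: real
  have clc: "continuous_on UNIV (cl T)" for T unfolding cl_def[abs_def] by (intro continuous_intros)
  have [measurable]: "cl T \<in> borel_measurable borel" for T by (rule borel_measurable_continuous_onI[OF clc])
  have "(\<lambda>n. LINT z|M. (w z - cl (real n) (w z))\<^sup>2) \<longlonglongrightarrow> (LINT z|M. 0)"
  proof (rule integral_dominated_convergence[where w="\<lambda>z. (w z)\<^sup>2"])
    show "integrable M (\<lambda>z. (w z)\<^sup>2)" using w by (rule L2_D)
    show "AE z in M. (\<lambda>n. (w z - cl (real n) (w z))\<^sup>2) \<longlonglongrightarrow> 0"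
    proof (rule AE_I2)
      fix z
      obtain N where N: "\<bar>w z\<bar> \<le> real N" using real_arch_simple by blast
      have "\<forall>\<^sub>F n in sequentially. 0 = (w z - cl (real n) (w z))\<^sup>2"
        using eventually_ge_at_top[of N]
      proof eventually_elim
        case (elim n)
        then have "\<bar>w z\<bar> \<le> real n" using N by linarith
        then show ?case by (simp add: cl_def min_def max_def abs_le_iff)
      qed
      then show "(\<lambda>n. (w z - cl (real n) (w z))\<^sup>2) \<longlonglongrightarrow> 0" by (rule Lim_transform_eventually[OF tendsto_const])
    qed
    show "AE z in M. norm ((w z - cl (real n) (w z))\<^sup>2) \<le> (w z)\<^sup>2" for n
    proof (rule AE_I2)
      fix z
      have "\<bar>w z - cl (real n) (w z)\<bar> \<le> \<bar>w z\<bar>" by (auto simp: cl_def min_def max_def abs_if)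
      then show "norm ((w z - cl (real n) (w z))\<^sup>2) \<le> (w z)\<^sup>2" by (simp add: abs_le_square_iff)
    qed
  qed measurable
  then have "\<forall>\<^sub>F n in sequentially. (LINT z|M. (w z - cl (real n) (w z))\<^sup>2) < \<epsilon> / 4"
    using \<epsilon> by (intro order_tendstoD) auto
  then obtain n where n: "(LINT z|M. (w z - cl (real n) (w z))\<^sup>2) < \<epsilon> / 4"
    by (auto simp: eventually_sequentially)
  have "(\<lambda>z. if z \<in> \<Omega> then w z else 0) \<in> borel_measurable lebesgue"
    using w by (subst borel_measurable_if) (auto simp: L2_def)
  \<comment> \<open>\<open>measurable_on\<close> supplies continuous functions that converge to the
    zero extension off a negligible set.\<close>
  then have "(\<lambda>z. if z \<in> \<Omega> then w z else 0) measurable_on UNIV"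
    by (rule lebesgue_measurable_imp_measurable_on_real) simp
  then obtain N h where N: "negligible N" and h: "\<And>j. continuous_on UNIV (h j)"
    "\<And>z. z \<notin> N \<Longrightarrow> (\<lambda>j. h j z) \<longlonglongrightarrow> (if z \<in> \<Omega> then w z else 0)"
    unfolding measurable_on_def by auto
  have hc: "continuous_on UNIV (\<lambda>z. cl (real n) (h j z))" for j
    by (rule continuous_on_compose2[OF clc h(1)]) simp
  have [measurable]: "(\<lambda>z. cl (real n) (h j z)) \<in> borel_measurable M" for j by (rule cont_measurable[OF hc])
  have cb: "\<bar>cl (real n) v\<bar> \<le> real n" for v by (auto simp: cl_def)
  have "(\<lambda>j. LINT z|M. (cl (real n) (w z) - cl (real n) (h j z))\<^sup>2) \<longlonglongrightarrow> (LINT z|M. 0)"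
  proof (rule integral_dominated_convergence[where w="\<lambda>z. (2 * real n)\<^sup>2"])
    show "AE z in M. norm ((cl (real n) (w z) - cl (real n) (h j z))\<^sup>2) \<le> (2 * real n)\<^sup>2" for j
    proof (rule AE_I2)
      fix z
      have "\<bar>cl (real n) (w z) - cl (real n) (h j z)\<bar> \<le> \<bar>2 * real n\<bar>" using cb[of "w z"] cb[of "h j z"] by linarith
      then show "norm ((cl (real n) (w z) - cl (real n) (h j z))\<^sup>2) \<le> (2 * real n)\<^sup>2"
        by (simp only: abs_le_square_iff real_norm_def abs_power2)
    qed
    have "AE z in lebesgue. z \<notin> N" using N by (simp add: negligible_iff_null_sets AE_not_in)
    then have "AE z in M. z \<notin> N" by (auto simp: AE_restrict_space_iff elim!: eventually_mono)
    then show "AE z in M. (\<lambda>j. (cl (real n) (w z) - cl (real n) (h j z))\<^sup>2) \<longlonglongrightarrow> 0"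
    proof (rule AE_mp, intro AE_I2 impI)
      fix z assume z: "z \<in> space M" "z \<notin> N"
      then have "(\<lambda>j. h j z) \<longlonglongrightarrow> w z" using h(2)[of z] by simp
      then have "(\<lambda>j. cl (real n) (h j z)) \<longlonglongrightarrow> cl (real n) (w z)"
        using clc by (intro isCont_tendsto_compose[where g="cl (real n)"]) (auto simp: continuous_on_eq_continuous_at)
      then have "(\<lambda>j. (cl (real n) (w z) - cl (real n) (h j z))\<^sup>2) \<longlonglongrightarrow> (cl (real n) (w z) - cl (real n) (w z))\<^sup>2"
        by (intro tendsto_intros)
      then show "(\<lambda>j. (cl (real n) (w z) - cl (real n) (h j z))\<^sup>2) \<longlonglongrightarrow> 0" by simp
    qed
  qed measurable
  then have "\<forall>\<^sub>F j in sequentially. (LINT z|M. (cl (real n) (w z) - cl (real n) (h j z))\<^sup>2) < \<epsilon> / 4"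
    using \<epsilon> by (intro order_tendstoD) auto
  then obtain j where j: "(LINT z|M. (cl (real n) (w z) - cl (real n) (h j z))\<^sup>2) < \<epsilon> / 4"
    by (auto simp: eventually_sequentially)
  have clL2: "(\<lambda>z. cl (real n) (w z)) \<in> L2 M"
    by (rule L2_bounded[OF finite_M, of _ "real n"]) (use cb in auto)
  have i1: "integrable M (\<lambda>z. (w z - cl (real n) (w z))\<^sup>2)" by (rule L2_D[OF L2_diff[OF w clL2]])
  have i2: "integrable M (\<lambda>z. (cl (real n) (w z) - cl (real n) (h j z))\<^sup>2)" by (rule L2_D[OF L2_diff[OF clL2 cont_L2[OF hc]]])
  have "(LINT z|M. (w z - cl (real n) (h j z))\<^sup>2) \<le> (LINT z|M. 2 * (w z - cl (real n) (w z))\<^sup>2 + 2 * (cl (real n) (w z) - cl (real n) (h j z))\<^sup>2)"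
  proof (rule integral_mono)
    show "integrable M (\<lambda>z. (w z - cl (real n) (h j z))\<^sup>2)" by (rule L2_D[OF L2_diff[OF w cont_L2[OF hc]]])
    show "(w z - cl (real n) (h j z))\<^sup>2 \<le> 2 * (w z - cl (real n) (w z))\<^sup>2 + 2 * (cl (real n) (w z) - cl (real n) (h j z))\<^sup>2" for z
      using square_add_le[of "w z - cl (real n) (w z)" "cl (real n) (w z) - cl (real n) (h j z)"] by simp
  qed (use i1 i2 in simp)
  also have "\<dots> = 2 * (LINT z|M. (w z - cl (real n) (w z))\<^sup>2) + 2 * (LINT z|M. (cl (real n) (w z) - cl (real n) (h j z))\<^sup>2)"
    using i1 i2 by simp
  also have "\<dots> < \<epsilon>" using n j by simp
  finally show ?thesis by (rule that[OF hc])
qed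

lemma trig_dense_L2:
  assumes w: "w \<in> L2 M" and \<epsilon>: "\<epsilon> > 0"
  obtains s where "s \<in> trig" "(LINT z|M. (w z - s z)\<^sup>2) < \<epsilon>"
proof -
  interpret finite_measure M by (rule finite_M)
  have "\<epsilon> / 4 > 0" using \<epsilon> by simp
  obtain F where F: "continuous_on UNIV F" "(LINT z|M. (w z - F z)\<^sup>2) < \<epsilon> / 4"
    using continuous_dense_L2[OF w \<open>\<epsilon> / 4 > 0\<close>] by blast
  define m where "m = measure M \<Omega>"
  \<comment> \<open>Chosen so that a uniform error \<eta> costs at most
    \<open>\<epsilon> / 4\<close> in the mean; \<open>m + 1\<close> keeps the quotient defined if
    \<open>m = 0\<close>.\<close>
  define \<eta> where "\<eta> = sqrt (\<epsilon> / (4 * (m + 1)))"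
  have m: "m \<ge> 0" by (simp add: m_def)
  have \<eta>: "\<eta> > 0" "\<eta>\<^sup>2 * m \<le> \<epsilon> / 4"
    using \<epsilon> m by (auto simp: \<eta>_def field_simps)
  obtain s where s: "s \<in> trig" "\<And>z. z \<in> K \<Longrightarrow> \<bar>F z - s z\<bar> < \<eta>" using trig_uniform_dense[OF F(1) \<eta>(1)] by blast
  note FL = cont_L2[OF F(1)] and sL = cont_L2[OF trig_cont[OF s(1)]]
  have i1: "integrable M (\<lambda>z. (w z - F z)\<^sup>2)" by (rule L2_D[OF L2_diff[OF w FL]])
  have i2: "integrable M (\<lambda>z. (w z - s z)\<^sup>2)" by (rule L2_D[OF L2_diff[OF w sL]])
  have "(LINT z|M. (w z - s z)\<^sup>2) \<le> (LINT z|M. 2 * (w z - F z)\<^sup>2 + 2 * \<eta>\<^sup>2)"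
  proof (rule integral_mono)
    fix z assume "z \<in> space M"
    then have "z \<in> K" using \<Omega>_K by (auto simp only: space_M)
    then have "\<bar>F z - s z\<bar> < \<eta>" by (rule s(2))
    then have "(F z - s z)\<^sup>2 \<le> \<eta>\<^sup>2" using \<eta>(1) by (intro power2_le_iff_abs_le[THEN iffD2]) auto
    then show "(w z - s z)\<^sup>2 \<le> 2 * (w z - F z)\<^sup>2 + 2 * \<eta>\<^sup>2"
      using square_add_le[of "w z - F z" "F z - s z"] by simp
  qed (use i1 i2 in auto)
  also have "\<dots> = 2 * (LINT z|M. (w z - F z)\<^sup>2) + 2 * (\<eta>\<^sup>2 * m)" using i1 by (simp add: m_def)
  also have "\<dots> < \<epsilon>" using F(2) \<eta>(2) by simp
  finally show ?thesis by (rule that[OF s(1)])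
qed

text \<open>A finite Fourier sum over the indices of an approximating trigonometric sum approximates
  \<open>w\<close> at least as well as that sum does.\<close>

lemma Parseval_lower:
  assumes w: "w \<in> L2 M" and \<epsilon>: "\<epsilon> > 0"
  obtains F where "finite F" "ip M w w - \<epsilon> < (\<Sum>i\<in>F. (ip M w (e i))\<^sup>2 / nu i)"
proof -
  obtain s where s: "s \<in> trig" "(LINT z|M. (w z - s z)\<^sup>2) < \<epsilon>" using trig_dense_L2[OF w \<epsilon>] by blast
  obtain F c where F: "finite F" "s = (\<lambda>z. \<Sum>i\<in>F. c i * e i z)" using trig_form[OF s(1)] by blast
  have "ip M w w - (\<Sum>i\<in>F. (ip M w (e i))\<^sup>2 / nu i) \<le> (LINT z|M. (w z - s z)\<^sup>2)"
    unfolding F(2) by (rule orthogonal_expansion(1)[OF F(1) w]) (auto simp: e_L2 e_orth nu_pos)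
  with s(2) show ?thesis by (intro that[OF F(1)]) linarith
qed

lemma cosine_complete:
  assumes w: "w \<in> L2 M" and 0: "\<And>i. ip M w (e i) = 0"
  shows "AE z in M. w z = 0"
proof (rule ip_eq_0_AE[OF w])
  have "ip M w w \<le> 0"
  proof (rule field_le_epsilon)
    fix \<epsilon> :: real assume "\<epsilon> > 0"
    show "ip M w w \<le> 0 + \<epsilon>"
      by (rule Parseval_lower[OF w \<open>\<epsilon> > 0\<close>]) (simp add: 0)
  qed
  moreover have "0 \<le> ip M w w" by (rule Bochner_Integration.integral_nonneg) simp
  ultimately show "ip M w w = 0" by linarith
qed

end

section \<open>Compactness of the embedding of \<open>H\<^sup>1\<close>\<close>

context strip
begin

section \<open>Linearity and uniqueness of weak gradients\<close>

lemma test_function_cont: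
  assumes "\<phi> \<in> test_functions \<Omega>"
  shows "continuous_on UNIV \<phi>" "b \<in> Basis \<Longrightarrow> continuous_on UNIV (partial_deriv b \<phi>)"
proof -
  have "Ck (Suc 0) \<phi>" using assms unfolding test_functions_def by blast
  then show "continuous_on UNIV \<phi>" "b \<in> Basis \<Longrightarrow> continuous_on UNIV (partial_deriv b \<phi>)"
    using Ck_continuous[of "Suc 0" \<phi>] by simp_all
qed

lemma ip_lincomb:
  assumes "u \<in> L2 M" "v \<in> L2 M" "\<psi> \<in> L2 M"
  shows "ip M (\<lambda>z. a * u z + b * v z) \<psi> = a * ip M u \<psi> + b * ip M v \<psi>"
proof -
  have "ip M (\<lambda>z. a * u z + b * v z) \<psi> = (LINT z|M. a * (u z * \<psi> z) + b * (v z * \<psi> z))"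
    by (simp add: distrib_right mult.assoc)
  also have "\<dots> = a * ip M u \<psi> + b * ip M v \<psi>"
    using L2_mult_integrable[OF assms(1,3)] L2_mult_integrable[OF assms(2,3)] by simp
  finally show ?thesis .
qed

lemma L2_lincomb: "u \<in> L2 M \<Longrightarrow> v \<in> L2 M \<Longrightarrow> (\<lambda>z. a * u z + b * v z) \<in> L2 M"
  by (intro L2_add L2_scale)

lemma weak_gradient_lincomb:
  assumes u: "has_weak_gradient \<Omega> u G" and v: "has_weak_gradient \<Omega> v H"
  shows "has_weak_gradient \<Omega> (\<lambda>z. a * u z + b * v z) (\<lambda>z. (a * fst (G z) + b * fst (H z), a * snd (G z) + b * snd (H z)))"
proof -
  note U = u[unfolded has_weak_gradient_iff] and W = v[unfolded has_weak_gradient_iff]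
  show ?thesis unfolding has_weak_gradient_iff fst_conv snd_conv
  proof (intro conjI ballI L2_lincomb)
    fix \<phi> assume \<phi>: "\<phi> \<in> test_functions \<Omega>"
    have L: "\<phi> \<in> L2 M" "partial_deriv (1, 0) \<phi> \<in> L2 M" "partial_deriv (0, 1) \<phi> \<in> L2 M"
      using test_function_cont[OF \<phi>] by (auto intro!: cont_L2 simp: Basis_prod_def)
    show "ip M (\<lambda>z. a * u z + b * v z) (partial_deriv (1, 0) \<phi>) = - ip M (\<lambda>z. a * fst (G z) + b * fst (H z)) \<phi>"
      using U W \<phi> L by (simp add: ip_lincomb)
    show "ip M (\<lambda>z. a * u z + b * v z) (partial_deriv (0, 1) \<phi>) = - ip M (\<lambda>z. a * snd (G z) + b * snd (H z)) \<phi>"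
      using U W \<phi> L by (simp add: ip_lincomb)
  qed (use U W in auto)
qed

text \<open>The difference is a weak gradient of 0, so its vertical component and its derivative
  along \<open>(1, g')\<close> are orthogonal to a complete system; these two determine the
  vector.\<close>

lemma weak_gradient_unique:
  assumes u: "has_weak_gradient \<Omega> u G" and v: "has_weak_gradient \<Omega> u H"
  shows "AE z in M. G z = H z"
proof -
  define D where "D z = (1 * fst (G z) + (- 1) * fst (H z), 1 * snd (G z) + (- 1) * snd (H z))" for z
  have D: "has_weak_gradient \<Omega> (\<lambda>_. 0) D"
    using weak_gradient_lincomb[OF u v, of 1 "-1"] by (simp add: D_def[abs_def])
  then have L2: "(\<lambda>z. fst (D z)) \<in> L2 M" "(\<lambda>z. snd (D z)) \<in> L2 M" by (auto simp: has_weak_gradient_iff)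
  have "AE z in M. snd (D z) = 0"
    by (rule cosine_complete[OF L2(2)]) (simp only: e_def weak_gradient_zero[OF D smooth_cs smooth_cs])
  moreover have "AE z in M. shear_grad D z = 0"
    by (rule cosine_complete[OF shear_grad_L2[OF L2]]) (simp only: e_def weak_gradient_zero[OF D smooth_cs smooth_cs])
  ultimately show ?thesis
    by eventually_elim (simp add: shear_grad_def D_def prod_eq_iff)
qed

lemma H1_weak_gradient: "u \<in> H1 \<Omega> \<Longrightarrow> has_weak_gradient \<Omega> u (weak_gradient \<Omega> u)"
  using someI_ex[of "has_weak_gradient \<Omega> u"] by (simp add: H1_def weak_gradient_def)

lemma H1_gradient_L2:
  "u \<in> H1 \<Omega> \<Longrightarrow> (\<lambda>z. fst (weak_gradient \<Omega> u z)) \<in> L2 M"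
  "u \<in> H1 \<Omega> \<Longrightarrow> (\<lambda>z. snd (weak_gradient \<Omega> u z)) \<in> L2 M"
  using H1_weak_gradient by (auto simp: has_weak_gradient_iff)

text \<open>Frees the form from the arbitrary choice inside \<open>weak_gradient\<close>: explicit
  gradients may be inserted from here on.\<close>

lemma dirichlet_form_eq:
  assumes u: "has_weak_gradient \<Omega> u G" and v: "has_weak_gradient \<Omega> v H"
  shows "dirichlet_form \<Omega> u v = ip M (\<lambda>z. fst (G z)) (\<lambda>z. fst (H z)) + ip M (\<lambda>z. snd (G z)) (\<lambda>z. snd (H z))"
proof -
  have H1: "u \<in> H1 \<Omega>" "v \<in> H1 \<Omega>" using u v by (auto simp: H1_def)
  note wu = H1_weak_gradient[OF H1(1)] and wv = H1_weak_gradient[OF H1(2)]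
  note L = u[unfolded has_weak_gradient_iff] v[unfolded has_weak_gradient_iff]
    wu[unfolded has_weak_gradient_iff] wv[unfolded has_weak_gradient_iff]
  have "dirichlet_form \<Omega> u v = (LINT z|M. fst (weak_gradient \<Omega> u z) * fst (weak_gradient \<Omega> v z) + snd (weak_gradient \<Omega> u z) * snd (weak_gradient \<Omega> v z))"
    by (simp add: dirichlet_form_def inner_prod_def)
  also have "\<dots> = (LINT z|M. fst (G z) * fst (H z) + snd (G z) * snd (H z))"
  proof (rule integral_cong_AE)
    show "AE z in M. fst (weak_gradient \<Omega> u z) * fst (weak_gradient \<Omega> v z) + snd (weak_gradient \<Omega> u z) * snd (weak_gradient \<Omega> v z)
        = fst (G z) * fst (H z) + snd (G z) * snd (H z)"
      using weak_gradient_unique[OF wu u] weak_gradient_unique[OF wv v] by eventually_elim simp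
  qed (use L in \<open>auto simp: L2_def\<close>)
  also have "\<dots> = ip M (\<lambda>z. fst (G z)) (\<lambda>z. fst (H z)) + ip M (\<lambda>z. snd (G z)) (\<lambda>z. snd (H z))"
    by (rule Bochner_Integration.integral_add) (use L in \<open>auto intro!: L2_mult_integrable\<close>)
  finally show ?thesis .
qed

lemma H1_L2: "u \<in> H1 \<Omega> \<Longrightarrow> u \<in> L2 M"
  using H1_weak_gradient by (auto simp: has_weak_gradient_iff)

lemma H1_lincomb: "u \<in> H1 \<Omega> \<Longrightarrow> v \<in> H1 \<Omega> \<Longrightarrow> (\<lambda>z. a * u z + b * v z) \<in> H1 \<Omega>"
  unfolding H1_def using weak_gradient_lincomb by blast

lemma dirichlet_form_lincomb:
  assumes "u \<in> H1 \<Omega>" "v \<in> H1 \<Omega>" "w \<in> H1 \<Omega>"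
  shows "dirichlet_form \<Omega> (\<lambda>z. a * u z + b * v z) w = a * dirichlet_form \<Omega> u w + b * dirichlet_form \<Omega> v w"
proof -
  note w = assms[THEN H1_weak_gradient]
  note x = assms[THEN H1_gradient_L2(1)] and y = assms[THEN H1_gradient_L2(2)]
  show ?thesis
    unfolding dirichlet_form_eq[OF weak_gradient_lincomb[OF w(1,2)] w(3)] dirichlet_form_eq[OF w(1,3)] dirichlet_form_eq[OF w(2,3)]
      fst_conv snd_conv ip_lincomb[OF x] ip_lincomb[OF y]
    by (simp only: distrib_left add_ac)
qed

section \<open>Fourier coefficients of weak derivatives\<close>

lemma coefficient_x:
  assumes u: "has_weak_gradient \<Omega> u G"
  shows "(real k * pi / l) * ip M u (e (k, m)) = - ip M (shear_grad G) (V (sn l k) (cs d m))"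
proof -
  have "(real k * pi / l) * ip M u (e (k, m)) = ip M u (V (\<lambda>x. (real k * pi / l) * cs l k x) (cs d m))"
    by (simp add: e_def V_def mult_ac)
  \<comment> \<open>The cosine with its factor is the derivative of the sine, which vanishes at both
    ends.\<close>
  also have "\<dots> = - ip M (shear_grad G) (V (sn l k) (cs d m))"
    by (rule weak_gradient_x[OF u smooth_sn sn_ends(1) sn_ends(2) DERIV_sn smooth_cs]) (use l in simp)
  finally show ?thesis .
qed

lemma coefficient_y:
  assumes u: "has_weak_gradient \<Omega> u G"
  shows "(real m * pi / d) * ip M u (e (k, m)) = - ip M (\<lambda>z. snd (G z)) (V (cs l k) (sn d m))"
proof -
  have "(real m * pi / d) * ip M u (e (k, m)) = ip M u (V (cs l k) (\<lambda>x. (real m * pi / d) * cs d m x))"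
    by (simp add: e_def V_def mult_ac)
  also have "\<dots> = - ip M (\<lambda>z. snd (G z)) (V (cs l k) (sn d m))"
    by (rule weak_gradient_y[OF u smooth_cs smooth_sn sn_ends(1) sn_ends(2) DERIV_sn]) (use d in simp)
  finally show ?thesis .
qed

lemma V_sin_L2: "V (sn l k) (cs d m) \<in> L2 M" "V (cs l m) (sn d k) \<in> L2 M"
  by (intro cont_L2 V_cont cs_cont sn_cont)+

text \<open>By the coefficient identities the weighted sums are Bessel sums of the two derivatives
  in the mixed sine-cosine systems. Frequency 0 is removed first: its weight is zero, and the zero
  sine does not have squared norm \<open>nu\<close>.\<close>

lemma Bessel_gradient:
  assumes u: "has_weak_gradient \<Omega> u G" and F: "finite F"
  shows "(\<Sum>i\<in>F. (real (fst i) * pi / l)\<^sup>2 * ((ip M u (e i))\<^sup>2 / nu i)) \<le> ip M (shear_grad G) (shear_grad G)" (is ?X)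
    and "(\<Sum>i\<in>F. (real (snd i) * pi / d)\<^sup>2 * ((ip M u (e i))\<^sup>2 / nu i)) \<le> ip M (\<lambda>z. snd (G z)) (\<lambda>z. snd (G z))" (is ?Y)
proof -
  have L2: "(\<lambda>z. fst (G z)) \<in> L2 M" "(\<lambda>z. snd (G z)) \<in> L2 M" using u by (auto simp: has_weak_gradient_iff)
  let ?F = "{i \<in> F. fst i > 0}"
  have "(\<Sum>i\<in>F. (real (fst i) * pi / l)\<^sup>2 * ((ip M u (e i))\<^sup>2 / nu i)) = (\<Sum>i\<in>?F. (real (fst i) * pi / l)\<^sup>2 * ((ip M u (e i))\<^sup>2 / nu i))"
    by (rule sum.mono_neutral_right) (use F in auto)
  also have "\<dots> = (\<Sum>i\<in>?F. (ip M (shear_grad G) (V (sn l (fst i)) (cs d (snd i))))\<^sup>2 / nu i)"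
  proof (rule sum.cong[OF refl])
    fix i
    have "((real (fst i) * pi / l) * ip M u (e i))\<^sup>2 = (ip M (shear_grad G) (V (sn l (fst i)) (cs d (snd i))))\<^sup>2"
      using coefficient_x[OF u, of "fst i" "snd i"] by simp
    then show "(real (fst i) * pi / l)\<^sup>2 * ((ip M u (e i))\<^sup>2 / nu i) = (ip M (shear_grad G) (V (sn l (fst i)) (cs d (snd i))))\<^sup>2 / nu i"
      by (simp only: power_mult_distrib times_divide_eq_right)
  qed
  also have "\<dots> \<le> ip M (shear_grad G) (shear_grad G)"
  proof (rule orthogonal_expansion(2)[OF _ shear_grad_L2[OF L2] V_sin_L2(1)])
    show "ip M (V (sn l (fst i)) (cs d (snd i))) (V (sn l (fst j)) (cs d (snd j))) = (if i = j then nu i else 0)"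
      if "i \<in> ?F" "j \<in> ?F" for i j
      using V_sin_orth(1)[of "fst i" "fst j" "snd i" "snd j"] that by (cases i; cases j) auto
  qed (use F nu_pos in auto)
  finally show ?X .
  let ?H = "{i \<in> F. snd i > 0}"
  have "(\<Sum>i\<in>F. (real (snd i) * pi / d)\<^sup>2 * ((ip M u (e i))\<^sup>2 / nu i)) = (\<Sum>i\<in>?H. (real (snd i) * pi / d)\<^sup>2 * ((ip M u (e i))\<^sup>2 / nu i))"
    by (rule sum.mono_neutral_right) (use F in auto)
  also have "\<dots> = (\<Sum>i\<in>?H. (ip M (\<lambda>z. snd (G z)) (V (cs l (fst i)) (sn d (snd i))))\<^sup>2 / nu i)"
  proof (rule sum.cong[OF refl])
    fix i
    have "((real (snd i) * pi / d) * ip M u (e i))\<^sup>2 = (ip M (\<lambda>z. snd (G z)) (V (cs l (fst i)) (sn d (snd i))))\<^sup>2"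
      using coefficient_y[OF u, of "snd i" "fst i"] by simp
    then show "(real (snd i) * pi / d)\<^sup>2 * ((ip M u (e i))\<^sup>2 / nu i) = (ip M (\<lambda>z. snd (G z)) (V (cs l (fst i)) (sn d (snd i))))\<^sup>2 / nu i"
      by (simp only: power_mult_distrib times_divide_eq_right)
  qed
  also have "\<dots> \<le> ip M (\<lambda>z. snd (G z)) (\<lambda>z. snd (G z))"
  proof (rule orthogonal_expansion(2)[OF _ L2(2) V_sin_L2(2)])
    show "ip M (V (cs l (fst i)) (sn d (snd i))) (V (cs l (fst j)) (sn d (snd j))) = (if i = j then nu i else 0)"
      if "i \<in> ?H" "j \<in> ?H" for i j
      using V_sin_orth(2)[of "snd i" "snd j" "fst i" "fst j"] that by (cases i; cases j) auto
  qed (use F nu_pos in auto)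
  finally show ?Y .
qed

lemma shear_grad_bound:
  obtains C where "C > 0" "\<And>u G. has_weak_gradient \<Omega> u G \<Longrightarrow>
    ip M (shear_grad G) (shear_grad G) \<le> C * dirichlet_form \<Omega> u u"
proof -
  obtain D where D: "D > 0" "\<And>x. 0 \<le> x \<Longrightarrow> x \<le> l \<Longrightarrow> \<bar>g' x\<bar> \<le> D" using bounded_on_interval[OF g'c, of 0 l] by metis
  have "ip M (shear_grad G) (shear_grad G) \<le> (2 + 2 * D\<^sup>2) * dirichlet_form \<Omega> u u"
    if u: "has_weak_gradient \<Omega> u G" for u G
  proof -
    have L2: "(\<lambda>z. fst (G z)) \<in> L2 M" "(\<lambda>z. snd (G z)) \<in> L2 M" using u by (auto simp: has_weak_gradient_iff)
    note i = L2_mult_integrable[OF L2(1) L2(1)] L2_mult_integrable[OF L2(2) L2(2)]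
    have "ip M (shear_grad G) (shear_grad G) \<le> (LINT z|M. (2 + 2 * D\<^sup>2) * (fst (G z) * fst (G z) + snd (G z) * snd (G z)))"
    proof (rule integral_mono)
      fix z assume "z \<in> space M"
      then have "\<bar>g' (fst z)\<bar> \<le> D" by (intro D(2)) (auto simp: \<Omega>_def)
      then have g2: "(g' (fst z))\<^sup>2 \<le> D\<^sup>2" using D(1) by (intro power2_le_iff_abs_le[THEN iffD2]) auto
      have "shear_grad G z * shear_grad G z \<le> 2 * (fst (G z))\<^sup>2 + 2 * (g' (fst z) * snd (G z))\<^sup>2"
        using square_add_le[of "fst (G z)" "g' (fst z) * snd (G z)"] by (simp add: shear_grad_def power2_eq_square)
      also have "\<dots> \<le> 2 * (fst (G z))\<^sup>2 + 2 * (D\<^sup>2 * (snd (G z))\<^sup>2)"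
        unfolding power_mult_distrib using g2 by (intro add_left_mono mult_left_mono mult_right_mono) auto
      also have "\<dots> \<le> (2 + 2 * D\<^sup>2) * (fst (G z) * fst (G z) + snd (G z) * snd (G z))"
      proof -
        have "0 \<le> 2 * (snd (G z))\<^sup>2 + 2 * (D\<^sup>2 * (fst (G z))\<^sup>2)" by simp
        then show ?thesis by (simp add: algebra_simps power2_eq_square)
      qed
      finally show "shear_grad G z * shear_grad G z \<le> (2 + 2 * D\<^sup>2) * (fst (G z) * fst (G z) + snd (G z) * snd (G z))" .
    qed (use i L2_mult_integrable[OF shear_grad_L2[OF L2] shear_grad_L2[OF L2]] in auto)
    also have "\<dots> = (2 + 2 * D\<^sup>2) * dirichlet_form \<Omega> u u"
      unfolding dirichlet_form_eq[OF u u] using i by simp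
    finally show ?thesis .
  qed
  then show ?thesis using D(1) by (intro that[of "2 + 2 * D\<^sup>2"]) (auto intro: add_pos_nonneg)
qed

text \<open>In place of a compact embedding: up to finitely many coefficients the norm is controlled by an
  arbitrarily small multiple of the energy.\<close>

lemma low_frequency_estimate:
  obtains C where "C > 0" "\<And>u N. u \<in> H1 \<Omega> \<Longrightarrow> N > 0 \<Longrightarrow>
    ip M u u \<le> (\<Sum>i\<in>{..<N} \<times> {..<N}. (ip M u (e i))\<^sup>2 / nu i) + C / (real N)\<^sup>2 * dirichlet_form \<Omega> u u"
proof -
  obtain D where D: "D > 0" "\<And>u G. has_weak_gradient \<Omega> u G \<Longrightarrow>
    ip M (shear_grad G) (shear_grad G) \<le> D * dirichlet_form \<Omega> u u" by (rule shear_grad_bound) blast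
  \<comment> \<open>The first part accounts for high frequencies in \<open>x\<close>, where
    \<open>D\<close> compares the derivative along \<open>(1, g')\<close> with the energy, the
    second for those in \<open>y - g x\<close>.\<close>
  define C where "C = (l / pi)\<^sup>2 * D + (d / pi)\<^sup>2"
  have "ip M u u \<le> (\<Sum>i\<in>{..<N} \<times> {..<N}. (ip M u (e i))\<^sup>2 / nu i) + C / (real N)\<^sup>2 * dirichlet_form \<Omega> u u"
    if u: "u \<in> H1 \<Omega>" and N: "N > 0" for u N
  proof (rule field_le_epsilon)
    fix \<epsilon> :: real assume "\<epsilon> > 0"
    define G where "G = weak_gradient \<Omega> u"
    have G: "has_weak_gradient \<Omega> u G" unfolding G_def by (rule H1_weak_gradient[OF u])
    have L2: "(\<lambda>z. fst (G z)) \<in> L2 M" "(\<lambda>z. snd (G z)) \<in> L2 M" using G by (auto simp: has_weak_gradient_iff)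
    define q where "q i = (ip M u (e i))\<^sup>2 / nu i" for i
    have q0: "q i \<ge> 0" for i using nu_pos[of i] by (simp add: q_def)
    let ?E = "dirichlet_form \<Omega> u u" and ?Q = "{..<N} \<times> {..<N}"
    obtain F where F: "finite F" "ip M u u - \<epsilon> < (\<Sum>i\<in>F. q i)"
      unfolding q_def by (rule Parseval_lower[OF H1_L2[OF u] \<open>\<epsilon> > 0\<close>]) blast
    \<comment> \<open>Outside the square one of the two indices is at least \<open>N\<close>; its
      squared ratio to \<open>N\<close> is then a weight of at least 1, which makes
      \<open>Bessel_gradient\<close> applicable.\<close>
    have "(\<Sum>i\<in>F. q i) \<le> (\<Sum>i\<in>?Q \<union> {i\<in>F. N \<le> fst i} \<union> {i\<in>F. N \<le> snd i}. q i)"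
      by (rule sum_mono2) (use F q0 in \<open>force simp: not_le\<close>)+
    also have "\<dots> \<le> (\<Sum>i\<in>?Q. q i) + (\<Sum>i\<in>{i\<in>F. N \<le> fst i}. q i) + (\<Sum>i\<in>{i\<in>F. N \<le> snd i}. q i)"
    proof -
      have "sum q (A \<union> B) \<le> sum q A + sum q B" if "finite A" "finite B" for A B
        using sum_Un[OF that, of q] sum_nonneg[of "A \<inter> B" q] q0 by simp
      from this[of "?Q \<union> {i\<in>F. N \<le> fst i}" "{i\<in>F. N \<le> snd i}"] this[of ?Q "{i\<in>F. N \<le> fst i}"]
      show ?thesis using F(1) by simp
    qed
    also have "(\<Sum>i\<in>{i\<in>F. N \<le> fst i}. q i) \<le> (l / pi)\<^sup>2 / (real N)\<^sup>2 * (D * ?E)"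
    proof -
      have "(\<Sum>i\<in>{i\<in>F. N \<le> fst i}. q i) \<le> (\<Sum>i\<in>{i\<in>F. N \<le> fst i}. (l / pi)\<^sup>2 / (real N)\<^sup>2 * ((real (fst i) * pi / l)\<^sup>2 * q i))"
      proof (rule sum_mono)
        fix i assume "i \<in> {i\<in>F. N \<le> fst i}"
        then have "1 * q i \<le> (real (fst i) / real N)\<^sup>2 * q i"
          using N q0 by (intro mult_right_mono) (auto simp: power_divide intro!: power_mono)
        also have "\<dots> = (l / pi)\<^sup>2 / (real N)\<^sup>2 * ((real (fst i) * pi / l)\<^sup>2 * q i)"
          using l N by (simp add: power_divide power_mult_distrib)
        finally show "q i \<le> (l / pi)\<^sup>2 / (real N)\<^sup>2 * ((real (fst i) * pi / l)\<^sup>2 * q i)" by simp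
      qed
      also have "\<dots> = (l / pi)\<^sup>2 / (real N)\<^sup>2 * (\<Sum>i\<in>{i\<in>F. N \<le> fst i}. (real (fst i) * pi / l)\<^sup>2 * q i)"
        by (simp add: sum_distrib_left)
      also have "\<dots> \<le> (l / pi)\<^sup>2 / (real N)\<^sup>2 * (D * ?E)"
        using Bessel_gradient(1)[OF G, of "{i\<in>F. N \<le> fst i}"] F(1) D(2)[OF G]
        by (intro mult_left_mono) (auto simp: q_def)
      finally show ?thesis .
    qed
    also have "(\<Sum>i\<in>{i\<in>F. N \<le> snd i}. q i) \<le> (d / pi)\<^sup>2 / (real N)\<^sup>2 * ?E"
    proof -
      have "(\<Sum>i\<in>{i\<in>F. N \<le> snd i}. q i) \<le> (\<Sum>i\<in>{i\<in>F. N \<le> snd i}. (d / pi)\<^sup>2 / (real N)\<^sup>2 * ((real (snd i) * pi / d)\<^sup>2 * q i))"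
      proof (rule sum_mono)
        fix i assume "i \<in> {i\<in>F. N \<le> snd i}"
        then have "1 * q i \<le> (real (snd i) / real N)\<^sup>2 * q i"
          using N q0 by (intro mult_right_mono) (auto simp: power_divide intro!: power_mono)
        also have "\<dots> = (d / pi)\<^sup>2 / (real N)\<^sup>2 * ((real (snd i) * pi / d)\<^sup>2 * q i)"
          using d N by (simp add: power_divide power_mult_distrib)
        finally show "q i \<le> (d / pi)\<^sup>2 / (real N)\<^sup>2 * ((real (snd i) * pi / d)\<^sup>2 * q i)" by simp
      qed
      also have "\<dots> = (d / pi)\<^sup>2 / (real N)\<^sup>2 * (\<Sum>i\<in>{i\<in>F. N \<le> snd i}. (real (snd i) * pi / d)\<^sup>2 * q i)"
        by (simp add: sum_distrib_left)
      also have "\<dots> \<le> (d / pi)\<^sup>2 / (real N)\<^sup>2 * ip M (\<lambda>z. snd (G z)) (\<lambda>z. snd (G z))"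
        using Bessel_gradient(2)[OF G, of "{i\<in>F. N \<le> snd i}"] F(1)
        by (intro mult_left_mono) (auto simp: q_def)
      also have "\<dots> \<le> (d / pi)\<^sup>2 / (real N)\<^sup>2 * ?E"
        unfolding dirichlet_form_eq[OF G G]
        by (intro mult_left_mono) (auto intro!: Bochner_Integration.integral_nonneg)
      finally show ?thesis .
    qed
    finally have "(\<Sum>i\<in>F. q i) \<le> (\<Sum>i\<in>?Q. q i) + (l / pi)\<^sup>2 / (real N)\<^sup>2 * (D * ?E) + (d / pi)\<^sup>2 / (real N)\<^sup>2 * ?E" by simp
    also have "\<dots> = (\<Sum>i\<in>?Q. q i) + C / (real N)\<^sup>2 * ?E"
      by (simp add: C_def add_divide_distrib distrib_right)
    finally show "ip M u u \<le> (\<Sum>i\<in>?Q. (ip M u (e i))\<^sup>2 / nu i) + C / (real N)\<^sup>2 * ?E + \<epsilon>"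
      using F(2) by (simp add: q_def)
  qed
  moreover have "C > 0" using l D(1) d by (simp add: C_def add_pos_nonneg)
  ultimately show ?thesis by (intro that[of C])
qed

text \<open>Bounded coefficients converge simultaneously along a subsequence. Differences of its
  members then have small low coefficients, while \<open>low_frequency_estimate\<close> bounds the
  remaining part of their norm by a small multiple of their bounded energy.\<close>

lemma Rellich:
  assumes u: "\<And>n::nat. u n \<in> H1 \<Omega>" and C: "\<And>n. dirichlet_form \<Omega> (u n) (u n) + ip M (u n) (u n) \<le> C"
  shows "\<exists>r::nat\<Rightarrow>nat. strict_mono r \<and>
    (\<forall>\<epsilon>>0. \<exists>N. \<forall>m\<ge>N. \<forall>n\<ge>N. ip M (\<lambda>z. u (r m) z - u (r n) z) (\<lambda>z. u (r m) z - u (r n) z) < \<epsilon>)"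
proof -
  obtain B where B: "B > 0" "\<And>u N. u \<in> H1 \<Omega> \<Longrightarrow> N > 0 \<Longrightarrow>
    ip M u u \<le> (\<Sum>i\<in>{..<N} \<times> {..<N}. (ip M u (e i))\<^sup>2 / nu i) + B / (real N)\<^sup>2 * dirichlet_form \<Omega> u u"
    by (rule low_frequency_estimate) blast
  have nn: "0 \<le> ip M v v" "0 \<le> dirichlet_form \<Omega> v v" for v
    by (auto simp: dirichlet_form_def intro!: Bochner_Integration.integral_nonneg)
  have "C \<ge> 0" using C[of 0] nn[of "u 0"] by linarith
  have bnd: "norm (ip M (u n) (e i)) \<le> sqrt (C * (l * d))" for n i
  proof -
    have "(ip M (u n) (e i))\<^sup>2 \<le> ip M (u n) (u n) * nu i"
      using L2_Cauchy_Schwarz[OF H1_L2[OF u] e_L2, of n i] by (simp add: e_orth)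
    also have "\<dots> \<le> C * (l * d)"
      using C[of n] nn[of "u n"] nu_le[of i] nu_pos[of i] \<open>C \<ge> 0\<close> by (intro mult_mono) auto
    finally show ?thesis by (simp add: real_le_rsqrt)
  qed
  have "\<exists>r :: nat \<Rightarrow> nat. strict_mono r \<and> (\<forall>i. \<exists>y. (\<lambda>n. ip M (u (r n)) (e i)) \<longlonglongrightarrow> y)"
  \<comment> \<open>The diagonal argument over the countable index set; \<open>i\<close> plays the
    role of the point of evaluation.\<close>
  proof (rule function_convergent_subsequence[of UNIV "\<lambda>n i. ip M (u n) (e i)" "sqrt (C * (l * d))"])
    fix r :: "nat \<Rightarrow> nat"
    assume "strict_mono r" "\<And>i. i \<in> UNIV \<Longrightarrow> \<exists>y. (\<lambda>n. ip M (u (r n)) (e i)) \<longlonglongrightarrow> y"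
    then show ?thesis by (intro exI[of _ r]) simp
  qed (use bnd in auto)
  then obtain r :: "nat \<Rightarrow> nat" where "strict_mono r \<and> (\<forall>i. \<exists>y. (\<lambda>n. ip M (u (r n)) (e i)) \<longlonglongrightarrow> y)"
    by (rule exE)
  then have r: "strict_mono r" "\<And>i. \<exists>y. (\<lambda>n. ip M (u (r n)) (e i)) \<longlonglongrightarrow> y" by blast+
  have "\<exists>N. \<forall>m\<ge>N. \<forall>n\<ge>N. ip M (\<lambda>z. u (r m) z - u (r n) z) (\<lambda>z. u (r m) z - u (r n) z) < \<epsilon>" if \<epsilon>: "\<epsilon> > 0" for \<epsilon>
  proof -
    obtain K where K: "8 * B * C / \<epsilon> < real K" using reals_Archimedean2 by blast
    define P where "P = Suc K"
    \<comment> \<open>The energy of a difference is at most \<open>4 * C\<close> by the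
      parallelogram law, so this frequency bound settles the energy term.\<close>
    have P: "P > 0" "B / (real P)\<^sup>2 * (4 * C) < \<epsilon> / 2"
    proof -
      have "8 * B * C < \<epsilon> * real P" using K \<epsilon> by (simp add: P_def field_simps)
      also have "\<dots> \<le> \<epsilon> * (real P)\<^sup>2"
        using \<epsilon> self_le_power[of "real P" 2] by (intro mult_left_mono) (auto simp: P_def)
      finally show "B / (real P)\<^sup>2 * (4 * C) < \<epsilon> / 2" by (simp add: P_def field_simps)
    qed (simp add: P_def)
    let ?Q = "{..<P} \<times> {..<P}"
    have "\<exists>N. \<forall>m\<ge>N. \<forall>n\<ge>N. (\<Sum>i\<in>?Q. (ip M (u (r m)) (e i) - ip M (u (r n)) (e i))\<^sup>2 / nu i) < \<epsilon> / 2"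
    proof -
      define y where "y i = lim (\<lambda>n. ip M (u (r n)) (e i))" for i
      have y: "(\<lambda>n. ip M (u (r n)) (e i)) \<longlonglongrightarrow> y i" for i
        using r(2)[of i] unfolding y_def convergent_def[symmetric] convergent_LIMSEQ_iff .
      have "(\<lambda>n. \<Sum>i\<in>?Q. 2 * (ip M (u (r n)) (e i) - y i)\<^sup>2 / nu i) \<longlonglongrightarrow> (\<Sum>i\<in>?Q. 2 * (y i - y i)\<^sup>2 / nu i)"
        by (intro tendsto_sum tendsto_divide tendsto_mult tendsto_const tendsto_power tendsto_diff y)
          (use nu_pos in \<open>auto simp: less_le\<close>)
      then have "\<forall>\<^sub>F n in sequentially. (\<Sum>i\<in>?Q. 2 * (ip M (u (r n)) (e i) - y i)\<^sup>2 / nu i) < \<epsilon> / 4"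
        using \<epsilon> by (intro order_tendstoD) auto
      then obtain N where N: "\<And>n. n \<ge> N \<Longrightarrow> (\<Sum>i\<in>?Q. 2 * (ip M (u (r n)) (e i) - y i)\<^sup>2 / nu i) < \<epsilon> / 4"
        by (auto simp: eventually_sequentially)
      have "(\<Sum>i\<in>?Q. (ip M (u (r m)) (e i) - ip M (u (r n)) (e i))\<^sup>2 / nu i) < \<epsilon> / 2" if mn: "m \<ge> N" "n \<ge> N" for m n
      proof -
        have "(\<Sum>i\<in>?Q. (ip M (u (r m)) (e i) - ip M (u (r n)) (e i))\<^sup>2 / nu i)
            \<le> (\<Sum>i\<in>?Q. 2 * (ip M (u (r m)) (e i) - y i)\<^sup>2 / nu i + 2 * (ip M (u (r n)) (e i) - y i)\<^sup>2 / nu i)"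
        proof (rule sum_mono)
          fix i
          have "(ip M (u (r m)) (e i) - ip M (u (r n)) (e i))\<^sup>2 \<le> 2 * (ip M (u (r m)) (e i) - y i)\<^sup>2 + 2 * (ip M (u (r n)) (e i) - y i)\<^sup>2"
            using square_add_le[of "ip M (u (r m)) (e i) - y i" "y i - ip M (u (r n)) (e i)"]
            by (simp add: power2_commute[of "y i"])
          then show "(ip M (u (r m)) (e i) - ip M (u (r n)) (e i))\<^sup>2 / nu i
             \<le> 2 * (ip M (u (r m)) (e i) - y i)\<^sup>2 / nu i + 2 * (ip M (u (r n)) (e i) - y i)\<^sup>2 / nu i"
            unfolding add_divide_distrib[symmetric] using nu_pos[of i] by (intro divide_right_mono) auto
        qed
        then show ?thesis using N[OF mn(1)] N[OF mn(2)] by (simp add: sum.distrib)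
      qed
      then show ?thesis by blast
    qed
    then obtain N where N: "\<And>m n. m \<ge> N \<Longrightarrow> n \<ge> N \<Longrightarrow> (\<Sum>i\<in>?Q. (ip M (u (r m)) (e i) - ip M (u (r n)) (e i))\<^sup>2 / nu i) < \<epsilon> / 2"
      by blast
    have "ip M (\<lambda>z. u (r m) z - u (r n) z) (\<lambda>z. u (r m) z - u (r n) z) < \<epsilon>" if mn: "m \<ge> N" "n \<ge> N" for m n
    proof -
      let ?w = "\<lambda>z. 1 * u (r m) z + (- 1) * u (r n) z" and ?s = "\<lambda>z. 1 * u (r m) z + 1 * u (r n) z"
      have w: "?w \<in> H1 \<Omega>" and s: "?s \<in> H1 \<Omega>" by (rule H1_lincomb[OF u u])+
      have sym: "dirichlet_form \<Omega> a b = dirichlet_form \<Omega> b a" for a b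
        by (simp add: dirichlet_form_def inner_commute)
      have par: "dirichlet_form \<Omega> ?w ?w + dirichlet_form \<Omega> ?s ?s = 2 * dirichlet_form \<Omega> (u (r m)) (u (r m)) + 2 * dirichlet_form \<Omega> (u (r n)) (u (r n))"
        unfolding dirichlet_form_lincomb[OF u u w] dirichlet_form_lincomb[OF u u s] sym[of _ ?w] sym[of _ ?s]
          dirichlet_form_lincomb[OF u u u]
        by (simp add: sym[of "u (r n)" "u (r m)"])
      have "dirichlet_form \<Omega> ?w ?w \<le> 4 * C"
        using par C[of "r m"] C[of "r n"] nn[of ?s] nn[of "u (r m)"] nn[of "u (r n)"] by linarith
      then have "B / (real P)\<^sup>2 * dirichlet_form \<Omega> ?w ?w \<le> B / (real P)\<^sup>2 * (4 * C)"
        using B(1) by (intro mult_left_mono) auto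
      moreover have "(\<Sum>i\<in>?Q. (ip M ?w (e i))\<^sup>2 / nu i) < \<epsilon> / 2"
        using N[OF mn] unfolding ip_lincomb[OF H1_L2[OF u] H1_L2[OF u] e_L2] by simp
      ultimately have "ip M ?w ?w < \<epsilon>" using B(2)[OF w P(1)] P(2) by linarith
      then show ?thesis by simp
    qed
    then show ?thesis by blast
  qed
  then show ?thesis using r(1) by blast
qed

text \<open>A Cauchy sequence for the form norm has L2 limits of the functions and of both gradient
  components; the weak equations, being continuous in L2 for each test function, pass to these
  limits.\<close>

lemma H1_complete:
  assumes u: "\<And>n::nat. u n \<in> H1 \<Omega>"
    and Cauchy: "\<And>\<epsilon>. \<epsilon> > 0 \<Longrightarrow> \<exists>N. \<forall>m\<ge>N. \<forall>n\<ge>N. dirichlet_form \<Omega> (\<lambda>z. u m z - u n z) (\<lambda>z. u m z - u n z)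
          + ip M (\<lambda>z. u m z - u n z) (\<lambda>z. u m z - u n z) < \<epsilon>"
  shows "\<exists>w\<in>H1 \<Omega>. (\<lambda>n. dirichlet_form \<Omega> (\<lambda>z. u n z - w z) (\<lambda>z. u n z - w z) + ip M (\<lambda>z. u n z - w z) (\<lambda>z. u n z - w z)) \<longlonglongrightarrow> 0"
proof -
  define G where "G n = weak_gradient \<Omega> (u n)" for n
  have G: "has_weak_gradient \<Omega> (u n) (G n)" for n unfolding G_def by (rule H1_weak_gradient[OF u])
  note L = G[unfolded has_weak_gradient_iff]
  have diff: "dirichlet_form \<Omega> (\<lambda>z. v z - w z) (\<lambda>z. v z - w z) = (LINT z|M. (fst (G z) - fst (H z))\<^sup>2) + (LINT z|M. (snd (G z) - snd (H z))\<^sup>2)"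
    if "has_weak_gradient \<Omega> v G" "has_weak_gradient \<Omega> w H" for v w G H
  proof -
    have "has_weak_gradient \<Omega> (\<lambda>z. v z - w z) (\<lambda>z. (fst (G z) - fst (H z), snd (G z) - snd (H z)))"
      using weak_gradient_lincomb[OF that, of 1 "-1"] by simp
    from dirichlet_form_eq[OF this this] show ?thesis by (simp add: power2_eq_square)
  qed
  have nn: "0 \<le> (LINT z|M. (f z)\<^sup>2)" for f :: "real \<times> real \<Rightarrow> real" by (rule Bochner_Integration.integral_nonneg) simp
  have C: "\<exists>N. \<forall>m\<ge>N. \<forall>n\<ge>N. (LINT z|M. (u m z - u n z)\<^sup>2) < \<epsilon> \<and> (LINT z|M. (fst (G m z) - fst (G n z))\<^sup>2) < \<epsilon>
      \<and> (LINT z|M. (snd (G m z) - snd (G n z))\<^sup>2) < \<epsilon>" if \<epsilon>: "\<epsilon> > 0" for \<epsilon>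
  proof -
    obtain N where N: "\<forall>m\<ge>N. \<forall>n\<ge>N. (LINT z|M. (fst (G m z) - fst (G n z))\<^sup>2) + (LINT z|M. (snd (G m z) - snd (G n z))\<^sup>2)
        + (LINT z|M. (u m z - u n z)\<^sup>2) < \<epsilon>"
      using Cauchy[OF \<epsilon>] unfolding diff[OF G G] power2_eq_square by blast
    have "(LINT z|M. (u m z - u n z)\<^sup>2) < \<epsilon> \<and> (LINT z|M. (fst (G m z) - fst (G n z))\<^sup>2) < \<epsilon>
      \<and> (LINT z|M. (snd (G m z) - snd (G n z))\<^sup>2) < \<epsilon>" if "m \<ge> N" "n \<ge> N" for m n
      using N[rule_format, OF that] nn[of "\<lambda>z. u m z - u n z"] nn[of "\<lambda>z. fst (G m z) - fst (G n z)"] nn[of "\<lambda>z. snd (G m z) - snd (G n z)"]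
      by linarith
    then show ?thesis by blast
  qed
  have uL: "u n \<in> L2 M" and G1: "(\<lambda>z. fst (G n z)) \<in> L2 M" and G2: "(\<lambda>z. snd (G n z)) \<in> L2 M" for n using L[of n] by auto
  have "\<exists>N. \<forall>m\<ge>N. \<forall>n\<ge>N. (LINT z|M. (u m z - u n z)\<^sup>2) < \<epsilon>"
    "\<exists>N. \<forall>m\<ge>N. \<forall>n\<ge>N. (LINT z|M. (fst (G m z) - fst (G n z))\<^sup>2) < \<epsilon>"
    "\<exists>N. \<forall>m\<ge>N. \<forall>n\<ge>N. (LINT z|M. (snd (G m z) - snd (G n z))\<^sup>2) < \<epsilon>" if "\<epsilon> > 0" for \<epsilon>
    using C[OF that] by blast+
  note C = this
  obtain w where w: "w \<in> L2 M" "(\<lambda>n. LINT z|M. (u n z - w z)\<^sup>2) \<longlonglongrightarrow> 0"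
    using L2_complete[where f=u, OF finite_M uL C(1)] by blast
  obtain Hx where Hx: "Hx \<in> L2 M" "(\<lambda>n. LINT z|M. (fst (G n z) - Hx z)\<^sup>2) \<longlonglongrightarrow> 0"
    using L2_complete[where f="\<lambda>n z. fst (G n z)", OF finite_M G1 C(2)] by blast
  obtain H2 where H2: "H2 \<in> L2 M" "(\<lambda>n. LINT z|M. (snd (G n z) - H2 z)\<^sup>2) \<longlonglongrightarrow> 0"
    using L2_complete[where f="\<lambda>n z. snd (G n z)", OF finite_M G2 C(3)] by blast
  have wH: "has_weak_gradient \<Omega> w (\<lambda>z. (Hx z, H2 z))"
    unfolding has_weak_gradient_iff fst_conv snd_conv
  proof (intro conjI ballI w(1) Hx(1) H2(1))
    fix \<phi> assume \<phi>: "\<phi> \<in> test_functions \<Omega>"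
    have P: "\<phi> \<in> L2 M" "partial_deriv (1, 0) \<phi> \<in> L2 M" "partial_deriv (0, 1) \<phi> \<in> L2 M"
      using test_function_cont[OF \<phi>] by (auto intro!: cont_L2 simp: Basis_prod_def)
    have x: "ip M (u n) (partial_deriv (1, 0) \<phi>) = - ip M (\<lambda>z. fst (G n z)) \<phi>"
      and y: "ip M (u n) (partial_deriv (0, 1) \<phi>) = - ip M (\<lambda>z. snd (G n z)) \<phi>" for n
      using L[of n] \<phi> by auto
    show "ip M w (partial_deriv (1, 0) \<phi>) = - ip M Hx \<phi>"
      using L2_tendsto_ip[OF uL w(1) P(2) w(2)] tendsto_minus[OF L2_tendsto_ip[OF G1 Hx(1) P(1) Hx(2)]]
      unfolding x by (rule LIMSEQ_unique)
    show "ip M w (partial_deriv (0, 1) \<phi>) = - ip M H2 \<phi>"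
      using L2_tendsto_ip[OF uL w(1) P(3) w(2)] tendsto_minus[OF L2_tendsto_ip[OF G2 H2(1) P(1) H2(2)]]
      unfolding y by (rule LIMSEQ_unique)
  qed
  have "(\<lambda>n. (LINT z|M. (fst (G n z) - Hx z)\<^sup>2) + (LINT z|M. (snd (G n z) - H2 z)\<^sup>2) + (LINT z|M. (u n z - w z)\<^sup>2)) \<longlonglongrightarrow> 0 + 0 + 0"
    by (intro tendsto_add w(2) Hx(2) H2(2))
  then have "(\<lambda>n. dirichlet_form \<Omega> (\<lambda>z. u n z - w z) (\<lambda>z. u n z - w z) + ip M (\<lambda>z. u n z - w z) (\<lambda>z. u n z - w z)) \<longlonglongrightarrow> 0"
    unfolding diff[OF G wH] by (simp add: power2_eq_square)
  moreover have "w \<in> H1 \<Omega>" using wH by (auto simp: H1_def)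
  ultimately show ?thesis by blast
qed

lemma neumann_form: "neumann_form \<Omega>"
proof
  have nn: "0 \<le> ip M v v" "0 \<le> dirichlet_form \<Omega> v v" for v
    by (auto simp: dirichlet_form_def intro!: Bochner_Integration.integral_nonneg)
  have zero: "(\<lambda>z. 0 * u z) = (\<lambda>_. 0)" for u :: "real \<times> real \<Rightarrow> real" by simp
  fix u v w :: "real \<times> real \<Rightarrow> real" and c :: real
  assume u: "u \<in> H1 \<Omega>"
  show "(\<lambda>x. c * u x) \<in> H1 \<Omega>" using H1_lincomb[OF u u, of c 0] by simp
  show "u \<in> L2 (lebesgue_on \<Omega>)" by (rule H1_L2[OF u])
  show "0 \<le> ip M u u" "0 \<le> dirichlet_form \<Omega> u u" by (rule nn)+
  { assume v: "v \<in> H1 \<Omega>"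
    show "(\<lambda>x. u x + v x) \<in> H1 \<Omega>" using H1_lincomb[OF u v, of 1 1] by simp
    show "dirichlet_form \<Omega> u v = dirichlet_form \<Omega> v u" by (simp add: dirichlet_form_def inner_commute)
    show "ip M u v = ip M v u" by (simp add: mult.commute)
    { assume w: "w \<in> H1 \<Omega>"
      show "dirichlet_form \<Omega> (\<lambda>x. u x + v x) w = dirichlet_form \<Omega> u w + dirichlet_form \<Omega> v w"
        using dirichlet_form_lincomb[OF u v w, of 1 1] by simp
      show "ip M (\<lambda>x. u x + v x) w = ip M u w + ip M v w"
        using ip_lincomb[OF H1_L2[OF u] H1_L2[OF v] H1_L2[OF w], of 1 1] by simp }
  }
  { assume w: "w \<in> H1 \<Omega>"
    show "dirichlet_form \<Omega> (\<lambda>x. c * u x) w = c * dirichlet_form \<Omega> u w"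
      using dirichlet_form_lincomb[OF u u w, of c 0] by simp
    show "ip M (\<lambda>x. c * u x) w = c * ip M u w"
      by (simp add: mult.assoc) }
next
  fix u :: "nat \<Rightarrow> real \<times> real \<Rightarrow> real" and C
  assume "\<And>n. u n \<in> H1 \<Omega>" "\<And>n. dirichlet_form \<Omega> (u n) (u n) + ip M (u n) (u n) \<le> C"
  then show "\<exists>r::nat\<Rightarrow>nat. strict_mono r \<and>
    (\<forall>\<epsilon>>0. \<exists>N. \<forall>m\<ge>N. \<forall>n\<ge>N. ip M (\<lambda>z. u (r m) z - u (r n) z) (\<lambda>z. u (r m) z - u (r n) z) < \<epsilon>)"
    by (rule Rellich)
next
  fix u :: "nat \<Rightarrow> real \<times> real \<Rightarrow> real"
  assume "\<And>n. u n \<in> H1 \<Omega>" "\<And>\<epsilon>. \<epsilon> > 0 \<Longrightarrow> \<exists>N. \<forall>m\<ge>N. \<forall>n\<ge>N. dirichlet_form \<Omega> (\<lambda>z. u m z - u n z) (\<lambda>z. u m z - u n z)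
          + ip M (\<lambda>z. u m z - u n z) (\<lambda>z. u m z - u n z) < \<epsilon>"
  then show "\<exists>w\<in>H1 \<Omega>. (\<lambda>n. dirichlet_form \<Omega> (\<lambda>z. u n z - w z) (\<lambda>z. u n z - w z) + ip M (\<lambda>z. u n z - w z) (\<lambda>z. u n z - w z)) \<longlonglongrightarrow> 0"
    by (rule H1_complete)
qed

end

section \<open>The trial functions\<close>

lemma integral_sn_even:
  assumes "L > 0"
  shows "integral {0..L} (sn L (2 * k)) = 0"
proof (cases "k = 0")
  case True
  then show ?thesis by (simp add: sn_def[abs_def])
next
  case False
  let ?a = "real (2 * k) * pi / L"
  have "?a \<noteq> 0" using False assms by simp
  have "(sn L (2 * k) has_integral - cs L (2 * k) L / ?a - - cs L (2 * k) 0 / ?a) {0..L}"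
  proof (rule fundamental_theorem_of_calculus)
    show "((\<lambda>x. - cs L (2 * k) x / ?a) has_vector_derivative sn L (2 * k) x) (at x within {0..L})" for x
      using DERIV_cdivide[OF DERIV_minus[OF DERIV_cs[of L "2 * k" x]], of ?a] \<open>?a \<noteq> 0\<close>
      by (simp add: has_real_derivative_iff_has_vector_derivative has_vector_derivative_at_within)
  qed (use assms in simp)
  moreover have "cs L (2 * k) L = 1" "cs L (2 * k) 0 = 1"
    using assms cos_2npi[of k] by (simp_all add: cs_def mult_ac)
  ultimately show ?thesis by (simp add: integral_unique)
qed

text \<open>The product is half a difference of sines with indices 4 and 2, which run over full
  periods. It decouples the third cosine from the second trial function in the rigidity
  argument.\<close>

lemma integral_sn1_cs3:
  assumes "L > 0"
  shows "integral {0..L} (\<lambda>x. sn L 1 x * cs L 3 x) = 0"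
proof -
  have "sn L 1 x * cs L 3 x = (sn L (2 * 2) x - sn L (2 * 1) x) / 2" for x
    using sin_add[of "3 * (pi / L * x)" "pi / L * x"] sin_diff[of "3 * (pi / L * x)" "pi / L * x"]
    by (simp add: sn_def cs_def mult_ac)
  then have "integral {0..L} (\<lambda>x. sn L 1 x * cs L 3 x) = integral {0..L} (\<lambda>x. (sn L (2 * 2) x - sn L (2 * 1) x) / 2)"
    by (rule Henstock_Kurzweil_Integration.integral_cong)
  also have "\<dots> = (integral {0..L} (sn L (2 * 2)) - integral {0..L} (sn L (2 * 1))) / 2"
  proof -
    have "sn L k integrable_on {0..L}" for k
      by (rule integrable_continuous_real) (use sn_cont continuous_on_subset in blast)
    then show ?thesis by (simp add: Henstock_Kurzweil_Integration.integral_diff)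
  qed
  also have "\<dots> = 0" unfolding integral_sn_even[OF assms] by simp
  finally show ?thesis .
qed

text \<open>The integrand is the derivative of \<open>cs L k\<close>, which for odd \<open>k\<close>
  falls from 1 to - 1.\<close>

lemma integral_sn_odd:
  assumes "L > 0" "odd k"
  shows "integral {0..L} (\<lambda>x. - (real k * pi / L) * sn L k x) = - 2"
proof -
  have "((\<lambda>x. - (real k * pi / L) * sn L k x) has_integral cs L k L - cs L k 0) {0..L}"
    by (rule fundamental_theorem_of_calculus)
      (use assms DERIV_cs in \<open>auto simp: has_real_derivative_iff_has_vector_derivative[symmetric] intro: has_field_derivative_at_within\<close>)
  then have "integral {0..L} (\<lambda>x. - (real k * pi / L) * sn L k x) = cs L k L - cs L k 0"
    by (rule integral_unique)
  also have "\<dots> = - 2" using assms cos_npi[of k] by (simp add: cs_def mult_ac)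
  finally show ?thesis .
qed

text \<open>Approximating \<open>f\<close> itself by polynomials makes the integral of its square
  arbitrarily small.\<close>

lemma continuous_zero_of_polynomials:
  fixes f :: "real \<Rightarrow> real"
  assumes f: "continuous_on {a..b} f" and "a < b"
    and 0: "\<And>q. real_polynomial_function q \<Longrightarrow> integral {a..b} (\<lambda>x. f x * q x) = 0" and x: "x \<in> {a..b}"
  shows "f x = 0"
proof -
  obtain C where C: "C > 0" "\<And>x. x \<in> {a..b} \<Longrightarrow> \<bar>f x\<bar> \<le> C"
  proof -
    have "compact (f ` {a..b})" using f by (intro compact_continuous_image) auto
    then obtain C where "\<And>x. x \<in> {a..b} \<Longrightarrow> \<bar>f x\<bar> \<le> C" using compact_imp_bounded by (force simp: bounded_iff)
    then show ?thesis by (intro that[of "\<bar>C\<bar> + 1"]) (force, smt (verit))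
  qed
  have int: "integral {a..b} (\<lambda>x. f x * f x) \<le> C * \<epsilon> * (b - a)" if \<epsilon>: "\<epsilon> > 0" for \<epsilon>
  proof -
    obtain q where q: "real_polynomial_function q" "\<And>x. x \<in> {a..b} \<Longrightarrow> \<bar>f x - q x\<bar> < \<epsilon>"
      using Stone_Weierstrass_real_polynomial_function[OF _ f \<epsilon>] by auto
    have qc: "continuous_on {a..b} q"
      using smooth_continuous[OF smooth_polynomial[OF q(1)]] continuous_on_subset by blast
    have "integral {a..b} (\<lambda>x. f x * f x) = integral {a..b} (\<lambda>x. f x * (f x - q x)) + integral {a..b} (\<lambda>x. f x * q x)"
      by (subst Henstock_Kurzweil_Integration.integral_add[symmetric])
        (auto intro!: integrable_continuous_real continuous_intros f qc simp: algebra_simps)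
    also have "\<dots> = integral {a..b} (\<lambda>x. f x * (f x - q x))" using 0[OF q(1)] by simp
    also have "\<dots> \<le> integral {a..b} (\<lambda>x. C * \<epsilon>)"
    proof (rule integral_le)
      fix x assume "x \<in> {a..b}"
      then have "\<bar>f x\<bar> * \<bar>f x - q x\<bar> \<le> C * \<epsilon>" using C q(2) by (intro mult_mono) (auto intro: less_imp_le)
      then show "f x * (f x - q x) \<le> C * \<epsilon>" by (simp add: abs_mult[symmetric] abs_le_iff)
    qed (auto intro!: integrable_continuous_real continuous_intros f qc)
    finally show ?thesis using \<open>a < b\<close> by (simp add: mult_ac)
  qed
  have "integral {a..b} (\<lambda>x. f x * f x) \<le> 0"
  proof (rule field_le_epsilon)
    fix \<epsilon> :: real assume \<epsilon>: "\<epsilon> > 0"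
    have "\<epsilon> / (C * (b - a)) > 0" using \<epsilon> C(1) \<open>a < b\<close> by simp
    moreover have "C * (\<epsilon> / (C * (b - a))) * (b - a) = \<epsilon>" using C(1) \<open>a < b\<close> by simp
    ultimately show "integral {a..b} (\<lambda>x. f x * f x) \<le> 0 + \<epsilon>" using int by fastforce
  qed
  moreover have "integral {a..b} (\<lambda>x. f x * f x) \<ge> 0"
    by (rule integral_nonneg) (auto intro!: integrable_continuous_real continuous_intros f)
  ultimately have "integral {a..b} (\<lambda>x. f x * f x) = 0" by linarith
  moreover have "integral {a..b} (\<lambda>x. f x * f x) = 0 \<longleftrightarrow> (\<forall>x\<in>{a..b}. f x * f x = 0)"
    by (rule integral_eq_0_iff) (use f \<open>a < b\<close> in \<open>auto intro: continuous_on_mult\<close>)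
  ultimately have "\<forall>x\<in>{a..b}. f x * f x = 0" by blast
  then show ?thesis using x by simp
qed

text \<open>The symmetric matrix with diagonal \<open>A\<close>, \<open>B\<close> and off-diagonal
  entry \<open>c\<close> has the eigenvalues \<open>(A + B + s) / 2\<close> and
  \<open>(A + B - s) / 2\<close>; its quadratic form is bounded by the larger one and attains the
  smaller one at an eigenvector.\<close>

lemma quadratic_form_bounds:
  fixes A B c :: real
  defines "s \<equiv> sqrt ((A - B)\<^sup>2 + 4 * c\<^sup>2)"
  shows "A * x\<^sup>2 + 2 * c * (x * y) + B * y\<^sup>2 \<le> (A + B + s) / 2 * (x\<^sup>2 + y\<^sup>2)"
    and "\<exists>x y. (x \<noteq> 0 \<or> y \<noteq> 0) \<and> A * x\<^sup>2 + 2 * c * (x * y) + B * y\<^sup>2 = (A + B - s) / 2 * (x\<^sup>2 + y\<^sup>2)"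
    and "(A + B - s) / 2 \<le> min A B"
proof -
  have s2: "s\<^sup>2 = (A - B)\<^sup>2 + 4 * c\<^sup>2" by (simp add: s_def)
  have s: "\<bar>A - B\<bar> \<le> s" unfolding s_def by (rule real_le_rsqrt) simp
  show "(A + B - s) / 2 \<le> min A B" using s by (simp add: min_def abs_le_iff)
  \<comment> \<open>The distances of \<open>A\<close> and of \<open>B\<close> from the larger
    eigenvalue; \<open>p * q = c^2\<close> says that the shifted matrix is singular.\<close>
  define p q where "p = (s - (A - B)) / 2" and "q = (s + (A - B)) / 2"
  have pq: "p \<ge> 0" "q \<ge> 0" "p * q = c\<^sup>2" using s s2 by (auto simp: p_def q_def power2_eq_square algebra_simps)
  have "\<bar>c\<bar> = sqrt p * sqrt q" using pq(3) by (simp flip: real_sqrt_mult)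
  then have "2 * c * (x * y) \<le> 2 * (sqrt p * \<bar>x\<bar>) * (sqrt q * \<bar>y\<bar>)"
    using abs_ge_self[of "c * (x * y)"] by (simp add: abs_mult mult_ac)
  also have "\<dots> \<le> (sqrt p * \<bar>x\<bar>)\<^sup>2 + (sqrt q * \<bar>y\<bar>)\<^sup>2" by (rule sum_squares_bound)
  also have "\<dots> = p * x\<^sup>2 + q * y\<^sup>2" using pq by (simp add: power_mult_distrib)
  finally have "A * x\<^sup>2 + 2 * c * (x * y) + B * y\<^sup>2 \<le> (A + p) * x\<^sup>2 + (B + q) * y\<^sup>2"
    by (simp add: distrib_right)
  moreover have "A + p = (A + B + s) / 2" "B + q = (A + B + s) / 2" by (simp_all add: p_def q_def field_simps)
  ultimately show "A * x\<^sup>2 + 2 * c * (x * y) + B * y\<^sup>2 \<le> (A + B + s) / 2 * (x\<^sup>2 + y\<^sup>2)"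
    by (simp only: distrib_left)
  show "\<exists>x y. (x \<noteq> 0 \<or> y \<noteq> 0) \<and> A * x\<^sup>2 + 2 * c * (x * y) + B * y\<^sup>2 = (A + B - s) / 2 * (x\<^sup>2 + y\<^sup>2)"
  proof (cases "c = 0")
    case False
    \<comment> \<open>\<open>(c, - q)\<close> is an eigenvector: for the smaller eigenvalue
      \<lambda> one has \<open>A - \<lambda> = q\<close> and \<open>B - \<lambda> = p\<close>, with
      \<open>p * q = c^2\<close>. For \<open>c = 0\<close> it could be the zero vector, hence the
      separate case.\<close>
    have "A * c\<^sup>2 + 2 * c * (c * (- q)) + B * (- q)\<^sup>2 - (A + B - s) / 2 * (c\<^sup>2 + (- q)\<^sup>2) = 0"
    proof -
      have e: "(A + B - s) / 2 = A - q" "B = A - q + p" by (simp_all add: p_def q_def field_simps)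
      show ?thesis unfolding e(1) using e(2) pq(3) by algebra
    qed
    then show ?thesis using False by (intro exI[of _ c] exI[of _ "- q"]) simp
  next
    case True
    then have s': "s = \<bar>A - B\<bar>" by (simp add: s_def)
    show ?thesis
    proof (cases "A \<le> B")
      case True
      then show ?thesis using \<open>c = 0\<close> s' by (intro exI[of _ 1] exI[of _ 0]) simp
    next
      case False
      then show ?thesis using \<open>c = 0\<close> s' by (intro exI[of _ 0] exI[of _ 1]) simp
    qed
  qed
qed

context strip
begin

section \<open>Energies of products and of the trial functions\<close>

lemma V_has_weak_gradient:
  assumes X: "\<And>x. (X has_real_derivative X' x) (at x)" "continuous_on UNIV X'"
    and Y: "\<And>x. (Y has_real_derivative Y' x) (at x)" "continuous_on UNIV Y'"
  shows "has_weak_gradient \<Omega> (V X Y) (\<lambda>z. (V X' Y z - V (\<lambda>x. g' x * X x) Y' z, V X Y' z))"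
proof -
  have Xc: "continuous_on UNIV X" and Yc: "continuous_on UNIV Y"
    using X(1) Y(1) DERIV_continuous_on by blast+
  define D where "D z h = X' (fst z) * fst h * Y (snd z - g (fst z))
        + X (fst z) * (Y' (snd z - g (fst z)) * (snd h - g' (fst z) * fst h))" for z h :: "real \<times> real"
  have D: "(V X Y has_derivative D z) (at z)" for z
    unfolding V_def[abs_def] D_def[abs_def] by (rule has_derivative_shear[OF X(1) Y(1) g])
  have D1: "D z (1, 0) = V X' Y z - V (\<lambda>x. g' x * X x) Y' z" and D2: "D z (0, 1) = V X Y' z" for z
    by (simp_all add: D_def V_def)
  have "has_weak_gradient \<Omega> (V X Y) (\<lambda>z. \<Sum>b\<in>Basis. D z b *\<^sub>R b)"
  proof (rule C1_has_weak_gradient[OF bounded_\<Omega> \<Omega>_sets D])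
    fix b :: "real \<times> real" assume "b \<in> Basis"
    then consider "b = (1, 0)" | "b = (0, 1)" by (auto simp: Basis_prod_def)
    then show "continuous_on UNIV (\<lambda>z. D z b)"
      by cases (auto simp: D1 D2 intro!: continuous_on_diff V_cont continuous_on_mult X(2) Y(2) Xc Yc g'c)
  qed
  moreover have "(\<Sum>b\<in>Basis. D z b *\<^sub>R b) = (D z (1, 0), D z (0, 1))" for z
    by (simp add: Basis_prod_def sum.union_disjoint sum.insert_if)
  ultimately show ?thesis by (simp add: D1 D2)
qed

lemma ip_V:
  assumes "continuous_on UNIV X" "continuous_on UNIV Y" "continuous_on UNIV A" "continuous_on UNIV B"
  shows "ip M (V X Y) (V A B) = integral {0..l} (\<lambda>x. X x * A x) * integral {0..d} (\<lambda>t. Y t * B t)"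
  unfolding V_mult by (rule integral_V) (intro continuous_on_mult assms)+

text \<open>In straightened coordinates the gradient is \<open>(X' Y - g' X Y', X Y')\<close>. The
  square of the shear term joins the y-derivative in the weight \<open>1 + g'^2\<close>, the mixed
  terms carry one \<open>g'\<close>, and \<open>integral_V\<close> factorises each term.\<close>

lemma dirichlet_V:
  assumes X: "\<And>x. (X has_real_derivative X' x) (at x)" "continuous_on UNIV X'"
    and Y: "\<And>x. (Y has_real_derivative Y' x) (at x)" "continuous_on UNIV Y'"
    and A: "\<And>x. (A has_real_derivative A' x) (at x)" "continuous_on UNIV A'"
    and B: "\<And>x. (B has_real_derivative B' x) (at x)" "continuous_on UNIV B'"
  shows "dirichlet_form \<Omega> (V X Y) (V A B) =
    integral {0..l} (\<lambda>x. X' x * A' x) * integral {0..d} (\<lambda>t. Y t * B t)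
    - integral {0..l} (\<lambda>x. g' x * X' x * A x) * integral {0..d} (\<lambda>t. Y t * B' t)
    - integral {0..l} (\<lambda>x. g' x * X x * A' x) * integral {0..d} (\<lambda>t. Y' t * B t)
    + integral {0..l} (\<lambda>x. (1 + (g' x)\<^sup>2) * X x * A x) * integral {0..d} (\<lambda>t. Y' t * B' t)"
proof -
  have c: "continuous_on UNIV X" "continuous_on UNIV Y" "continuous_on UNIV A" "continuous_on UNIV B"
    using X(1) Y(1) A(1) B(1) DERIV_continuous_on by blast+
  note cc = c X(2) Y(2) A(2) B(2) g'c
  have int: "integrable M (V P Q)" if "continuous_on UNIV P" "continuous_on UNIV Q" for P Q
    by (rule finite_measure.L2_integrable[OF finite_M cont_L2[OF V_cont[OF that]]])
  let ?a = "V (\<lambda>x. X' x * A' x) (\<lambda>t. Y t * B t)" and ?b = "V (\<lambda>x. g' x * X' x * A x) (\<lambda>t. Y t * B' t)"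
    and ?c = "V (\<lambda>x. g' x * X x * A' x) (\<lambda>t. Y' t * B t)" and ?e = "V (\<lambda>x. (1 + (g' x)\<^sup>2) * X x * A x) (\<lambda>t. Y' t * B' t)"
  note G = V_has_weak_gradient[OF X Y] and H = V_has_weak_gradient[OF A B]
  have i: "integrable M ?a" "integrable M ?b" "integrable M ?c" "integrable M ?e"
    by (intro int continuous_on_mult continuous_on_add continuous_on_const continuous_on_power cc)+
  have L: "V X' Y \<in> L2 M" "V (\<lambda>x. g' x * X x) Y' \<in> L2 M" "V X Y' \<in> L2 M" "V A' B \<in> L2 M" "V (\<lambda>x. g' x * A x) B' \<in> L2 M" "V A B' \<in> L2 M"
    by (intro cont_L2 V_cont continuous_on_mult cc)+
  have "dirichlet_form \<Omega> (V X Y) (V A B) =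
     (LINT z|M. (V X' Y z - V (\<lambda>x. g' x * X x) Y' z) * (V A' B z - V (\<lambda>x. g' x * A x) B' z) + V X Y' z * V A B' z)"
    unfolding dirichlet_form_eq[OF G H] fst_conv snd_conv
    by (rule Bochner_Integration.integral_add[symmetric]) (intro L2_mult_integrable L2_diff L)+
  also have "\<dots> = (LINT z|M. ?a z - ?b z - ?c z + ?e z)"
    by (rule Bochner_Integration.integral_cong) (auto simp: V_def algebra_simps power2_eq_square)
  also have "\<dots> = integral\<^sup>L M ?a - integral\<^sup>L M ?b - integral\<^sup>L M ?c + integral\<^sup>L M ?e"
    using i by simp
  finally show ?thesis
    by (simp only: integral_V continuous_on_mult continuous_on_add continuous_on_const continuous_on_power cc)
qed

sublocale nf: neumann_form \<Omega>
  by (rule neumann_form)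

abbreviation "I2 \<equiv> integral {0..l} (\<lambda>x. 1 + (g' x)\<^sup>2)"
abbreviation "S1 \<equiv> integral {0..l} (\<lambda>x. g' x * sin (pi * x / l))"

lemma deriv_cont: "continuous_on UNIV (\<lambda>x. - (real k * pi / L) * sn L k x)"
  by (intro continuous_on_mult continuous_on_const sn_cont)

lemma dirichlet_e:
  "dirichlet_form \<Omega> (e (j, k)) (e (j', k')) =
    integral {0..l} (\<lambda>x. - (real j * pi / l) * sn l j x * (- (real j' * pi / l) * sn l j' x)) * integral {0..d} (\<lambda>t. cs d k t * cs d k' t)
    - integral {0..l} (\<lambda>x. g' x * (- (real j * pi / l) * sn l j x) * cs l j' x) * integral {0..d} (\<lambda>t. cs d k t * (- (real k' * pi / d) * sn d k' t))
    - integral {0..l} (\<lambda>x. g' x * cs l j x * (- (real j' * pi / l) * sn l j' x)) * integral {0..d} (\<lambda>t. - (real k * pi / d) * sn d k t * cs d k' t)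
    + integral {0..l} (\<lambda>x. (1 + (g' x)\<^sup>2) * cs l j x * cs l j' x) * integral {0..d} (\<lambda>t. - (real k * pi / d) * sn d k t * (- (real k' * pi / d) * sn d k' t))"
  unfolding e_def fst_conv snd_conv
  by (rule dirichlet_V[OF DERIV_cs deriv_cont DERIV_cs deriv_cont DERIV_cs deriv_cont DERIV_cs deriv_cont])

lemma e_H1: "e i \<in> H1 \<Omega>"
  using V_has_weak_gradient[OF DERIV_cs deriv_cont DERIV_cs deriv_cont, of l "fst i" d "snd i"]
  by (auto simp: e_def H1_def)

lemma cs_0: "cs L 0 = (\<lambda>_. 1)" "sn L 0 = (\<lambda>_. 0)"
  by (simp_all add: cs_def[abs_def] sn_def[abs_def])

lemma dirichlet_const: "v \<in> H1 \<Omega> \<Longrightarrow> dirichlet_form \<Omega> (e (0, 0)) v = 0"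
proof -
  assume v: "v \<in> H1 \<Omega>"
  have "has_weak_gradient \<Omega> (e (0, 0)) (\<lambda>_. (0, 0))"
    using V_has_weak_gradient[OF DERIV_cs deriv_cont DERIV_cs deriv_cont, of l 0 d 0]
    by (simp add: e_def V_def[abs_def])
  from dirichlet_form_eq[OF this H1_weak_gradient[OF v]] show ?thesis by simp
qed

text \<open>The factor \<open>l * d / 2\<close>, the squared norm of both functions, is split off so
  that the matrix of Rayleigh quotients can be read off. In the mixed entry a single product
  survives: \<open>S1\<close> from the sine in \<open>x\<close>, and - 2 from the fall of the cosine
  across the strip.\<close>

lemma dirichlet_trial:
  "dirichlet_form \<Omega> (e (1, 0)) (e (1, 0)) = pi\<^sup>2 / l\<^sup>2 * (l * d / 2)"
  "dirichlet_form \<Omega> (e (0, 1)) (e (0, 1)) = pi\<^sup>2 / (d\<^sup>2 * l) * I2 * (l * d / 2)"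
  "dirichlet_form \<Omega> (e (1, 0)) (e (0, 1)) = - (4 * pi / (l\<^sup>2 * d)) * S1 * (l * d / 2)"
proof -
  have s: "integral {0..L} (\<lambda>x. - (real 1 * pi / L) * sn L 1 x * (- (real 1 * pi / L) * sn L 1 x)) = (pi / L)\<^sup>2 * (L / 2)" if "L > 0" for L
  proof -
    have "(\<lambda>x. - (real 1 * pi / L) * sn L 1 x * (- (real 1 * pi / L) * sn L 1 x)) = (\<lambda>x. (pi / L)\<^sup>2 * (sn L 1 x * sn L 1 x))"
      by (simp add: power2_eq_square fun_eq_iff)
    then show ?thesis using integral_sn_sn[OF that, of 1 1] by (simp add: nrm_def)
  qed
  show "dirichlet_form \<Omega> (e (1, 0)) (e (1, 0)) = pi\<^sup>2 / l\<^sup>2 * (l * d / 2)"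
    unfolding dirichlet_e s[OF l] using d by (simp add: cs_0 power_divide)
  show "dirichlet_form \<Omega> (e (0, 1)) (e (0, 1)) = pi\<^sup>2 / (d\<^sup>2 * l) * I2 * (l * d / 2)"
    unfolding dirichlet_e s[OF d] using l d by (simp add: cs_0 power_divide)
  have "integral {0..l} (\<lambda>x. g' x * (- (real 1 * pi / l) * sn l 1 x) * cs l 0 x) = - (pi / l) * S1"
  proof -
    have "(\<lambda>x. g' x * (- (real 1 * pi / l) * sn l 1 x) * cs l 0 x) = (\<lambda>x. - (pi / l) * (g' x * sin (pi * x / l)))"
      by (simp add: fun_eq_iff cs_0 sn_def mult_ac)
    then show ?thesis by simp
  qed
  moreover have "integral {0..d} (\<lambda>t. cs d 0 t * (- (real 1 * pi / d) * sn d 1 t)) = - 2"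
    using integral_sn_odd[OF d, of 1] by (simp add: cs_0)
  ultimately show "dirichlet_form \<Omega> (e (1, 0)) (e (0, 1)) = - (4 * pi / (l\<^sup>2 * d)) * S1 * (l * d / 2)"
    unfolding dirichlet_e using l d by (simp add: cs_0 power2_eq_square field_simps)
qed

definition trial :: "real \<Rightarrow> real \<Rightarrow> real \<times> real \<Rightarrow> real" where
  "trial a b z = a * e (1, 0) z + b * e (0, 1) z"

lemma trial_H1: "trial a b \<in> H1 \<Omega>"
  unfolding trial_def[abs_def] by (rule H1_lincomb[OF e_H1 e_H1])

lemma ip_trial: "w \<in> L2 M \<Longrightarrow> ip M (trial a b) w = a * ip M (e (1, 0)) w + b * ip M (e (0, 1)) w"
  unfolding trial_def[abs_def] by (rule ip_lincomb[OF e_L2 e_L2])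

lemma dirichlet_form_trial:
  "w \<in> H1 \<Omega> \<Longrightarrow> dirichlet_form \<Omega> (trial a b) w = a * dirichlet_form \<Omega> (e (1, 0)) w + b * dirichlet_form \<Omega> (e (0, 1)) w"
  unfolding trial_def[abs_def] by (rule dirichlet_form_lincomb[OF e_H1 e_H1])

lemma trial_const: "ip M (trial a b) (e (0, 0)) = 0"
  by (simp add: ip_trial e_L2 e_orth)

lemma trial_norm: "ip M (trial a b) (trial a b) = (a\<^sup>2 + b\<^sup>2) * (l * d / 2)"
proof -
  have sym: "ip M (e i) (trial a b) = ip M (trial a b) (e i)" for i
    by (rule Bochner_Integration.integral_cong) (auto simp: mult.commute)
  show ?thesis
    unfolding ip_trial[OF H1_L2[OF trial_H1]] sym ip_trial[OF e_L2] e_orth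
    by (simp add: nu_def nrm_def power2_eq_square distrib_right)
qed

lemma trial_energy: "dirichlet_form \<Omega> (trial a b) (trial a b)
    = (pi\<^sup>2 / l\<^sup>2 * a\<^sup>2 + 2 * (- (4 * pi / (l\<^sup>2 * d)) * S1) * (a * b) + pi\<^sup>2 / (d\<^sup>2 * l) * I2 * b\<^sup>2) * (l * d / 2)"
proof -
  have sym: "dirichlet_form \<Omega> u v = dirichlet_form \<Omega> v u" for u v by (simp add: dirichlet_form_def inner_commute)
  have "dirichlet_form \<Omega> (trial a b) (trial a b)
     = a * (a * dirichlet_form \<Omega> (e (1, 0)) (e (1, 0)) + b * dirichlet_form \<Omega> (e (1, 0)) (e (0, 1)))
     + b * (a * dirichlet_form \<Omega> (e (1, 0)) (e (0, 1)) + b * dirichlet_form \<Omega> (e (0, 1)) (e (0, 1)))"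
    unfolding dirichlet_form_trial[OF trial_H1] sym[of "e (1, 0)" "trial a b"] sym[of "e (0, 1)" "trial a b"]
      dirichlet_form_trial[OF e_H1] sym[of "e (0, 1)" "e (1, 0)"] ..
  moreover have "a * (a * (P * n) + b * (R * n)) + b * (a * (R * n) + b * (Q * n)) = (P * a\<^sup>2 + 2 * R * (a * b) + Q * b\<^sup>2) * n"
    for P Q R n :: real by (simp add: algebra_simps power2_eq_square)
  ultimately show ?thesis unfolding dirichlet_trial by (simp only:)
qed

end

section \<open>Spectrum and rigidity\<close>

context strip
begin

text \<open>Successive minimisation in the complement of the normalised constant \<open>e0\<close>,
  and then of \<open>e0\<close> and the first minimiser \<open>u1\<close>. The bound for the third
  eigenvalue is the min-max argument: a two-dimensional trial space orthogonal to the constants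
  contains a nonzero element that is orthogonal to \<open>u1\<close> as well.\<close>

lemma spectrum:
  shows "\<exists>v. nf.eigvec (neumann_eigenvalue \<Omega> 2) v \<and> ip M v v = 1 \<and> ip M v (e (0, 0)) = 0"
    and "w \<in> H1 \<Omega> \<Longrightarrow> ip M w (e (0, 0)) = 0 \<Longrightarrow> neumann_eigenvalue \<Omega> 2 * ip M w w \<le> dirichlet_form \<Omega> w w"
    and "w \<in> H1 \<Omega> \<Longrightarrow> ip M w (e (0, 0)) = 0 \<Longrightarrow> dirichlet_form \<Omega> w w = neumann_eigenvalue \<Omega> 2 * ip M w w
      \<Longrightarrow> nf.eigvec (neumann_eigenvalue \<Omega> 2) w"
    and "\<exists>a b. (a \<noteq> 0 \<or> b \<noteq> 0) \<and>
      neumann_eigenvalue \<Omega> 3 * ip M (trial a b) (trial a b) \<le> dirichlet_form \<Omega> (trial a b) (trial a b)"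
proof -
  \<comment> \<open>Normalises \<open>e (0, 0)\<close>, the constant 1, whose squared norm is the
    area \<open>l * d\<close>.\<close>
  define c where "c = 1 / sqrt (l * d)"
  have c: "c * c * (l * d) = 1" "c \<noteq> 0" using l d by (auto simp: c_def)
  define e0 where "e0 z = c * e (0, 0) z" for z
  have e0V: "e0 \<in> H1 \<Omega>" unfolding e0_def[abs_def] by (rule nf.V_scale[OF e_H1])
  have ip_e0: "ip M w e0 = c * ip M w (e (0, 0))" for w
    by (simp add: e0_def mult.left_commute)
  have e0e0: "ip M e0 e0 = 1"
  proof -
    have "ip M e0 e0 = c * c * ip M (e (0, 0)) (e (0, 0))" by (simp add: e0_def mult_ac)
    then show ?thesis using c(1) by (simp add: e_orth nu_def nrm_def)
  qed
  have eig0: "nf.eigvec 0 e0"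
    unfolding nf.eigvec_def using e0V nf.a_scale[OF e_H1, of _ c "(0, 0)"] dirichlet_const
    by (simp add: e0_def[abs_def])
  have orth: "nf.orth {e0} = {w \<in> H1 \<Omega>. ip M w (e (0, 0)) = 0}"
    using c(2) by (auto simp: nf.orth_def ip_e0)
  have e1: "e (1, 0) \<in> nf.orth {e0}" "ip M (e (1, 0)) (e (1, 0)) > 0"
    unfolding orth using nu_pos[of "(1, 0)"] by (auto simp: e_orth e_H1)
  have e0V': "{e0} \<subseteq> H1 \<Omega>" using e0V by simp
  obtain u1 where u1: "u1 \<in> nf.orth {e0}" "ip M u1 u1 = 1"
    "\<And>w. w \<in> nf.orth {e0} \<Longrightarrow> dirichlet_form \<Omega> w w \<ge> dirichlet_form \<Omega> u1 u1 * ip M w w"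
    using nf.minimiser_exists[OF e0V' e1] by blast
  define \<mu>2 where "\<mu>2 = dirichlet_form \<Omega> u1 u1"
  note min1 = u1(3)[folded \<mu>2_def]
  have eig1: "nf.eigvec \<mu>2 w" if w: "w \<in> nf.orth {e0}" "dirichlet_form \<Omega> w w = \<mu>2 * ip M w w" for w
  proof (rule nf.eigvec_of_orth[where k=1 and \<mu>="\<lambda>_. 0" and e="\<lambda>_. e0"])
    have im: "(\<lambda>_. e0) ` {..<1::nat} = {e0}" by auto
    show "w \<in> nf.orth ((\<lambda>_. e0) ` {..<1::nat})" unfolding im by (rule w)
    show "dirichlet_form \<Omega> w v = \<mu>2 * ip M w v" if "v \<in> nf.orth ((\<lambda>_. e0) ` {..<1::nat})" for v
      by (rule nf.minimiser_stationary[OF e0V' w(1) min1 w(2)]) (use that im in simp_all)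
  qed (use eig0 e0e0 in auto)
  have u1V: "u1 \<in> H1 \<Omega>" and u1e: "ip M u1 (e (0, 0)) = 0" using u1(1) unfolding orth by auto
  have eigu1: "nf.eigvec \<mu>2 u1" by (rule eig1[OF u1(1)]) (simp add: u1(2) \<mu>2_def)
  have u1e0: "ip M u1 e0 = 0" "ip M e0 u1 = 0"
    using u1e nf.b_sym[OF e0V u1V] by (auto simp: ip_e0)
  define p where "p = ip M (e (1, 0)) u1"
  define q where "q = ip M (e (0, 1)) u1"
  \<comment> \<open>One linear equation in two unknowns: orthogonality of \<open>trial x y\<close>
    to \<open>u1\<close>.\<close>
  obtain x y where xy: "x \<noteq> 0 \<or> y \<noteq> 0" "x * p + y * q = 0"
  proof (cases "p = 0 \<and> q = 0")
    case True
    then show ?thesis by (intro that[of 1 0]) auto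
  next
    case False
    then show ?thesis by (intro that[of q "- p"]) auto
  qed
  let ?E = "{e0, u1}"
  have EV: "?E \<subseteq> H1 \<Omega>" using e0V u1V by auto
  have tO: "trial x y \<in> nf.orth ?E"
    using xy(2) by (simp add: nf.orth_def trial_H1 ip_e0 trial_const ip_trial[OF H1_L2[OF u1V]] p_def q_def)
  have "x\<^sup>2 + y\<^sup>2 > 0" using xy(1) by (simp add: sum_power2_gt_zero_iff)
  then have tpos: "ip M (trial x y) (trial x y) > 0" unfolding trial_norm using l d by simp
  obtain u2 where u2: "u2 \<in> nf.orth ?E" "ip M u2 u2 = 1"
    "\<And>w. w \<in> nf.orth ?E \<Longrightarrow> dirichlet_form \<Omega> w w \<ge> dirichlet_form \<Omega> u2 u2 * ip M w w"
    using nf.minimiser_exists[OF EV tO tpos] by blast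
  define \<mu>3 where "\<mu>3 = dirichlet_form \<Omega> u2 u2"
  note min2 = u2(3)[folded \<mu>3_def]
  have u2V: "u2 \<in> H1 \<Omega>" and u2e: "ip M u2 e0 = 0" "ip M u2 u1 = 0" using u2(1) by (auto simp: nf.orth_def)
  have u2e': "ip M e0 u2 = 0" "ip M u1 u2 = 0" using u2e nf.b_sym[OF u2V e0V] nf.b_sym[OF u2V u1V] by auto
  have \<mu>0: "0 \<le> \<mu>2" unfolding \<mu>2_def by (rule nf.a_nonneg[OF u1V])
  have \<mu>23: "\<mu>2 \<le> \<mu>3" using min1[of u2] u2V u2e(1) by (simp add: nf.orth_def u2(2) \<mu>3_def)
  have two: "{..<2::nat} = {0, 1}" by auto
  have im2: "(\<lambda>i. if i = 0 then e0 else u1) ` {..<2::nat} = ?E"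
    unfolding two by (simp add: insert_commute)
  have eigu2: "nf.eigvec \<mu>3 u2"
  proof (rule nf.eigvec_of_orth[where k=2 and \<mu>="\<lambda>i. if i = 0 then 0 else \<mu>2" and e="\<lambda>i. if i = 0 then e0 else u1"])
    show "u2 \<in> nf.orth ((\<lambda>i. if i = 0 then e0 else u1) ` {..<2::nat})" unfolding im2 by (rule u2)
    show "dirichlet_form \<Omega> u2 v = \<mu>3 * ip M u2 v" if "v \<in> nf.orth ((\<lambda>i. if i = 0 then e0 else u1) ` {..<2::nat})" for v
      by (rule nf.minimiser_stationary[OF EV u2(1) min2]) (use that im2 in \<open>simp_all add: u2(2) \<mu>3_def\<close>)
  qed (use eig0 eigu1 e0e0 u1e0 u1(2) in auto)
  \<comment> \<open>Indexed from 0, so that \<open>Suc 1\<close> and \<open>Suc 2\<close> give the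
    second and the third eigenvalue.\<close>
  define ee where "ee = (\<lambda>i::nat. if i = 0 then e0 else if i = 1 then u1 else u2)"
  define mm where "mm = (\<lambda>i::nat. if i = 0 then 0 else if i = 1 then \<mu>2 else \<mu>3)"
  have ee: "ee 0 = e0" "ee 1 = u1" "ee 2 = u2" and mm: "mm 0 = 0" "mm 1 = \<mu>2" "mm 2 = \<mu>3"
    by (auto simp: ee_def mm_def)
  have cases: "i = 0 \<or> i = 1 \<or> i = 2" if "i \<le> 2" for i :: nat using that by auto
  have "neumann_eigenvalue \<Omega> (Suc 1) = mm 1"
  proof (rule nf.neumann_eigenvalue_eq[where e=ee])
    have im: "ee ` {..<1} = {e0}" by (auto simp: ee_def)
    show "mm 1 * ip M v v \<le> dirichlet_form \<Omega> v v" if "v \<in> nf.orth (ee ` {..<1})" for v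
      using min1[of v] that unfolding im mm by simp
    show "nf.eigvec (mm i) (ee i)" if "i \<le> 1" for i
      using that eig0 eigu1 by (auto simp: ee_def mm_def)
    show "mm i \<le> mm 1" if "i \<le> 1" for i
      using that \<mu>0 by (auto simp: mm_def)
    show "ip M (ee i) (ee j) = (if i = j then 1 else 0)" if "i \<le> 1" "j \<le> 1" for i j
    proof -
      have "i = 0 \<or> i = 1" "j = 0 \<or> j = 1" using that by auto
      then show ?thesis using e0e0 u1e0 u1(2) by (elim disjE) (simp_all only: ee, simp_all)
    qed
  qed
  then have n2: "neumann_eigenvalue \<Omega> 2 = \<mu>2" by (simp add: mm_def numeral_2_eq_2)
  have "neumann_eigenvalue \<Omega> (Suc 2) = mm 2"
  proof (rule nf.neumann_eigenvalue_eq[where e=ee])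
    have im: "ee ` {..<2} = ?E"
      unfolding two by (simp add: ee_def insert_commute)
    show "mm 2 * ip M v v \<le> dirichlet_form \<Omega> v v" if "v \<in> nf.orth (ee ` {..<2})" for v
      using min2[of v] that unfolding im mm by simp
    show "nf.eigvec (mm i) (ee i)" if "i \<le> 2" for i
      using cases[OF that] eig0 eigu1 eigu2 by (auto simp only: ee mm)
    show "mm i \<le> mm 2" if "i \<le> 2" for i
      using cases[OF that] \<mu>0 \<mu>23 mm by auto
    show "ip M (ee i) (ee j) = (if i = j then 1 else 0)" if "i \<le> 2" "j \<le> 2" for i j
      using cases[OF that(1)] cases[OF that(2)] e0e0 u1e0 u1(2) u2e u2e' u2(2)
      by (elim disjE) (simp_all only: ee, simp_all)
  qed
  then have n3: "neumann_eigenvalue \<Omega> 3 = \<mu>3" by (simp add: mm_def numeral_3_eq_3 numeral_2_eq_2)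
  show "\<exists>v. nf.eigvec (neumann_eigenvalue \<Omega> 2) v \<and> ip M v v = 1 \<and> ip M v (e (0, 0)) = 0"
    unfolding n2 using eigu1 u1(2) u1e by (intro exI[of _ u1]) simp
  show "neumann_eigenvalue \<Omega> 2 * ip M w w \<le> dirichlet_form \<Omega> w w" if "w \<in> H1 \<Omega>" "ip M w (e (0, 0)) = 0"
    unfolding n2 by (rule min1) (use that in \<open>simp add: orth\<close>)
  show "nf.eigvec (neumann_eigenvalue \<Omega> 2) w"
    if "w \<in> H1 \<Omega>" "ip M w (e (0, 0)) = 0" "dirichlet_form \<Omega> w w = neumann_eigenvalue \<Omega> 2 * ip M w w"
    unfolding n2 by (rule eig1[OF _ that(3)[unfolded n2]]) (use that in \<open>simp add: orth\<close>)
  show "\<exists>a b. (a \<noteq> 0 \<or> b \<noteq> 0) \<and>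
      neumann_eigenvalue \<Omega> 3 * ip M (trial a b) (trial a b) \<le> dirichlet_form \<Omega> (trial a b) (trial a b)"
    unfolding n3 using xy(1) min2[OF tO] by (intro exI[of _ x] exI[of _ y]) simp
qed

text \<open>Suitable test functions isolate a single term of the eigenvalue equation, an integral of
  \<open>g'\<close>, or of \<open>g'\<close> times a sine, against an arbitrary polynomial. Which
  term is isolated depends on which coefficient is nonzero.\<close>

lemma trial_eigvec_imp_flat:
  assumes eig: "nf.eigvec \<mu> (trial a b)" and ab: "a \<noteq> 0 \<or> b \<noteq> 0" and x: "x \<in> {0..l}"
  shows "g' x = 0"
proof -
  have g'c': "continuous_on {0..l} g'" using g'c continuous_on_subset by blast
  have eq: "a * dirichlet_form \<Omega> (e (1, 0)) w + b * dirichlet_form \<Omega> (e (0, 1)) w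
      = \<mu> * (a * ip M (e (1, 0)) w + b * ip M (e (0, 1)) w)" if "w \<in> H1 \<Omega>" for w
    using eig that unfolding nf.eigvec_def ip_trial[OF H1_L2[OF that], symmetric] dirichlet_form_trial[OF that, symmetric] by blast
  show ?thesis
  proof (cases "a = 0")
    case False
    have 0: "g' x * sn l 1 x = 0" if "x \<in> {0..l}" for x
    proof (rule continuous_zero_of_polynomials[OF _ l _ that])
      show "continuous_on {0..l} (\<lambda>x. g' x * sn l 1 x)"
        by (intro continuous_on_mult g'c' continuous_on_subset[OF sn_cont]) simp
      fix q :: "real \<Rightarrow> real" assume q: "real_polynomial_function q"
      obtain q' where q': "\<And>x. (q has_real_derivative q' x) (at x)" "smooth q'"
        using smooth_derivE[OF smooth_polynomial[OF q]] by blast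
      note qc = smooth_continuous[OF smooth_polynomial[OF q]] smooth_continuous[OF q'(2)]
      \<comment> \<open>The third cosine is orthogonal to the constants and to the first cosine, and
        its pairings with the energy of \<open>e (0, 1)\<close> vanish, so \<open>b\<close> and
        \<mu> drop out. Since 3 is odd, its derivative has a nonzero integral and the term with
        \<open>g'\<close> stays.\<close>
      let ?w = "V q (cs d 3)"
      have w: "?w \<in> H1 \<Omega>"
        using V_has_weak_gradient[OF q'(1) qc(2) DERIV_cs deriv_cont] by (auto simp: H1_def)
      have i: "integral {0..d} (\<lambda>t. cs d 0 t * cs d 3 t) = 0" "integral {0..d} (\<lambda>t. cs d 1 t * cs d 3 t) = 0"
        unfolding integral_cs_cs[OF d] by auto
      have j: "integral {0..d} (\<lambda>t. cs d 0 t * (- (real 3 * pi / d) * sn d 3 t)) = - 2"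
        using integral_sn_odd[OF d, of 3] by (simp add: cs_0)
      have k: "integral {0..d} (\<lambda>t. - (real 1 * pi / d) * sn d 1 t * cs d 3 t) = 0"
        using integral_sn1_cs3[OF d] by (simp add: mult.assoc)
      have m: "integral {0..d} (\<lambda>t. - (real 1 * pi / d) * sn d 1 t * (- (real 3 * pi / d) * sn d 3 t)) = 0"
      proof -
        have "(\<lambda>t. - (real 1 * pi / d) * sn d 1 t * (- (real 3 * pi / d) * sn d 3 t)) = (\<lambda>t. 3 * (pi / d)\<^sup>2 * (sn d 1 t * sn d 3 t))"
          by (simp add: fun_eq_iff power2_eq_square)
        then show ?thesis using integral_sn_sn[OF d, of 3 1] by simp
      qed
      have "dirichlet_form \<Omega> (e (1, 0)) ?w = 2 * integral {0..l} (\<lambda>x. g' x * (- (real 1 * pi / l) * sn l 1 x) * q x)"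
        unfolding e_def fst_conv snd_conv dirichlet_V[OF DERIV_cs deriv_cont DERIV_cs deriv_cont q'(1) qc(2) DERIV_cs deriv_cont] i j
        by simp
      moreover have "dirichlet_form \<Omega> (e (0, 1)) ?w = 0"
        unfolding e_def fst_conv snd_conv dirichlet_V[OF DERIV_cs deriv_cont DERIV_cs deriv_cont q'(1) qc(2) DERIV_cs deriv_cont] i k m
        by simp
      moreover have "ip M (e (1, 0)) ?w = 0" "ip M (e (0, 1)) ?w = 0"
        unfolding e_def fst_conv snd_conv ip_V[OF cs_cont cs_cont qc(1) cs_cont] i by simp_all
      ultimately have "integral {0..l} (\<lambda>x. g' x * (- (real 1 * pi / l) * sn l 1 x) * q x) = 0"
        using eq[OF w] False by simp
      moreover have "integral {0..l} (\<lambda>x. g' x * (- (real 1 * pi / l) * sn l 1 x) * q x) = - (pi / l) * integral {0..l} (\<lambda>x. g' x * sn l 1 x * q x)"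
        unfolding Henstock_Kurzweil_Integration.integral_mult_right[symmetric]
        by (rule Henstock_Kurzweil_Integration.integral_cong) simp
      ultimately have "- (pi / l) * integral {0..l} (\<lambda>x. g' x * sn l 1 x * q x) = 0" by (simp only:)
      then show "integral {0..l} (\<lambda>x. g' x * sn l 1 x * q x) = 0" using l by simp
    qed
    \<comment> \<open>The sine is positive inside the interval only; the end points follow by the
      continuity of \<open>g'\<close>.\<close>
    have in0: "g' x = 0" if "x \<in> {0<..<l}" for x
    proof -
      have "pi / l * x < pi / l * l" using that l by (intro mult_strict_left_mono) auto
      then have "sn l 1 x > 0" unfolding sn_def using that l by (intro sin_gt_zero) auto
      then show ?thesis using 0[of x] that by auto
    qed
    have cl: "closure {0<..<l} = {0..l}" using l by simp
    show ?thesis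
      by (rule continuous_constant_on_closure[of "{0<..<l}" g']) (use in0 g'c' x cl in auto)
  next
    case True
    then have b: "b \<noteq> 0" using ab by simp
    show ?thesis
    proof (rule continuous_zero_of_polynomials[OF g'c' l _ x])
      fix q :: "real \<Rightarrow> real" assume q: "real_polynomial_function q"
      \<comment> \<open>The equation contains the derivative of the test function, so an
        antiderivative makes the polynomial itself appear.\<close>
      obtain A where A: "\<And>x. (A has_real_derivative q x) (at x)" using polynomial_antiderivative[OF q, of 0] by blast
      have Ac: "continuous_on UNIV A" using A DERIV_continuous_on by blast
      note qc = smooth_continuous[OF smooth_polynomial[OF q]]
      let ?w = "V A (cs d 0)"
      have w: "?w \<in> H1 \<Omega>"
        using V_has_weak_gradient[OF A qc DERIV_cs deriv_cont] by (auto simp: H1_def)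
      have i: "integral {0..d} (\<lambda>t. cs d 1 t * cs d 0 t) = 0"
        unfolding integral_cs_cs[OF d] by auto
      have j: "integral {0..d} (\<lambda>t. - (real 1 * pi / d) * sn d 1 t * cs d 0 t) = - 2"
        using integral_sn_odd[OF d, of 1] by (simp add: cs_0)
      have "dirichlet_form \<Omega> (e (0, 1)) ?w = 2 * integral {0..l} (\<lambda>x. g' x * q x)"
        unfolding e_def fst_conv snd_conv dirichlet_V[OF DERIV_cs deriv_cont DERIV_cs deriv_cont A qc DERIV_cs deriv_cont] i j
        by (simp add: cs_0)
      moreover have "ip M (e (0, 1)) ?w = 0"
        unfolding e_def fst_conv snd_conv ip_V[OF cs_cont cs_cont Ac cs_cont] i by simp
      ultimately show "integral {0..l} (\<lambda>x. g' x * q x) = 0" using eq[OF w] True b by simp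
    qed
  qed
qed

text \<open>For \<open>g' = 0\<close> the system consists of eigenfunctions, and testing with
  \<open>e (k, m)\<close> shows that \<open>(k * pi / l)^2 + (m * pi / d)^2 - \<mu>\<close>
  annihilates the coefficient of \<open>v\<close>. For smaller \<mu> all nonconstant coefficients
  vanish, the constant one does by assumption, and completeness contradicts the norm 1.\<close>

lemma flat_eigenvalue_ge:
  assumes flat: "\<And>x. x \<in> {0..l} \<Longrightarrow> g' x = 0"
    and eig: "nf.eigvec \<mu> v" and v: "ip M v v = 1" "ip M v (e (0, 0)) = 0"
  shows "min (pi\<^sup>2 / l\<^sup>2) (pi\<^sup>2 / d\<^sup>2) \<le> \<mu>"
proof (rule ccontr)
  assume less: "\<not> min (pi\<^sup>2 / l\<^sup>2) (pi\<^sup>2 / d\<^sup>2) \<le> \<mu>"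
  have vV: "v \<in> H1 \<Omega>" using eig by (simp add: nf.eigvec_def)
  define G where "G = weak_gradient \<Omega> v"
  have G: "has_weak_gradient \<Omega> v G" unfolding G_def by (rule H1_weak_gradient[OF vV])
  have "ip M v (e i) = 0" for i
  proof -
    obtain k m where i: "i = (k, m)" by (cases i)
    let ?X' = "\<lambda>x. - (real k * pi / l) * sn l k x" and ?Y' = "\<lambda>x. - (real m * pi / d) * sn d m x"
    have "dirichlet_form \<Omega> v (e i) = (LINT z|M. fst (G z) * (V ?X' (cs d m) z - V (\<lambda>x. g' x * cs l k x) ?Y' z)) + ip M (\<lambda>z. snd (G z)) (V (cs l k) ?Y')"
      unfolding i e_def fst_conv snd_conv
      by (subst dirichlet_form_eq[OF G V_has_weak_gradient[OF DERIV_cs deriv_cont DERIV_cs deriv_cont]]) simp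
    also have "(LINT z|M. fst (G z) * (V ?X' (cs d m) z - V (\<lambda>x. g' x * cs l k x) ?Y' z)) = (LINT z|M. - (real k * pi / l) * (shear_grad G z * V (sn l k) (cs d m) z))"
    proof (rule Bochner_Integration.integral_cong[OF refl])
      fix z assume "z \<in> space M"
      then have "g' (fst z) = 0" by (intro flat) (auto simp: \<Omega>_def)
      then show "fst (G z) * (V ?X' (cs d m) z - V (\<lambda>x. g' x * cs l k x) ?Y' z) = - (real k * pi / l) * (shear_grad G z * V (sn l k) (cs d m) z)"
        by (simp add: V_def shear_grad_def)
    qed
    also have "\<dots> = (real k * pi / l) * ((real k * pi / l) * ip M v (e i))"
      unfolding i coefficient_x[OF G] by simp
    also have "ip M (\<lambda>z. snd (G z)) (V (cs l k) ?Y') = (LINT z|M. - (real m * pi / d) * (snd (G z) * V (cs l k) (sn d m) z))"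
      by (rule Bochner_Integration.integral_cong) (auto simp: V_def)
    also have "\<dots> = (real m * pi / d) * ((real m * pi / d) * ip M v (e i))"
      unfolding i coefficient_y[OF G] by simp
    finally have "((real k * pi / l)\<^sup>2 + (real m * pi / d)\<^sup>2 - \<mu>) * ip M v (e i) = 0"
      using eig e_H1[of i] by (simp add: nf.eigvec_def power2_eq_square algebra_simps)
    moreover have "(real k * pi / l)\<^sup>2 + (real m * pi / d)\<^sup>2 > \<mu>" if "i \<noteq> (0, 0)"
    proof (cases "k = 0")
      case True
      then have "1 \<le> real m" using that i by (cases m) auto
      then have "1 * (pi\<^sup>2 / d\<^sup>2) \<le> (real m)\<^sup>2 * (pi\<^sup>2 / d\<^sup>2)" by (intro mult_right_mono one_le_power) auto
      then show ?thesis using less True by (simp add: power_mult_distrib power_divide)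
    next
      case False
      then have "1 \<le> real k" by simp
      then have "1 * (pi\<^sup>2 / l\<^sup>2) \<le> (real k)\<^sup>2 * (pi\<^sup>2 / l\<^sup>2)" by (intro mult_right_mono one_le_power) auto
      moreover have "0 \<le> (real m * pi / d)\<^sup>2" by simp
      moreover have "(real k * pi / l)\<^sup>2 = (real k)\<^sup>2 * (pi\<^sup>2 / l\<^sup>2)"
        by (simp add: power_mult_distrib power_divide)
      ultimately have "pi\<^sup>2 / l\<^sup>2 \<le> (real k * pi / l)\<^sup>2 + (real m * pi / d)\<^sup>2" by linarith
      then show ?thesis using less by linarith
    qed
    ultimately show ?thesis using v(2) by (cases "i = (0, 0)") auto
  qed
  then have "AE z in M. v z = 0" by (rule cosine_complete[OF H1_L2[OF vV]])
  then have "ip M v v = 0" by (intro integral_eq_zero_AE) auto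
  then show False using v(1) by simp
qed

lemma flat_imp_rectangle:
  assumes flat: "\<And>x. x \<in> {0..l} \<Longrightarrow> g' x = 0"
  shows "is_rectangle \<Omega>"
proof -
  have g0: "g x = g 0" if x: "0 < x" "x < l" for x
  proof -
    obtain y where "0 < y" "y < x" "g x - g 0 = (x - 0) * g' y" using MVT2[OF x(1) g] by blast
    then show ?thesis using flat[of y] x by simp
  qed
  show ?thesis unfolding is_rectangle_def
  proof (intro exI conjI)
    show "\<Omega> = {(0, g 0) + s *\<^sub>R (1, 0) + t *\<^sub>R (0, 1) | s t. 0 < s \<and> s < l \<and> 0 < t \<and> t < d}"
    proof (intro equalityI subsetI)
      fix z assume "z \<in> \<Omega>"
      then have z: "0 < fst z" "fst z < l" "g 0 < snd z" "snd z < g 0 + d" using g0 by (auto simp: \<Omega>_def)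
      then show "z \<in> {(0, g 0) + s *\<^sub>R (1, 0) + t *\<^sub>R (0, 1) | s t. 0 < s \<and> s < l \<and> 0 < t \<and> t < d}"
        by (intro CollectI exI[of _ "fst z"] exI[of _ "snd z - g 0"]) (auto simp: prod_eq_iff)
    qed (auto simp: \<Omega>_def g0)
  qed (use l d in \<open>auto simp: norm_Pair\<close>)
qed

text \<open>A point of the rectangle may exchange one of its two rectangle coordinates with another
  point.  Applied to two points on a vertical segment of fixed length close to the left end of the
  strip, this leads out of the strip unless the rectangle is axis-parallel.\<close>

lemma rectangle_imp_flat:
  assumes rect: "is_rectangle \<Omega>" and x: "x \<in> {0..l}"
  shows "g' x = 0"
proof -
  obtain p E F a b where E: "norm E = 1" and F: "norm F = 1" and EF: "E \<bullet> F = 0"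
    and R: "\<Omega> = {p + s *\<^sub>R E + t *\<^sub>R F | s t. 0 < s \<and> s < a \<and> 0 < t \<and> t < b}"
    using rect unfolding is_rectangle_def by blast
  obtain p1 p2 E1 E2 F1 F2 where pr: "p = (p1, p2)" "E = (E1, E2)" "F = (F1, F2)"
    by (cases p, cases E, cases F) auto
  have n: "E1\<^sup>2 + E2\<^sup>2 = 1" "F1\<^sup>2 + F2\<^sup>2 = 1" "E1 * F1 + E2 * F2 = 0"
    using E F EF by (auto simp: pr norm_Pair inner_prod_def)
  have R': "(u, v) \<in> \<Omega> \<longleftrightarrow> (\<exists>s t. u = p1 + s * E1 + t * F1 \<and> v = p2 + s * E2 + t * F2 \<and> 0 < s \<and> s < a \<and> 0 < t \<and> t < b)" for u v
    unfolding R pr by auto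
  have \<Omega>': "(u, v) \<in> \<Omega> \<longleftrightarrow> 0 < u \<and> u < l \<and> g u < v \<and> v < g u + d" for u v by (simp add: \<Omega>_def)
  \<comment> \<open>The columns of an orthogonal matrix being orthonormal, its rows are orthogonal:
    \<open>E1 * E2 + F1 * F2 = 0\<close>.\<close>
  have rows: "F1 * F2 = - (E1 * E2)"
  proof -
    have "F1 * F2 = (E1\<^sup>2 + E2\<^sup>2) * (F1 * F2)" using n(1) by simp
    also have "\<dots> = (E1 * F1 + E2 * F2) * (E1 * F2 + E2 * F1) - E1 * E2 * (F1\<^sup>2 + F2\<^sup>2)"
      by (simp add: power2_eq_square algebra_simps)
    finally show ?thesis using n by simp
  qed
  have axis: "E1 * E2 = 0"
  proof (rule ccontr)
    assume ne: "E1 * E2 \<noteq> 0"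
    define \<delta> where "\<delta> = d / 2"
    \<comment> \<open>The exchanged points have the first coordinates
      \<open>u + \<delta> * (E1 * E2)\<close> and \<open>u - \<delta> * (E1 * E2)\<close>; for
      \<open>u\<close> below the size of this shift one of them is negative.\<close>
    define u where "u = min l (\<delta> * \<bar>E1 * E2\<bar>) / 2"
    have \<delta>: "\<delta> > 0" using d by (simp add: \<delta>_def)
    have u: "0 < u" "u < l" "u < \<delta> * \<bar>E1 * E2\<bar>" using l \<delta> ne by (auto simp: u_def min_def)
    have "(u, g u + d / 4) \<in> \<Omega>" "(u, g u + d / 4 + \<delta>) \<in> \<Omega>" using u d by (auto simp: \<Omega>' \<delta>_def)
    then obtain s t s' t' where s: "u = p1 + s * E1 + t * F1" "g u + d / 4 = p2 + s * E2 + t * F2" "0 < s" "s < a" "0 < t" "t < b"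
      and s': "u = p1 + s' * E1 + t' * F1" "g u + d / 4 + \<delta> = p2 + s' * E2 + t' * F2" "0 < s'" "s' < a" "0 < t'" "t' < b"
      unfolding R' by blast
    have x: "(s' - s) * E1 + (t' - t) * F1 = 0" and y: "(s' - s) * E2 + (t' - t) * F2 = \<delta>"
      using s s' by (auto simp: algebra_simps)
    have "s' - s = (s' - s) * (E1\<^sup>2 + E2\<^sup>2) + (t' - t) * (E1 * F1 + E2 * F2)" using n by simp
    also have "\<dots> = E1 * ((s' - s) * E1 + (t' - t) * F1) + E2 * ((s' - s) * E2 + (t' - t) * F2)"
      by (simp add: power2_eq_square algebra_simps)
    finally have ss: "s' = s + \<delta> * E2" unfolding x y by (simp add: algebra_simps)
    have "t' - t = (s' - s) * (E1 * F1 + E2 * F2) + (t' - t) * (F1\<^sup>2 + F2\<^sup>2)" using n by simp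
    also have "\<dots> = F1 * ((s' - s) * E1 + (t' - t) * F1) + F2 * ((s' - s) * E2 + (t' - t) * F2)"
      by (simp add: power2_eq_square algebra_simps)
    finally have tt: "t' = t + \<delta> * F2" unfolding x y by (simp add: algebra_simps)
    have "(p1 + s' * E1 + t * F1, p2 + s' * E2 + t * F2) \<in> \<Omega>" "(p1 + s * E1 + t' * F1, p2 + s * E2 + t' * F2) \<in> \<Omega>"
      unfolding R' using s s' by blast+
    then have "0 < p1 + s' * E1 + t * F1" "0 < p1 + s * E1 + t' * F1" by (auto simp: \<Omega>')
    moreover have "p1 + s' * E1 + t * F1 = u + \<delta> * (E1 * E2)" unfolding ss s(1) by (simp add: algebra_simps)
    moreover have "p1 + s * E1 + t' * F1 = u + \<delta> * (F1 * F2)" unfolding tt s(1) by (simp add: algebra_simps)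
    ultimately have "\<bar>\<delta> * (E1 * E2)\<bar> < u" unfolding rows by (simp add: abs_less_iff)
    then show False using u(3) \<delta> by (simp add: abs_mult)
  qed
  \<comment> \<open>Axis-parallel sides make the domain a product set, so first and second
    coordinates of its points combine freely.\<close>
  have mix: "(u, v') \<in> \<Omega>" if "(u, v) \<in> \<Omega>" "(u', v') \<in> \<Omega>" for u v u' v'
  proof -
    obtain s t s' t' where s: "u = p1 + s * E1 + t * F1" "v = p2 + s * E2 + t * F2" "0 < s" "s < a" "0 < t" "t < b"
      and s': "u' = p1 + s' * E1 + t' * F1" "v' = p2 + s' * E2 + t' * F2" "0 < s'" "s' < a" "0 < t'" "t' < b"
      using \<open>(u, v) \<in> \<Omega>\<close> \<open>(u', v') \<in> \<Omega>\<close> unfolding R' by blast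
    show ?thesis
    proof (cases "E1 = 0")
      case True
      then have "E2 \<noteq> 0" "F2 = 0" using n by auto
      then show ?thesis unfolding R' using True s s' by (intro exI[of _ s'] exI[of _ t]) auto
    next
      case False
      then have "E2 = 0" using axis by simp
      then have "F1 = 0" using n False by simp
      then show ?thesis unfolding R' using \<open>E2 = 0\<close> s s' by (intro exI[of _ s] exI[of _ t']) auto
    qed
  qed
  have le: "g u \<le> g v" if u: "0 < u" "u < l" and v: "0 < v" "v < l" for u v
  proof (rule ccontr)
    assume "\<not> g u \<le> g v"
    \<comment> \<open>A height inside the fibre over \<open>v\<close> but not above
      \<open>g u\<close>, hence outside the fibre over \<open>u\<close>.\<close>
    define y where "y = (g v + min (g u) (g v + d)) / 2"
    have y: "g v < y" "y < g v + d" "y \<le> g u" using \<open>\<not> g u \<le> g v\<close> d by (auto simp: y_def min_def)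
    have "(u, g u + d / 2) \<in> \<Omega>" "(v, y) \<in> \<Omega>" using u v y d by (auto simp: \<Omega>')
    from mix[OF this] show False using y(3) by (simp add: \<Omega>')
  qed
  have const: "g u = g (l / 2)" if "u \<in> {0<..<l}" for u
    using le[of u "l / 2"] le[of "l / 2" u] that l by auto
  have in0: "g' u = 0" if u: "u \<in> {0<..<l}" for u
  proof -
    have "(g has_real_derivative 0) (at u)"
    proof (rule has_field_derivative_transform_within_open[OF DERIV_const[of "g (l / 2)"]])
      show "g (l / 2) = g v" if "v \<in> {0<..<l}" for v by (rule const[OF that, symmetric])
    qed (use u in auto)
    then show ?thesis using DERIV_unique[OF g] by blast
  qed
  have "closure {0<..<l} = {0..l}" using l by simp
  moreover have "continuous_on {0..l} g'" using g'c continuous_on_subset by blast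
  ultimately show ?thesis
    using continuous_constant_on_closure[of "{0<..<l}" g' 0 x] in0 x by auto
qed

end

section \<open>The estimates\<close>

lemma entire_antiderivative:
  fixes f :: "real \<Rightarrow> real"
  assumes f: "continuous_on UNIV f"
  obtains F where "\<And>x. (F has_real_derivative f x) (at x)"
proof
  \<comment> \<open>The signed integral from 0 to \<open>x\<close>: for \<open>x \<noteq> 0\<close>
    one of the two intervals is empty and contributes 0.\<close>
  define F where "F x = integral {0..x} f - integral {x..0} f" for x
  show "(F has_real_derivative f x) (at x)" for x
  proof -
    define c where "c = \<bar>x\<bar> + 1"
    have c: "- c < x" "x < c" "c > 0" by (auto simp: c_def)
    have fi: "f integrable_on {p..q}" for p q
      by (rule integrable_continuous_real) (use f continuous_on_subset in blast)
    have "continuous_on {- c..c} f" using f continuous_on_subset by blast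
    then have "((\<lambda>u. integral {- c..u} f) has_real_derivative f x) (at x within {- c..c})"
      by (rule integral_has_real_derivative) (use c in auto)
    then have "((\<lambda>u. integral {- c..u} f) has_real_derivative f x) (at x)"
      using c by (simp add: at_within_Icc_at)
    then have d1: "((\<lambda>u. integral {- c..u} f - integral {- c..0} f) has_real_derivative f x - 0) (at x)"
      by (rule DERIV_diff) (rule DERIV_const)
    have e1: "integral {- c..y} f - integral {- c..0} f = F y" if "y \<in> {- c<..<c}" for y
    proof (cases "0 \<le> y")
      case True
      then have "integral {- c..0} f + integral {0..y} f = integral {- c..y} f"
        using c by (intro Henstock_Kurzweil_Integration.integral_combine fi) auto
      moreover have "integral {y..0} f = 0" using True by (cases "y = 0") auto
      ultimately show ?thesis by (simp add: F_def)
    next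
      case False
      then have "integral {- c..y} f + integral {y..0} f = integral {- c..0} f"
        using that by (intro Henstock_Kurzweil_Integration.integral_combine fi) auto
      then show ?thesis using False by (simp add: F_def)
    qed
    show ?thesis
    proof (rule has_field_derivative_transform_within_open)
      show "((\<lambda>u. integral {- c..u} f - integral {- c..0} f) has_real_derivative f x) (at x)" using d1 by simp
      show "integral {- c..y} f - integral {- c..0} f = F y" if "y \<in> {- c<..<c}" for y by (rule e1[OF that])
    qed (use c in auto)
  qed
qed

text \<open>Continuing \<open>g'\<close> by its boundary values keeps it continuous; its
  antiderivative agrees with \<open>g\<close> on \<open>{0..l}\<close>, where both have the same
  derivative and the same value at 0. This converts one-sided data into an instance of
  \<open>strip\<close>.\<close>

lemma C1_extension:
  fixes g g' :: "real \<Rightarrow> real"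
  assumes l: "0 < l" and g: "\<And>x. x \<in> {0..l} \<Longrightarrow> (g has_real_derivative g' x) (at x within {0..l})"
    and g': "continuous_on {0..l} g'"
  obtains G G' where "\<And>x. (G has_real_derivative G' x) (at x)" "continuous_on UNIV G'"
    "\<And>x. x \<in> {0..l} \<Longrightarrow> G x = g x" "\<And>x. x \<in> {0..l} \<Longrightarrow> G' x = g' x"
proof -
  define G' where "G' x = g' (max 0 (min l x))" for x
  have c: "continuous_on UNIV G'"
    unfolding G'_def by (rule continuous_on_compose2[OF g']) (use l in \<open>auto intro!: continuous_intros\<close>)
  have eq: "G' x = g' x" if "x \<in> {0..l}" for x using that by (simp add: G'_def)
  obtain F where F: "\<And>x. (F has_real_derivative G' x) (at x)" using entire_antiderivative[OF c] by blast
  define G where "G x = g 0 + (F x - F 0)" for x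
  have G: "(G has_real_derivative G' x) (at x)" for x
    using DERIV_add[OF DERIV_const[of "g 0"] DERIV_diff[OF F DERIV_const[of "F 0"]]] by (simp add: G_def[abs_def])
  have "G x - g x = G 0 - g 0" if x: "x \<in> {0..l}" for x
  proof -
    have d: "((\<lambda>x. G x - g x) has_real_derivative 0) (at y within {0..l})" if "y \<in> {0..l}" for y
      using DERIV_diff[OF has_field_derivative_at_within[OF G] g[OF that]] eq[OF that] by simp
    have "\<exists>k. \<forall>y\<in>{0..l}. G y - g y = k"
      by (rule has_field_derivative_zero_constant) (use d in auto)
    then show ?thesis using x l by (metis atLeastAtMost_iff less_imp_le order_refl)
  qed
  then have "G x = g x" if "x \<in> {0..l}" for x using that by (simp add: G_def)
  then show ?thesis using that G c eq by blast
qed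

text \<open>Everything sits in the chain \<mu>_2 \<le> \<open>(A + B - s) / 2\<close> \<le>
  \<open>min A B\<close>. On a rectangle \<open>B = pi^2 / d^2\<close>, and
  \<open>flat_eigenvalue_ge\<close> closes the chain from below; conversely either equality makes a
  trial function an eigenfunction and forces \<open>g' = 0\<close>.\<close>

lemma (in strip) rayleigh_ritz_estimates:
  fixes A B c :: real
  defines "A \<equiv> pi\<^sup>2 / l\<^sup>2" and "B \<equiv> pi\<^sup>2 / (d\<^sup>2 * l) * I2" and "c \<equiv> - (4 * pi / (l\<^sup>2 * d)) * S1"
  defines "s \<equiv> sqrt ((A - B)\<^sup>2 + 4 * c\<^sup>2)"
  shows "neumann_eigenvalue \<Omega> 2 \<le> (A + B - s) / 2" (is ?t1)
    and "neumann_eigenvalue \<Omega> 3 \<le> (A + B + s) / 2" (is ?t2)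
    and "neumann_eigenvalue \<Omega> 2 \<le> min A B" (is ?t3)
    and "(neumann_eigenvalue \<Omega> 2 + neumann_eigenvalue \<Omega> 3) / 2 \<le> (A + B) / 2" (is ?t4)
    and "neumann_eigenvalue \<Omega> 2 = (A + B - s) / 2 \<longleftrightarrow> is_rectangle \<Omega>" (is ?t5)
    and "neumann_eigenvalue \<Omega> 2 = min A B \<longleftrightarrow> is_rectangle \<Omega>" (is ?t6)
proof -
  define \<mu>2 where "\<mu>2 = neumann_eigenvalue \<Omega> 2"
  define \<mu>3 where "\<mu>3 = neumann_eigenvalue \<Omega> 3"
  note min = spectrum(2)[folded \<mu>2_def] and eig = spectrum(3)[folded \<mu>2_def] and tr = spectrum(4)[folded \<mu>3_def]
  note \<mu> = \<mu>2_def[symmetric] \<mu>3_def[symmetric]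
  obtain v where v: "nf.eigvec \<mu>2 v" "ip M v v = 1" "ip M v (e (0, 0)) = 0"
    using spectrum(1) unfolding \<mu>(1) by blast
  have n: "l * d / 2 > 0" using l d by simp
  have pos: "x\<^sup>2 + y\<^sup>2 > 0" if "x \<noteq> 0 \<or> y \<noteq> 0" for x y :: real using that by (simp add: sum_power2_gt_zero_iff)
  note energy = trial_energy[folded A_def B_def c_def]
  note q = quadratic_form_bounds[where A=A and B=B and c=c, folded s_def]
  obtain x y where xy: "x \<noteq> 0 \<or> y \<noteq> 0" "A * x\<^sup>2 + 2 * c * (x * y) + B * y\<^sup>2 = (A + B - s) / 2 * (x\<^sup>2 + y\<^sup>2)"
    using q(2) by blast
  have E: "dirichlet_form \<Omega> (trial x y) (trial x y) = (A + B - s) / 2 * ip M (trial x y) (trial x y)"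
    unfolding energy xy(2) trial_norm by simp
  have N: "ip M (trial x y) (trial x y) > 0" unfolding trial_norm using n pos[OF xy(1)] by simp
  have "\<mu>2 * ip M (trial x y) (trial x y) \<le> (A + B - s) / 2 * ip M (trial x y) (trial x y)"
    using min[OF trial_H1 trial_const, of x y] unfolding E .
  then have m2: "\<mu>2 \<le> (A + B - s) / 2" using N by simp
  then show ?t1 by (simp add: \<mu>)
  obtain a b where ab: "a \<noteq> 0 \<or> b \<noteq> 0" "\<mu>3 * ip M (trial a b) (trial a b) \<le> dirichlet_form \<Omega> (trial a b) (trial a b)"
    using tr by blast
  have "dirichlet_form \<Omega> (trial a b) (trial a b) \<le> (A + B + s) / 2 * (a\<^sup>2 + b\<^sup>2) * (l * d / 2)"
    unfolding energy using q(1)[of a b] n by (intro mult_right_mono) auto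
  also have "\<dots> = (A + B + s) / 2 * ip M (trial a b) (trial a b)" unfolding trial_norm by simp
  finally have "\<mu>3 * ip M (trial a b) (trial a b) \<le> (A + B + s) / 2 * ip M (trial a b) (trial a b)" using ab(2) by linarith
  moreover have "ip M (trial a b) (trial a b) > 0" unfolding trial_norm using n pos[OF ab(1)] by simp
  ultimately have m3: "\<mu>3 \<le> (A + B + s) / 2" by simp
  then show ?t2 by (simp add: \<mu>)
  show ?t3 using m2 q(3) by (simp add: \<mu>)
  show ?t4 using m2 m3 by (simp add: \<mu> field_simps)
  have rect: "is_rectangle \<Omega>" if "\<mu>2 = (A + B - s) / 2"
  proof (rule flat_imp_rectangle)
    have "nf.eigvec \<mu>2 (trial x y)" by (rule eig[OF trial_H1 trial_const E[folded that]])
    then show "g' t = 0" if "t \<in> {0..l}" for t by (rule trial_eigvec_imp_flat[OF _ xy(1) that])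
  qed
  have flat: "\<mu>2 = (A + B - s) / 2 \<and> \<mu>2 = min A B" if R: "is_rectangle \<Omega>"
  proof -
    have g'0: "g' t = 0" if "t \<in> {0..l}" for t by (rule rectangle_imp_flat[OF R that])
    have "I2 = integral {0..l} (\<lambda>x. 1)" by (rule Henstock_Kurzweil_Integration.integral_cong) (simp add: g'0)
    then have "I2 = l" using l by simp
    then have "B = pi\<^sup>2 / d\<^sup>2" using l by (simp add: B_def)
    then have "min A B \<le> \<mu>2" using flat_eigenvalue_ge[OF g'0 v] by (simp add: A_def)
    then show ?thesis using m2 q(3) by linarith
  qed
  have rect': "is_rectangle \<Omega>" if "\<mu>2 = min A B"
    by (rule rect) (use that m2 q(3) in linarith)
  show ?t5 unfolding \<mu> using rect flat by blast
  show ?t6 unfolding \<mu> using rect' flat by blast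
qed

theorem theorem4p2:
  fixes l d lam_minus lam_plus :: real
    and g h g' h' :: "real \<Rightarrow> real"
    and \<Omega> :: "(real \<times> real) set"
  assumes l_pos: "0 < l"
    and g_deriv: "\<And>x. x \<in> {0..l} \<Longrightarrow> (g has_real_derivative g' x) (at x within {0..l})"
    and g'_cont: "continuous_on {0..l} g'"
    and h_deriv: "\<And>x. x \<in> {0..l} \<Longrightarrow> (h has_real_derivative h' x) (at x within {0..l})"
    and h'_cont: "continuous_on {0..l} h'"
    and d_const: "\<And>x. x \<in> {0..l} \<Longrightarrow> h x - g x = d"
    and d_pos: "0 < d"
    and \<Omega>_eq: "\<Omega> = {(x, y). 0 < x \<and> x < l \<and> g x < y \<and> y < h x}"
    and lam_minus_eq: "lam_minus = pi\<^sup>2 / (2 * l * d) *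
          (d / l + 1 / d * integral {0..l} (\<lambda>x. 1 + (g' x)\<^sup>2)
           - sqrt ((d / l - 1 / d * integral {0..l} (\<lambda>x. 1 + (g' x)\<^sup>2))\<^sup>2
                   + 64 / (pi\<^sup>2 * l\<^sup>2) * (integral {0..l} (\<lambda>x. g' x * sin (pi * x / l)))\<^sup>2))"
    and lam_plus_eq: "lam_plus = pi\<^sup>2 / (2 * l * d) *
          (d / l + 1 / d * integral {0..l} (\<lambda>x. 1 + (g' x)\<^sup>2)
           + sqrt ((d / l - 1 / d * integral {0..l} (\<lambda>x. 1 + (g' x)\<^sup>2))\<^sup>2
                   + 64 / (pi\<^sup>2 * l\<^sup>2) * (integral {0..l} (\<lambda>x. g' x * sin (pi * x / l)))\<^sup>2))"
  shows "neumann_eigenvalue \<Omega> 2 \<le> lam_minus \<and> neumann_eigenvalue \<Omega> 3 \<le> lam_plus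
    \<and> neumann_eigenvalue \<Omega> 2
        \<le> min (pi\<^sup>2 / l\<^sup>2) (pi\<^sup>2 / (d\<^sup>2 * l) * integral {0..l} (\<lambda>x. 1 + (g' x)\<^sup>2))
    \<and> (neumann_eigenvalue \<Omega> 2 + neumann_eigenvalue \<Omega> 3) / 2
        \<le> pi\<^sup>2 / 2 * (1 / l\<^sup>2 + 1 / (l * d\<^sup>2) * integral {0..l} (\<lambda>x. 1 + (g' x)\<^sup>2))
    \<and> (neumann_eigenvalue \<Omega> 2 = lam_minus \<longleftrightarrow> is_rectangle \<Omega>)
    \<and> (neumann_eigenvalue \<Omega> 2
         = min (pi\<^sup>2 / l\<^sup>2) (pi\<^sup>2 / (d\<^sup>2 * l) * integral {0..l} (\<lambda>x. 1 + (g' x)\<^sup>2))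
        \<longleftrightarrow> is_rectangle \<Omega>)"
proof -
  obtain G G' where G: "\<And>x. (G has_real_derivative G' x) (at x)" "continuous_on UNIV G'"
    and eq: "\<And>x. x \<in> {0..l} \<Longrightarrow> G x = g x" "\<And>x. x \<in> {0..l} \<Longrightarrow> G' x = g' x"
    using C1_extension[OF l_pos g_deriv g'_cont] by blast
  interpret strip l d G G' by unfold_locales (use l_pos d_pos G in auto)
  have h: "h x = G x + d" if "0 < x" "x < l" for x
    using d_const[of x] eq(1)[of x] that by simp
  \<comment> \<open>Outside \<open>{0..l}\<close> the extension may differ from \<open>g\<close>,
    but the domain only sees abscissae in between.\<close>
  have \<Omega>: "\<Omega> = strip.\<Omega> l d G"
  proof (rule set_eqI)
    fix z :: "real \<times> real"
    have "G (fst z) = g (fst z)" "h (fst z) = G (fst z) + d" if "0 < fst z" "fst z < l"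
      using h[OF that] eq(1)[of "fst z"] that by simp_all
    then show "z \<in> \<Omega> \<longleftrightarrow> z \<in> strip.\<Omega> l d G"
      by (cases "0 < fst z \<and> fst z < l") (auto simp: \<Omega>_eq \<Omega>_def case_prod_unfold)
  qed
  define I where "I = integral {0..l} (\<lambda>x. 1 + (g' x)\<^sup>2)"
  define S where "S = integral {0..l} (\<lambda>x. g' x * sin (pi * x / l))"
  have I: "integral {0..l} (\<lambda>x. 1 + (G' x)\<^sup>2) = I" and S: "integral {0..l} (\<lambda>x. G' x * sin (pi * x / l)) = S"
    unfolding I_def S_def by (rule Henstock_Kurzweil_Integration.integral_cong; simp add: eq)+
  define A where "A = pi\<^sup>2 / l\<^sup>2"
  define B where "B = pi\<^sup>2 / (d\<^sup>2 * l) * I"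
  define c where "c = - (4 * pi / (l\<^sup>2 * d)) * S"
  \<comment> \<open>The scale that turns \<open>d / l\<close> into \<open>A\<close> and
    \<open>(1 / d) * I\<close> into \<open>B\<close>; drawn into the square root it turns
    \<open>64 / (pi^2 * l^2) * S^2\<close> into \<open>4 * c^2\<close>.\<close>
  define k where "k = pi\<^sup>2 / (l * d)"
  have k: "k > 0" using l_pos d_pos by (simp add: k_def)
  have kA: "k * (d / l) = A" and kB: "k * (1 / d * I) = B"
    using l_pos d_pos by (simp_all add: k_def A_def B_def power2_eq_square)
  have "sqrt ((A - B)\<^sup>2 + 4 * c\<^sup>2) = sqrt (k\<^sup>2 * ((d / l - 1 / d * I)\<^sup>2 + 64 / (pi\<^sup>2 * l\<^sup>2) * S\<^sup>2))"
  proof (rule arg_cong[where f=sqrt])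
    have "4 * c\<^sup>2 = k\<^sup>2 * (64 / (pi\<^sup>2 * l\<^sup>2) * S\<^sup>2)"
      using l_pos d_pos by (simp add: c_def k_def power2_eq_square field_simps)
    moreover have "(A - B)\<^sup>2 = k\<^sup>2 * (d / l - 1 / d * I)\<^sup>2"
      unfolding kA[symmetric] kB[symmetric] by (simp add: power2_eq_square algebra_simps)
    ultimately show "(A - B)\<^sup>2 + 4 * c\<^sup>2 = k\<^sup>2 * ((d / l - 1 / d * I)\<^sup>2 + 64 / (pi\<^sup>2 * l\<^sup>2) * S\<^sup>2)"
      by (simp only: distrib_left)
  qed
  also have "\<dots> = k * sqrt ((d / l - 1 / d * I)\<^sup>2 + 64 / (pi\<^sup>2 * l\<^sup>2) * S\<^sup>2)"
    using k by (simp add: real_sqrt_mult)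
  finally have s: "k * sqrt ((d / l - 1 / d * I)\<^sup>2 + 64 / (pi\<^sup>2 * l\<^sup>2) * S\<^sup>2) = sqrt ((A - B)\<^sup>2 + 4 * c\<^sup>2)" ..
  have k2: "pi\<^sup>2 / (2 * l * d) * t = k * t / 2" for t by (simp add: k_def)
  have lm: "lam_minus = (A + B - sqrt ((A - B)\<^sup>2 + 4 * c\<^sup>2)) / 2"
    unfolding lam_minus_eq I_def[symmetric] S_def[symmetric] k2 right_diff_distrib distrib_left s kA kB
    by (simp add: diff_divide_distrib add_divide_distrib)
  have lp: "lam_plus = (A + B + sqrt ((A - B)\<^sup>2 + 4 * c\<^sup>2)) / 2"
    unfolding lam_plus_eq I_def[symmetric] S_def[symmetric] k2 distrib_left s kA kB
    by (simp add: diff_divide_distrib add_divide_distrib)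
  have AB: "pi\<^sup>2 / 2 * (1 / l\<^sup>2 + 1 / (l * d\<^sup>2) * I) = (A + B) / 2"
    by (simp add: A_def B_def field_simps)
  show ?thesis
    unfolding lm lp I_def[symmetric] AB A_def[symmetric] B_def[symmetric] \<Omega>
    using rayleigh_ritz_estimates[unfolded I S, folded A_def B_def c_def] by blast
qed

end
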